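(* Let $N=2$ and consider the Hamiltonian system $\partial_t U=\partial_x(B\,\mathsf E\mathcal H[U])$ described in the context. Assume: there exist an open set $\Omega\subset\mathbb R^{4}$ and a family of nonconstant periodic traveling profiles $\underline U$, of period $\Xi$, smoothly parametrized (together with $\Xi$) by $(\mu,\boldsymbol\lambda,c)\in\Omega\subset\mathbb R\times\mathbb R^2\times\mathbb R$, such that $$\mathsf E(\mathcal H+c\mathcal Q)[\underline U]=\boldsymbol\lambda,\qquad \underline U\cdot\mathsf E\mathcal H[\underline U]+\mathsf L\mathcal H[\underline U]+c\,\mathcal Q(\underline U)=\mu .$$ Let $D(z)=\det(\mathbf F(\Xi;z)-\mathbf F(0;z))$ be the Evans function defined in the context and let $\Theta(\mu,\boldsymbol\lambda,c)$ be the abbreviated action. Then, for real $r$, $$D(r)= r^{4}\,(-\det(B^{-1}))\,\det(\mathrm{Hess}\,\Theta)+o(r^{4})\quad (r\to0),\qquad D(r)>0\ \text{ for } r>0 \text{ large enough},$$ where $\mathrm{Hess}\,\Theta$ is the $4\times4$ Hessian of $\Theta$ at $(\mu,\boldsymbol\lambda,c)$. If $\det(\mathrm{Hess}\,\Theta)<0$, then the corresponding wave is spectrally unstable with respect to co-periodic perturbations.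
   Context: The unknown is $U=(v,u)^{\mathsf T}$, a function of $(x,t)$ with values in $\mathbb R^2$. The matrix $B$ is symmetric and nonsingular with $B^{-1}=\begin{pmatrix}a&b\\ b&0\end{pmatrix}$, $b\neq0$ (so $-\det(B^{-1})=b^2$). The Hamiltonian is $\mathcal H[U]=\mathcal H(U,U_x)=\mathcal I(v,u)+\mathcal E(v,v_x)$ with $\mathcal I,\mathcal E$ smooth, $\mathcal I$ strongly convex in $u$ ($\partial_u^2\mathcal I>0$) and $\mathcal E$ strongly convex in $v_x$ ($\partial^2_{v_x}\mathcal E>0$). The impulse is $\mathcal Q(U)=\tfrac12U\cdot B^{-1}U$. Notation: $(\mathsf E\mathcal H[U])_\alpha=\partial_{U_\alpha}\mathcal H-\mathrm D_x(\partial_{U_{\alpha,x}}\mathcal H)$ is the variational derivative ($\mathrm D_x$ the total derivative), and $\mathsf L\mathcal H[U]=\sum_\alpha U_{\alpha,x}\,\partial_{U_{\alpha,x}}\mathcal H-\mathcal H$. A profile $\underline U=(\underline v,\underline u)^{\mathsf T}$ with parameters $(\mu,\boldsymbol\lambda,c)$ gives the traveling wave $U(x,t)=\underline U(x-ct)$. Abbreviated action: $\Theta(\mu,\boldsymbol\lambda,c)=\int_0^{\Xi}\big(\mathcal H(\underline U,\underline U_x)+c\,\mathcal Q(\underline U)-\boldsymbol\lambda\cdot\underline U+\mu\big)\,dx$. Linearization: $\mathbf A=\mathrm{Hess}(\mathcal H+c\mathcal Q)[\underline U]$ is the second variational derivative, i.e. the self-adjoint differential operator $(\mathrm{Hess}\,\mathcal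 H[\underline U]U)_\alpha=\partial^2_{U_\alpha U_\beta}\mathcal H\,U_\beta+\partial^2_{U_\alpha U_{\beta,x}}\mathcal H\,U_{\beta,x}-\mathrm D_x\big(\partial^2_{U_{\alpha,x}U_\beta}\mathcal H\,U_\beta+\partial^2_{U_{\alpha,x}U_{\beta,x}}\mathcal H\,U_{\beta,x}\big)$ (coefficients evaluated at $\underline U$, summation over $\beta$), and $\mathrm{Hess}\,\mathcal Q=B^{-1}$. Set $\mathscr A=B\,\partial_x\mathbf A$, with $\Xi$-periodic coefficients. Evans function: the eigenvalue equation $\mathscr AU=zU$ is equivalent to a first-order linear system of four ODEs with $\Xi$-periodic coefficients for $(v,v_x,v_{xx},u)^{\mathsf T}$; $\mathbf F(\cdot;z)$ is its fundamental solution with $\mathbf F(0;z)=I_4$. Thus $D(z)=0$ iff there is a nontrivial $\Xi$-periodic solution of $\mathscr AU=zU$. The wave is spectrally stable with respect to co-periodic perturbations if the spectrum of $\mathscr A$ in $L^2(\mathbb R/\Xi\mathbb Z)$ is purely imaginary, and spectrally unstable otherwise. *)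

theory Defs
  imports "HOL-Analysis.Analysis" "HOL-Library.Landau_Symbols"
begin

primrec Ck_on :: "nat \<Rightarrow> 'a::real_normed_vector set \<Rightarrow> ('a \<Rightarrow> 'b::real_normed_vector) \<Rightarrow> bool" where
  "Ck_on 0 S f \<longleftrightarrow> continuous_on S f"
| "Ck_on (Suc k) S f \<longleftrightarrow>
     (\<forall>x\<in>S. f differentiable (at x)) \<and>
     (\<forall>h. Ck_on k S (\<lambda>x. frechet_derivative f (at x) h))"

(* intended for open S only, since the derivatives are unrestricted ones *)
definition smooth_on :: "'a::real_normed_vector set \<Rightarrow> ('a \<Rightarrow> 'b::real_normed_vector) \<Rightarrow> bool" where
  "smooth_on S f \<longleftrightarrow> (\<forall>k. Ck_on k S f)"

(* derivative in direction h; with h a coordinate vector this is a partial derivative *)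
definition pd :: "'a::real_normed_vector \<Rightarrow> ('a \<Rightarrow> real) \<Rightarrow> 'a \<Rightarrow> real" where
  "pd h f x = deriv (\<lambda>s. f (x + s *\<^sub>R h)) 0"

definition hessian_matrix :: "(real ^ 'n \<Rightarrow> real) \<Rightarrow> real ^ 'n \<Rightarrow> real ^ 'n ^ 'n" where
  "hessian_matrix f x = (\<chi> i j. pd (axis i 1) (pd (axis j 1) f) x)"


(* A density K depending on U and U_x is a function of the pair (U, U_x);
   dirU i and dirX i are the coordinate directions of U_i and U_{i,x}. *)

type_synonym density = "(real ^ 2) \<times> (real ^ 2) \<Rightarrow> real"

definition dirU :: "2 \<Rightarrow> (real ^ 2) \<times> (real ^ 2)" where
  "dirU i = (axis i 1, 0)"

definition dirX :: "2 \<Rightarrow> (real ^ 2) \<times> (real ^ 2)" where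
  "dirX i = (0, axis i 1)"

definition jet :: "(real \<Rightarrow> real ^ 2) \<Rightarrow> real \<Rightarrow> (real ^ 2) \<times> (real ^ 2)" where
  "jet U x = (U x, vector_derivative U (at x))"

(* E K[U]; the total derivative D_x of g(U,U_x) is the x-derivative of g along the jet *)
definition var_deriv :: "density \<Rightarrow> (real \<Rightarrow> real ^ 2) \<Rightarrow> real \<Rightarrow> real ^ 2" where
  "var_deriv K U x =
     (\<chi> i. pd (dirU i) K (jet U x) - deriv (\<lambda>y. pd (dirX i) K (jet U y)) x)"

(* L K[U] *)
definition legendre :: "density \<Rightarrow> (real \<Rightarrow> real ^ 2) \<Rightarrow> real \<Rightarrow> real" where
  "legendre K U x =
     (\<Sum>i\<in>UNIV. vector_derivative U (at x) $ i * pd (dirX i) K (jet U x)) - K (jet U x)"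

(* the components of U are (v, u) *)
definition hamiltonian :: "(real \<times> real \<Rightarrow> real) \<Rightarrow> (real \<times> real \<Rightarrow> real) \<Rightarrow> density" where
  "hamiltonian I E = (\<lambda>(U, V). I (U $ 1, U $ 2) + E (U $ 1, V $ 1))"

definition impulse :: "real ^ 2 ^ 2 \<Rightarrow> real ^ 2 \<Rightarrow> real" where
  "impulse B U = (U \<bullet> (matrix_inv B *v U)) / 2"

(* the density of H + c Q *)
definition plus_impulse :: "density \<Rightarrow> real \<Rightarrow> real ^ 2 ^ 2 \<Rightarrow> density" where
  "plus_impulse H c B = (\<lambda>(U, V). H (U, V) + c * impulse B U)"


(* The parameters (mu, lambda, c) are collected in one vector of length 4. *)

definition par_mu :: "real ^ 4 \<Rightarrow> real" where
  "par_mu p = p $ 1"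

definition par_lambda :: "real ^ 4 \<Rightarrow> real ^ 2" where
  "par_lambda p = vector [p $ 2, p $ 3]"

definition par_c :: "real ^ 4 \<Rightarrow> real" where
  "par_c p = p $ 4"

definition action ::
  "real ^ 2 ^ 2 \<Rightarrow> density \<Rightarrow> (real ^ 4 \<Rightarrow> real \<Rightarrow> real ^ 2) \<Rightarrow> (real ^ 4 \<Rightarrow> real) \<Rightarrow> real ^ 4 \<Rightarrow> real"
where
  "action B H U \<Xi> p =
     integral {0..\<Xi> p}
       (\<lambda>x. H (jet (U p) x) + par_c p * impulse B (U p x) - par_lambda p \<bullet> U p x + par_mu p)"


definition cmat :: "real ^ 'n ^ 'm \<Rightarrow> complex ^ 'n ^ 'm" where
  "cmat M = (\<chi> i j. complex_of_real (M $ i $ j))"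

definition hess_coeff ::
  "(2 \<Rightarrow> (real ^ 2) \<times> (real ^ 2)) \<Rightarrow> (2 \<Rightarrow> (real ^ 2) \<times> (real ^ 2)) \<Rightarrow> density
     \<Rightarrow> (real \<Rightarrow> real ^ 2) \<Rightarrow> real \<Rightarrow> complex ^ 2 ^ 2"
where
  "hess_coeff d e K U x = cmat (\<chi> i j. pd (d i) (pd (e j) K) (jet U x))"

(* hess_graph der K U W G states that G = (Hess K[U]) W.  The notion of derivative is a
   parameter: "der f g" reads "g is a derivative of f".  It is instantiated by the classical
   derivative for the eigenvalue ODE and by the weak derivative for the operator on L^2. *)
definition hess_graph ::
  "((real \<Rightarrow> complex ^ 2) \<Rightarrow> (real \<Rightarrow> complex ^ 2) \<Rightarrow> bool) \<Rightarrow> density \<Rightarrow> (real \<Rightarrow> real ^ 2)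
     \<Rightarrow> (real \<Rightarrow> complex ^ 2) \<Rightarrow> (real \<Rightarrow> complex ^ 2) \<Rightarrow> bool"
where
  "hess_graph der K U W G \<longleftrightarrow>
     (\<exists>W' P'. der W W' \<and>
        der (\<lambda>x. hess_coeff dirX dirU K U x *v W x + hess_coeff dirX dirX K U x *v W' x) P' \<and>
        G = (\<lambda>x. hess_coeff dirU dirU K U x *v W x + hess_coeff dirU dirX K U x *v W' x - P' x))"

(* F = B d/dx (Hess K[U]) W *)
definition lin_graph ::
  "((real \<Rightarrow> complex ^ 2) \<Rightarrow> (real \<Rightarrow> complex ^ 2) \<Rightarrow> bool) \<Rightarrow> real ^ 2 ^ 2 \<Rightarrow> density
     \<Rightarrow> (real \<Rightarrow> real ^ 2) \<Rightarrow> (real \<Rightarrow> complex ^ 2) \<Rightarrow> (real \<Rightarrow> complex ^ 2) \<Rightarrow> bool"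
where
  "lin_graph der B K U W F \<longleftrightarrow>
     (\<exists>G G'. hess_graph der K U W G \<and> der G G' \<and> F = (\<lambda>x. cmat B *v G' x))"


definition classical_deriv :: "(real \<Rightarrow> 'a::real_normed_vector) \<Rightarrow> (real \<Rightarrow> 'a) \<Rightarrow> bool" where
  "classical_deriv f g \<longleftrightarrow> (\<forall>x. (f has_vector_derivative g x) (at x))"

(* Fundamental matrix at 0 of the first-order system for (v, v_x, v_xx, u) that is equivalent
   to the eigenvalue equation: the columns are the vectors (v, v_x, v_xx, u) of
   solutions (v, u), and the value at 0 is the identity. *)
definition fundamental_solution ::
  "real ^ 2 ^ 2 \<Rightarrow> density \<Rightarrow> (real \<Rightarrow> real ^ 2) \<Rightarrow> complex \<Rightarrow> (real \<Rightarrow> complex ^ 4 ^ 4) \<Rightarrow> bool"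
where
  "fundamental_solution B K U z F \<longleftrightarrow>
     F 0 = mat 1 \<and>
     (\<forall>j. \<exists>W v1 v2.
        lin_graph classical_deriv B K U W (\<lambda>x. z *s W x) \<and>
        classical_deriv (\<lambda>x. W x $ 1) v1 \<and> classical_deriv v1 v2 \<and>
        (\<forall>x. column j (F x) = vector [W x $ 1, v1 x, v2 x, W x $ 2]))"

definition evans ::
  "real ^ 2 ^ 2 \<Rightarrow> density \<Rightarrow> (real \<Rightarrow> real ^ 2) \<Rightarrow> real \<Rightarrow> complex \<Rightarrow> complex"
where
  "evans B K U X z = (let F = (THE F. fundamental_solution B K U z F) in det (F X - F 0))"


(* L^2(R/XZ; C^m), represented by X-periodic Borel functions on the line *)
definition L2_per :: "real \<Rightarrow> (real \<Rightarrow> complex ^ 'm) set" where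
  "L2_per X = {f. f \<in> borel_measurable borel \<and> (\<forall>x. f (x + X) = f x) \<and>
                  set_integrable lborel {0..X} (\<lambda>x. (norm (f x))\<^sup>2)}"

definition L2_norm :: "real \<Rightarrow> (real \<Rightarrow> complex ^ 'm) \<Rightarrow> real" where
  "L2_norm X f = sqrt (LINT x:{0..X}|lborel. (norm (f x))\<^sup>2)"

(* weak derivative in L^2(R/XZ); it is determined only almost everywhere, so every
   representative g is admitted *)
definition weak_deriv_per :: "real \<Rightarrow> (real \<Rightarrow> complex ^ 'm) \<Rightarrow> (real \<Rightarrow> complex ^ 'm) \<Rightarrow> bool" where
  "weak_deriv_per X f g \<longleftrightarrow> f \<in> L2_per X \<and> g \<in> L2_per X \<and>
     (\<forall>\<phi>::real \<Rightarrow> real. smooth_on UNIV \<phi> \<longrightarrow> (\<forall>x. \<phi> (x + X) = \<phi> x) \<longrightarrow>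
        (LINT x:{0..X}|lborel. deriv \<phi> x *\<^sub>R f x) = - (LINT x:{0..X}|lborel. \<phi> x *\<^sub>R g x))"

(* Resolvent set of the operator A = B d/dx (Hess K[U]) on L^2(R/XZ): A - z maps its domain
   bijectively onto L^2 with bounded inverse (injectivity is contained in the estimate).
   In weak_deriv_per form the domain consists of the (v, u) in H^3 x H^1 for the
   Hamiltonians considered here. *)
definition resolvent_set ::
  "real ^ 2 ^ 2 \<Rightarrow> density \<Rightarrow> (real \<Rightarrow> real ^ 2) \<Rightarrow> real \<Rightarrow> complex set"
where
  "resolvent_set B K U X = {z.
     (\<forall>G\<in>L2_per X. \<exists>W F. lin_graph (weak_deriv_per X) B K U W F \<and> (\<lambda>x. F x - z *s W x) = G) \<and>
     (\<exists>C. \<forall>W F. lin_graph (weak_deriv_per X) B K U W F \<longrightarrow>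
        L2_norm X W \<le> C * L2_norm X (\<lambda>x. F x - z *s W x))}"

definition coperiodic_spectrum ::
  "real ^ 2 ^ 2 \<Rightarrow> density \<Rightarrow> (real \<Rightarrow> real ^ 2) \<Rightarrow> real \<Rightarrow> complex set"
where
  "coperiodic_spectrum B K U X = - resolvent_set B K U X"

definition coperiodically_stable ::
  "real ^ 2 ^ 2 \<Rightarrow> density \<Rightarrow> (real \<Rightarrow> real ^ 2) \<Rightarrow> real \<Rightarrow> bool"
where
  "coperiodically_stable B K U X \<longleftrightarrow> (\<forall>z\<in>coperiodic_spectrum B K U X. Re z = 0)"

end

theory Submission
  imports Defs
begin

text \<open>
  For \<open>U = (v, u)\<close> and \<open>\<pi> = \<partial>E/\<partial>v\<^sub>x\<close>, the eigenvalue equation \<open>\<partial>\<^sub>x g = z B\<^sup>-\<^sup>1 W\<close>, \<open>g = A W\<close>, is a first-order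
  system for \<open>Y = (w, P, g\<^sub>1, g\<^sub>2)\<close>, where \<open>w\<close> is the \<open>v\<close>-component of \<open>W\<close> and \<open>P\<close> the linearisation of \<open>\<pi>\<close>.
  It differs from the system for \<open>(v, v\<^sub>x, v\<^sub>x\<^sub>x, u)\<close> by a periodic change of variables independent of \<open>z\<close>, so
  \<open>D(r) = det(\<Phi>\<^sub>r(\<Xi>) - 1)\<close> for its fundamental matrix \<open>\<Phi>\<^sub>r\<close>.

  Small \<open>r\<close>: differentiating the profile equations yields the solutions \<open>U\<^sub>x, U\<^sub>\<mu>, U\<^sub>\<lambda>\<close> at \<open>r = 0\<close>, and
  \<open>U\<^sub>x - r U\<^sub>c\<close> up to \<open>O(r\<^sup>2)\<close>. Since \<open>g' = r B\<^sup>-\<^sup>1 W\<close> and \<open>v\<^sub>x P - \<pi>\<^sub>x w + U \<bullet> g\<close> has derivative \<open>r U \<bullet> B\<^sup>-\<^sup>1 W\<close>, three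
  rows and one column of the matrix of jumps over a period carry an exact factor \<open>r\<close>; what remains is the matrix
  of parameter derivatives of \<open>(\<Xi>, - \<integral>v, - \<integral>u, \<integral>Q)\<close>, the gradient of the action.

  Large \<open>r\<close>: a quadratic form increases strictly along every nonzero solution, so
  \<open>det(\<Phi>\<^sub>r(L) - 1) \<noteq> 0\<close> for all \<open>0 < L \<le> \<Xi>\<close>, and for \<open>L \<rightarrow> 0\<close> this determinant is positive.

  If the Hessian is negative, \<open>D\<close> changes sign on \<open>r > 0\<close>, and a zero gives a periodic eigenfunction.
\<close>

section \<open>Linear ordinary differential equations\<close>

text \<open>In the variables \<open>Y\<close> no derivative of a coefficient occurs, and the
  spectral parameter enters affinely and only in the equations for \<open>g\<close>; so
  \<open>g\<close> is constant at \<open>r = 0\<close>. The base point 0 is arbitrary, and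
  \<open>v_x\<close> may vanish there. But the energy relation differentiated in mu says that
  \<open>v_x P - \<pi>_x w = 1\<close> for the mu-derivative of the profile. Hence
  \<open>(v_x, \<pi>_x)\<close> is nonzero at 0, the four solutions used near \<open>r = 0\<close>
  form a basis, and the first two jumps can be replaced by their component along
  \<open>(v_x, \<pi>_x)\<close> and by the jump of the flux, which contains the orthogonal
  component. All powers of \<open>r\<close> are divided out by exact identities before the limit is
  taken, so that convergence of the columns with error O(r) suffices and no fourth-order expansion
  is made. For large \<open>r\<close> the length of the interval is the homotopy parameter: the
  monotone quadratic form excludes \<open>Y L = Y 0\<close>, a condition that makes sense although
  the coefficients need not have period \<open>L\<close>.\<close>

lemma continuous_antiderivative:
  fixes f :: "real \<Rightarrow> 'a::banach"
  assumes f: "continuous_on UNIV f"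
  obtains F where "F 0 = 0" "\<And>x. (F has_vector_derivative f x) (at x)"
proof (rule that[of "\<lambda>x. integral {0..x} f - integral {x..0} f"])
  \<comment> \<open>An integral over an empty interval is 0, so this difference is the oriented
    integral from 0 to \<open>x\<close>. Near each point it differs by a constant from the integral
    that starts at \<open>-R\<close>.\<close>
  let ?F = "\<lambda>x. integral {0..x} f - integral {x..0} f"
  show "?F 0 = 0" by simp
  fix x :: real
  define R where "R = \<bar>x\<bar> + 1"
  have int: "f integrable_on {c..d}" for c d
    by (rule integrable_continuous_real) (rule continuous_on_subset[OF f], simp)
  have eq: "integral {-R..y} f - integral {-R..0} f = ?F y" if "y \<in> {-R<..<R}" for y
  proof (cases "y \<ge> 0")
    case True
    then have "integral {y..0} f = 0"
      by (cases "y = 0") auto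
    then show ?thesis
      using Henstock_Kurzweil_Integration.integral_combine[of "-R" 0 y f, symmetric] True that int by simp
  next
    case False
    then show ?thesis
      using Henstock_Kurzweil_Integration.integral_combine[of "-R" y 0 f, symmetric] that int by simp
  qed
  have "((\<lambda>y. integral {-R..y} f) has_vector_derivative f x) (at x within {-R..R})"
    by (rule integral_has_vector_derivative) (use continuous_on_subset[OF f] in \<open>auto simp: R_def\<close>)
  moreover have "x \<in> interior {-R..R}"
    unfolding interior_atLeastAtMost_real by (auto simp: R_def)
  ultimately have D: "((\<lambda>y. integral {-R..y} f) has_vector_derivative f x) (at x)"
    by (simp only: at_within_interior)
  then have "((\<lambda>y. integral {-R..y} f - integral {-R..0} f) has_vector_derivative f x) (at x)"
    using has_vector_derivative_diff[OF D has_vector_derivative_const] by simp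
  then show "(?F has_vector_derivative f x) (at x)"
    by (rule has_vector_derivative_transform_within_open[where S = "{-R<..<R}"])
       (use eq in \<open>auto simp: R_def\<close>)
qed

lemma has_vector_derivative_uminus_arg:
  assumes "(f has_vector_derivative f') (at (- x))"
  shows "((\<lambda>x. f (- x)) has_vector_derivative - f') (at (x::real))"
proof -
  have "((\<lambda>x. - x) has_real_derivative -1) (at x)"
    by (auto intro!: derivative_eq_intros)
  from vector_diff_chain_at[OF this[unfolded has_real_derivative_iff_has_vector_derivative], of f f']
  show ?thesis using assms by (simp add: o_def)
qed

text \<open>One integration turns the bound \<open>x^n / n!\<close> into the next one; this gives
  the terms of the series below their factorial decay. Negative arguments are treated by
  reflection.\<close>

lemma power_series_bound_step:
  fixes Y :: "real \<Rightarrow> 'a::real_normed_vector"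
  assumes Y: "\<And>x. (Y has_vector_derivative Y' x) (at x)" "Y 0 = 0"
    and bd: "\<And>x. \<bar>x\<bar> \<le> R \<Longrightarrow> norm (Y' x) \<le> C * \<bar>x\<bar> ^ n / fact n"
    and x: "\<bar>x\<bar> \<le> R"
  shows "norm (Y x) \<le> C * \<bar>x\<bar> ^ Suc n / fact (Suc n)"
proof -
  have aux: "norm (Z x) \<le> C * x ^ Suc n / fact (Suc n)"
    if Z: "\<And>x. (Z has_vector_derivative Z' x) (at x)" "Z 0 = 0" and x: "0 \<le> x" "x \<le> R"
      and bd: "\<And>x. \<bar>x\<bar> \<le> R \<Longrightarrow> norm (Z' x) \<le> C * \<bar>x\<bar> ^ n / fact n"
    for Z Z' :: "real \<Rightarrow> 'a" and x
  proof (cases "x = 0")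
    case False
    with x have "0 < x" by simp
    let ?phi = "\<lambda>x. C * x ^ Suc n / fact (Suc n)"
    have phi: "(?phi has_vector_derivative C * y ^ n / fact n) (at y)" for y
    proof -
      have "((\<lambda>y. C / fact (Suc n) * y ^ Suc n) has_real_derivative
          C / fact (Suc n) * (of_nat (Suc n) * y ^ n)) (at y)"
        by (intro DERIV_cmult) (use DERIV_pow[of "Suc n" y] in simp)
      moreover have "C / fact (Suc n) * (of_nat (Suc n) * y ^ n) = C * y ^ n / fact n"
        by (simp only: fact_Suc of_nat_mult) (simp add: divide_simps)
      ultimately show ?thesis
        by (simp only: times_divide_eq_left has_real_derivative_iff_has_vector_derivative)
    qed
    have "norm (Z x - Z 0) \<le> ?phi x - ?phi 0"
    proof (rule differentiable_bound_general[OF \<open>0 < x\<close>, where f' = Z' and \<phi>' = "\<lambda>y. C * y ^ n / fact n"])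
      show "continuous_on {0..x} Z"
        by (intro continuous_at_imp_continuous_on ballI has_vector_derivative_continuous[OF Z(1)])
      show "continuous_on {0..x} ?phi"
        by (intro continuous_intros) auto
      show "norm (Z' y) \<le> C * y ^ n / fact n" if "0 < y" "y < x" for y
        using bd[of y] that x by simp
    qed (use Z phi in blast)+
    then show ?thesis using Z by simp
  qed (use Z in simp)
  show ?thesis
  proof (cases "x \<ge> 0")
    case True
    then show ?thesis using aux[of Y Y' x] assms by simp
  next
    case False
    have "((\<lambda>x. Y (- x)) has_vector_derivative - Y' (- x)) (at x)" for x
      by (rule has_vector_derivative_uminus_arg[OF Y(1)])
    moreover have "norm (- Y' (- x)) \<le> C * \<bar>x\<bar> ^ n / fact n" if "\<bar>x\<bar> \<le> R" for x
      using bd[of "- x"] that by simp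
    ultimately show ?thesis
      using aux[of "\<lambda>x. Y (- x)" "\<lambda>x. - Y' (- x)" "- x"] False Y(2) x by simp
  qed
qed

text \<open>The equation is \<open>Y' = mul (M x) Y\<close> for an abstract bilinear product, so
  that fundamental matrices (\<open>**\<close>) and single solutions (\<open>*v\<close>) are both
  instances.\<close>

lemma bilinear_bound_on_interval:
  fixes mul :: "'b::real_normed_vector \<Rightarrow> 'a::real_normed_vector \<Rightarrow> 'a" and M :: "real \<Rightarrow> 'b"
  assumes "bounded_bilinear mul" and M: "continuous_on UNIV M"
  obtains K where "K \<ge> 0" "\<And>x y. x \<in> {c..d} \<Longrightarrow> norm (mul (M x) y) \<le> K * norm y"
proof -
  interpret bounded_bilinear mul by fact
  obtain C where C: "\<And>a b. norm (mul a b) \<le> norm a * norm b * C" "C \<ge> 0"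
    using nonneg_bounded by blast
  obtain A where A: "A \<ge> 0" "\<And>x. x \<in> {c..d} \<Longrightarrow> norm (M x) \<le> A"
    by (rule continuous_on_compact_bound[OF compact_Icc continuous_on_subset[OF M]]) auto
  have "norm (mul (M x) y) \<le> A * C * norm y" if "x \<in> {c..d}" for x y
  proof -
    have "norm (M x) * norm y * C \<le> A * norm y * C"
      by (intro mult_right_mono A that) (use C in auto)
    with C(1)[of "M x" y] show ?thesis by (simp add: ac_simps)
  qed
  then show thesis using that[of "A * C"] A C by simp
qed

text \<open>The Peano--Baker series.\<close>

lemma linear_ode_exists:
  fixes mul :: "'b::real_normed_vector \<Rightarrow> 'a::banach \<Rightarrow> 'a" and y0 :: 'a
  assumes "bounded_bilinear mul" and M: "continuous_on UNIV M"
  obtains Y where "Y 0 = y0" "\<And>x. (Y has_vector_derivative mul (M x) (Y x)) (at x)"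
proof -
  interpret bounded_bilinear mul by fact
  have "\<exists>Z. Z 0 = 0 \<and> (\<forall>x. (Z has_vector_derivative mul (M x) (Y x)) (at x))"
    if "continuous_on UNIV Y" for Y
    using continuous_antiderivative[of "\<lambda>x. mul (M x) (Y x)"] continuous_on[OF M that] by metis
  then obtain T where T: "\<And>Y. continuous_on UNIV Y \<Longrightarrow> T Y 0 = 0 \<and>
      (\<forall>x. (T Y has_vector_derivative mul (M x) (Y x)) (at x))"
    by metis
  define Y where "Y n = (T ^^ n) (\<lambda>_. y0)" for n
  have cont: "continuous_on UNIV (Y n)" for n
  proof (induction n)
    case (Suc n)
    show ?case
      using T[OF Suc] by (auto simp: Y_def intro!: continuous_at_imp_continuous_on has_vector_derivative_continuous)
  qed (simp add: Y_def)
  have Y0: "Y 0 x = y0" for x by (simp add: Y_def)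
  have YS: "Y (Suc n) 0 = 0" "(Y (Suc n) has_vector_derivative mul (M x) (Y n x)) (at x)" for n x
    using T[OF cont, of n] by (auto simp: Y_def)
  define S where "S x = (\<Sum>n. Y n x)" for x
  have main: "(S has_vector_derivative mul (M x) (S x)) (at x) \<and> (\<lambda>n. Y n x) sums S x" for x
  proof -
    define R where "R = \<bar>x\<bar> + 1"
    obtain K where "K \<ge> 0" "\<And>x y. x \<in> {-R..R} \<Longrightarrow> norm (mul (M x) y) \<le> K * norm y"
      by (rule bilinear_bound_on_interval[OF assms(1) M, of "-R" R]) (rule that)
    then have K: "K \<ge> 0" "\<And>x y. \<bar>x\<bar> \<le> R \<Longrightarrow> norm (mul (M x) y) \<le> K * norm y"
      by (auto simp: abs_le_iff)
    have Yb: "norm (Y n y) \<le> norm y0 * K ^ n * \<bar>y\<bar> ^ n / fact n" if "\<bar>y\<bar> \<le> R" for n y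
      using that
    proof (induction n arbitrary: y)
      case (Suc n)
      show ?case
      proof (rule power_series_bound_step[OF YS(2) YS(1) _ Suc.prems])
        fix x assume x: "\<bar>x\<bar> \<le> R"
        have "norm (mul (M x) (Y n x)) \<le> K * norm (Y n x)" by (rule K(2)[OF x])
        also have "\<dots> \<le> K * (norm y0 * K ^ n * \<bar>x\<bar> ^ n / fact n)"
          by (intro mult_left_mono Suc.IH x K)
        finally show "norm (mul (M x) (Y n x)) \<le> norm y0 * K ^ Suc n * \<bar>x\<bar> ^ n / fact n"
          by (simp add: ac_simps)
      qed
    qed (simp add: Y0)
    have R: "R > 0" by (simp add: R_def)
    have Yb': "norm (Y n y) \<le> norm y0 * ((K * R) ^ n / fact n)" if "\<bar>y\<bar> \<le> R" for n y
    proof -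
      have "norm y0 * K ^ n * \<bar>y\<bar> ^ n / fact n \<le> norm y0 * K ^ n * R ^ n / fact n"
        by (intro divide_right_mono mult_left_mono power_mono mult_nonneg_nonneg) (use that K in auto)
      with Yb[OF that, of n] show ?thesis by (simp add: power_mult_distrib field_simps)
    qed
    have sumb: "summable (\<lambda>n. norm y0 * ((K * R) ^ n / fact n))"
      by (intro summable_mult) (use summable_exp[of "K * R"] in \<open>simp add: field_simps\<close>)
    define A where "A = {-R<..<R}"
    have unif: "uniform_limit A (\<lambda>n y. \<Sum>i<n. Y i y) S sequentially"
      unfolding S_def by (rule Weierstrass_m_test[OF Yb' sumb]) (auto simp: A_def)
    have sums: "(\<lambda>n. Y n y) sums S y" if "y \<in> A" for y
      unfolding S_def using that Yb'[of y]
      by (intro summable_sums summable_comparison_test'[OF sumb]) (auto simp: A_def)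
    \<comment> \<open>Each term differentiates to \<open>M\<close> times the previous term, and the
      term of index 0 to 0. Hence the differentiated partial sum of length \<open>n + 1\<close> is
      \<open>M\<close> times the partial sum of length \<open>n\<close>, and inherits its uniform
      convergence.\<close>
    define Y' where "Y' n y = (case n of 0 \<Rightarrow> 0 | Suc m \<Rightarrow> mul (M y) (Y m y))" for n y
    have Y': "(Y n has_vector_derivative Y' n y) (at y within A)" for n y
    proof (cases n)
      case 0
      have "Y 0 = (\<lambda>_. y0)" using Y0 by auto
      then show ?thesis by (simp add: 0 Y'_def)
    next
      case (Suc m)
      show ?thesis
        unfolding Suc Y'_def nat.case by (rule has_vector_derivative_at_within[OF YS(2)])
    qed
    have sumY': "(\<Sum>i<Suc n. Y' i y) = mul (M y) (\<Sum>i<n. Y i y)" for n y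
      unfolding sum.lessThan_Suc_shift by (simp add: Y'_def sum_right del: sum.lessThan_Suc)
    have ev: "\<forall>\<^sub>F n in sequentially. \<forall>y\<in>A. \<forall>h. norm ((\<Sum>i<n. h *\<^sub>R Y' i y) - h *\<^sub>R mul (M y) (S y)) \<le> e * norm h"
      if "e > 0" for e
    proof -
      have "\<forall>\<^sub>F n in sequentially. \<forall>y\<in>A. dist (\<Sum>i<n. Y i y) (S y) < e / (K + 1)"
        using uniform_limitD[OF unif, of "e / (K + 1)"] that K by simp
      then have "\<forall>\<^sub>F n in sequentially. \<forall>y\<in>A. \<forall>h. norm ((\<Sum>i<Suc n. h *\<^sub>R Y' i y) - h *\<^sub>R mul (M y) (S y)) \<le> e * norm h"
      proof (eventually_elim, intro ballI allI)
        fix n y h assume H: "\<forall>y\<in>A. dist (\<Sum>i<n. Y i y) (S y) < e / (K + 1)" and y: "y \<in> A"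
        let ?d = "(\<Sum>i<n. Y i y) - S y"
        have eq: "(\<Sum>i<Suc n. h *\<^sub>R Y' i y) - h *\<^sub>R mul (M y) (S y) = h *\<^sub>R mul (M y) ?d"
          unfolding scaleR_sum_right[symmetric] sumY' by (simp add: diff_right scaleR_diff_right)
        have "norm (mul (M y) ?d) \<le> K * norm ?d"
          by (rule K) (use y in \<open>auto simp: A_def\<close>)
        also have "\<dots> \<le> K * (e / (K + 1))"
          using H y K by (intro mult_left_mono) (auto simp: dist_norm less_imp_le)
        also have "\<dots> \<le> e"
          using K that by (simp add: field_simps)
        finally show "norm ((\<Sum>i<Suc n. h *\<^sub>R Y' i y) - h *\<^sub>R mul (M y) (S y)) \<le> e * norm h"
          unfolding eq by (simp add: mult.commute[of e] mult_left_mono)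
      qed
      then show ?thesis
        by (subst (asm) eventually_sequentially_Suc)
    qed
    have xA: "x \<in> A" by (auto simp: A_def R_def)
    have "\<exists>g. \<forall>y\<in>A. (\<lambda>n. Y n y) sums g y \<and>
        (g has_derivative (\<lambda>h. h *\<^sub>R mul (M y) (S y))) (at y within A)"
    proof (rule has_derivative_series)
      show "(Y n has_derivative (\<lambda>h. h *\<^sub>R Y' n y)) (at y within A)" for n y
        using Y' by (simp add: has_vector_derivative_def)
      show "\<forall>\<^sub>F n in sequentially. \<forall>y\<in>A. \<forall>h. norm ((\<Sum>i<n. h *\<^sub>R Y' i y) - h *\<^sub>R mul (M y) (S y)) \<le> e * norm h"
        if "e > 0" for e
        by (rule ev[OF that])
      show "convex A" by (simp add: A_def)
    qed (fact xA, rule sums[OF xA])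
    then obtain g where g: "\<And>y. y \<in> A \<Longrightarrow> (\<lambda>n. Y n y) sums g y"
      "\<And>y. y \<in> A \<Longrightarrow> (g has_vector_derivative mul (M y) (S y)) (at y within A)"
      unfolding has_vector_derivative_def by blast
    have "(S has_vector_derivative mul (M x) (S x)) (at x within A)"
      by (rule has_vector_derivative_transform[OF xA _ g(2)[OF xA]]) (rule sums_unique2[OF sums g(1)])
    then show ?thesis
      using sums[OF xA] xA by (simp add: A_def at_within_open[OF _ open_greaterThanLessThan])
  qed
  have "(\<lambda>n. Y n 0) sums y0"
  proof -
    have "(\<lambda>n. Y n 0) = (\<lambda>n. if n = 0 then y0 else 0)"
    proof
      show "Y n 0 = (if n = 0 then y0 else 0)" for n
        using YS(1) Y0 by (cases n) auto
    qed
    then show ?thesis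
      using sums_single[of 0 "\<lambda>_. y0"] by simp
  qed
  with main[of 0] have "S 0 = y0" by (metis sums_unique2)
  with main that show ?thesis by blast
qed

text \<open>The squared norm is differentiable even where \<open>Z\<close> vanishes. The inequality
  \<open>2 \<epsilon> |Z| \<le> |Z|^2 + \<epsilon>^2\<close> accounts for the rate
  \<open>2 * K + 1\<close> and makes \<phi> nonincreasing.\<close>

lemma gronwall:
  fixes Z :: "real \<Rightarrow> 'a::real_inner"
  assumes Z: "\<And>x. x \<in> {0..X} \<Longrightarrow> (Z has_vector_derivative Z' x) (at x)"
    and bd: "\<And>x. x \<in> {0..X} \<Longrightarrow> norm (Z' x) \<le> K * norm (Z x) + \<epsilon>"
    and K: "K \<ge> 0" and x: "x \<in> {0..X}"
  shows "(norm (Z x))\<^sup>2 \<le> exp ((2 * K + 1) * x) * ((norm (Z 0))\<^sup>2 + \<epsilon>\<^sup>2 * x)"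
proof -
  define \<phi> where "\<phi> y = exp (- ((2 * K + 1) * y)) * (Z y \<bullet> Z y) - \<epsilon>\<^sup>2 * y" for y
  have "\<exists>d. (\<phi> has_real_derivative d) (at y) \<and> d \<le> 0" if "0 \<le> y" "y \<le> x" for y
  proof -
    let ?E = "exp (- ((2 * K + 1) * y))"
    have y: "y \<in> {0..X}" using that x by auto
    have "((\<lambda>y. Z y \<bullet> Z y) has_vector_derivative (Z y \<bullet> Z' y + Z' y \<bullet> Z y)) (at y)"
      by (rule bounded_bilinear.has_vector_derivative[OF bounded_bilinear_inner Z[OF y] Z[OF y]])
    then have D: "((\<lambda>y. Z y \<bullet> Z y) has_real_derivative 2 * (Z y \<bullet> Z' y)) (at y)"
      by (simp add: has_real_derivative_iff_has_vector_derivative inner_commute)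
    have "(\<phi> has_real_derivative (?E * (2 * (Z y \<bullet> Z' y)) - (2 * K + 1) * ?E * (Z y \<bullet> Z y) - \<epsilon>\<^sup>2)) (at y)"
      unfolding \<phi>_def by (rule derivative_eq_intros D refl)+ (simp add: algebra_simps)
    moreover have "?E * (2 * (Z y \<bullet> Z' y)) - (2 * K + 1) * ?E * (Z y \<bullet> Z y) - \<epsilon>\<^sup>2 \<le> 0"
    proof -
      have "Z y \<bullet> Z' y \<le> norm (Z y) * (K * norm (Z y) + \<epsilon>)"
        using norm_cauchy_schwarz[of "Z y" "Z' y"] mult_left_mono[OF bd[OF y], of "norm (Z y)"] by simp
      also have "2 * \<dots> \<le> (2 * K + 1) * (norm (Z y))\<^sup>2 + \<epsilon>\<^sup>2"
        using zero_le_power2[of "norm (Z y) - \<epsilon>"] by (simp add: power2_eq_square algebra_simps)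
      finally have *: "2 * (Z y \<bullet> Z' y) \<le> (2 * K + 1) * (Z y \<bullet> Z y) + \<epsilon>\<^sup>2"
        by (simp add: power2_norm_eq_inner)
      have "?E * (2 * (Z y \<bullet> Z' y)) \<le> ?E * ((2 * K + 1) * (Z y \<bullet> Z y) + \<epsilon>\<^sup>2)"
        by (intro mult_left_mono *) auto
      moreover have "?E * \<epsilon>\<^sup>2 \<le> 1 * \<epsilon>\<^sup>2"
        by (intro mult_right_mono) (use K that in auto)
      ultimately show ?thesis by (simp add: algebra_simps)
    qed
    ultimately show ?thesis by blast
  qed
  then have "\<phi> x \<le> \<phi> 0"
    using x by (intro DERIV_nonpos_imp_nonincreasing[of 0 x \<phi>]) auto
  then have "exp (- ((2 * K + 1) * x)) * (norm (Z x))\<^sup>2 \<le> (norm (Z 0))\<^sup>2 + \<epsilon>\<^sup>2 * x"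
    by (simp add: \<phi>_def power2_norm_eq_inner)
  from mult_left_mono[OF this, of "exp ((2 * K + 1) * x)"]
  show ?thesis by (simp add: mult.assoc[symmetric] exp_minus)
qed

lemma linear_ode_unique_zero:
  fixes mul :: "'b::real_normed_vector \<Rightarrow> 'a::real_inner \<Rightarrow> 'a"
  assumes "bounded_bilinear mul" and M: "continuous_on UNIV M"
    and Z: "\<And>x. (Z has_vector_derivative mul (M x) (Z x)) (at x)" and Z0: "Z 0 = 0"
  shows "Z x = 0"
proof -
  obtain K where KC: "0 \<le> K" and bd: "\<And>y z. y \<in> {-\<bar>x\<bar>..\<bar>x\<bar>} \<Longrightarrow> norm (mul (M y) z) \<le> K * norm z"
    by (rule bilinear_bound_on_interval[OF assms(1) M, of "-\<bar>x\<bar>" "\<bar>x\<bar>"]) (rule that)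
  have "(norm (Z x))\<^sup>2 \<le> 0"
  proof (cases "x \<ge> 0")
    case True
    have "(norm (Z x))\<^sup>2 \<le> exp ((2 * K + 1) * x) * ((norm (Z 0))\<^sup>2 + 0\<^sup>2 * x)"
      by (rule gronwall[of x Z "\<lambda>y. mul (M y) (Z y)" _ 0]) (use Z bd KC True in auto)
    then show ?thesis by (simp add: Z0)
  next
    case False
    have "(norm (Z (- (- x))))\<^sup>2 \<le> exp ((2 * K + 1) * (- x)) * ((norm (Z (- 0)))\<^sup>2 + 0\<^sup>2 * (- x))"
      by (rule gronwall[of "- x" "\<lambda>y. Z (- y)" "\<lambda>y. - mul (M (- y)) (Z (- y))" _ 0])
         (use Z bd KC False in \<open>auto intro!: has_vector_derivative_uminus_arg\<close>)
    then show ?thesis by (simp add: Z0)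
  qed
  then show ?thesis by simp
qed

lemma linear_ode_unique:
  fixes mul :: "'b::real_normed_vector \<Rightarrow> 'a::real_inner \<Rightarrow> 'a"
  assumes "bounded_bilinear mul" and "continuous_on UNIV M"
    and Y: "\<And>x. (Y has_vector_derivative mul (M x) (Y x)) (at x)"
    and Z: "\<And>x. (Z has_vector_derivative mul (M x) (Z x)) (at x)" and "Y 0 = Z 0"
  shows "Y x = Z x"
proof -
  interpret bounded_bilinear mul by fact
  have "((\<lambda>x. Y x - Z x) has_vector_derivative mul (M x) (Y x - Z x)) (at x)" for x
    unfolding diff_right by (intro has_vector_derivative_diff Y Z)
  from linear_ode_unique_zero[OF assms(1,2) this] have "Y x - Z x = 0"
    using assms(5) by simp
  then show ?thesis by simp
qed

lemma bounded_bilinear_matrix_matrix: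
  "bounded_bilinear ((**) :: real ^ 'n ^ 'm \<Rightarrow> real ^ 'k ^ 'n \<Rightarrow> real ^ 'k ^ 'm)"
  unfolding bilinear_conv_bounded_bilinear[symmetric] bilinear_def
  by (auto intro!: linearI simp: matrix_matrix_mult_def vec_eq_iff sum.distrib algebra_simps sum_distrib_left)

lemma bounded_bilinear_matrix_vector:
  "bounded_bilinear ((*v) :: real ^ 'n ^ 'm \<Rightarrow> real ^ 'n \<Rightarrow> real ^ 'm)"
  unfolding bilinear_conv_bounded_bilinear[symmetric] bilinear_def
  by (auto intro!: linearI simp: matrix_vector_mult_def vec_eq_iff sum.distrib algebra_simps sum_distrib_left)

section \<open>The spectral system in Hamiltonian variables\<close>

lemma vector_4 [simp]:
  "(vector [x, y, z, w] :: 'a::zero ^ 4) $ 1 = x"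
  "(vector [x, y, z, w] :: 'a ^ 4) $ 2 = y"
  "(vector [x, y, z, w] :: 'a ^ 4) $ 3 = z"
  "(vector [x, y, z, w] :: 'a ^ 4) $ 4 = w"
  unfolding vector_def by simp_all

text \<open>With the expansion written out, concrete determinants and limits of determinants can be
  handled entry by entry.\<close>

lemma det_4:
  "det (A :: 'a::comm_ring_1 ^ 4 ^ 4) =
    A$1$1 * (A$2$2 * (A$3$3 * A$4$4 - A$3$4 * A$4$3) - A$2$3 * (A$3$2 * A$4$4 - A$3$4 * A$4$2) + A$2$4 * (A$3$2 * A$4$3 - A$3$3 * A$4$2))
  - A$1$2 * (A$2$1 * (A$3$3 * A$4$4 - A$3$4 * A$4$3) - A$2$3 * (A$3$1 * A$4$4 - A$3$4 * A$4$1) + A$2$4 * (A$3$1 * A$4$3 - A$3$3 * A$4$1))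
  + A$1$3 * (A$2$1 * (A$3$2 * A$4$4 - A$3$4 * A$4$2) - A$2$2 * (A$3$1 * A$4$4 - A$3$4 * A$4$1) + A$2$4 * (A$3$1 * A$4$2 - A$3$2 * A$4$1))
  - A$1$4 * (A$2$1 * (A$3$2 * A$4$3 - A$3$3 * A$4$2) - A$2$2 * (A$3$1 * A$4$3 - A$3$3 * A$4$1) + A$2$3 * (A$3$1 * A$4$2 - A$3$2 * A$4$1))"
proof -
  have f1: "finite {2::4, 3, 4}" "1 \<notin> {2::4, 3, 4}" by auto
  have f2: "finite {3::4, 4}" "2 \<notin> {3::4, 4}" by auto
  have f3: "finite {4::4}" "3 \<notin> {4::4}" by auto
  show ?thesis
    unfolding det_def UNIV_4
    unfolding sum_over_permutations_insert[OF f1]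
    unfolding sum_over_permutations_insert[OF f2]
    unfolding sum_over_permutations_insert[OF f3]
    unfolding permutes_sing
    by (simp add: sign_swap_id permutation_swap_id permutation_compose sign_compose sign_id swap_id_eq algebra_simps)
qed

lemma has_vector_derivative_vec_iff:
  fixes f :: "real \<Rightarrow> 'a::real_normed_vector ^ 'n"
  shows "(f has_vector_derivative f') (at x) \<longleftrightarrow>
    (\<forall>i. ((\<lambda>x. f x $ i) has_vector_derivative f' $ i) (at x))"
proof
  show "\<forall>i. ((\<lambda>x. f x $ i) has_vector_derivative f' $ i) (at x)"
    if "(f has_vector_derivative f') (at x)"
    using bounded_linear.has_vector_derivative[OF bounded_linear_vec_nth that] by blast
next
  assume comp: "\<forall>i. ((\<lambda>x. f x $ i) has_vector_derivative f' $ i) (at x)"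
  have lin: "bounded_linear (\<lambda>y. axis i y :: 'a ^ 'n)" for i
    by (rule bounded_linear_intro[where K = 1])
       (auto simp: axis_def vec_eq_iff norm_vec_def L2_set_def if_distrib[of norm] if_distrib[of "\<lambda>x. x\<^sup>2"] cong: if_cong)
  have eq: "(\<Sum>i\<in>UNIV. axis i (v $ i)) = v" for v :: "'a ^ 'n"
    by (simp add: vec_eq_iff axis_def)
  have "((\<lambda>x. \<Sum>i\<in>UNIV. axis i (f x $ i)) has_vector_derivative (\<Sum>i\<in>UNIV. axis i (f' $ i))) (at x)"
    using comp by (intro has_vector_derivative_sum bounded_linear.has_vector_derivative[OF lin]) blast
  then show "(f has_vector_derivative f') (at x)"
    unfolding eq .
qed

lemma has_vector_derivative_vec_nth:
  "(f has_vector_derivative f') (at x) \<Longrightarrow> ((\<lambda>x. f x $ i) has_vector_derivative f' $ i) (at x)"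
  by (rule bounded_linear.has_vector_derivative[OF bounded_linear_vec_nth])

lemma tendsto_det_4:
  fixes A :: "'a \<Rightarrow> real ^ 4 ^ 4"
  assumes "\<And>i j. ((\<lambda>x. A x $ i $ j) \<longlongrightarrow> B $ i $ j) F"
  shows "((\<lambda>x. det (A x)) \<longlongrightarrow> det B) F"
  unfolding det_4 by (intro tendsto_add tendsto_diff tendsto_mult assms)

text \<open>The left-hand side is the derivative of
  \<open>\<theta> (- p h + \<sigma> w q) + w p + \<sigma> h q\<close> along the rescaled system. To
  leading order in \<rho> the first bracket produces \<open>h^2 + w^2\<close> and the other two
  terms produce \<open>k p^2 + l q^2\<close>. The only surviving cross term,
  \<open>\<theta> \<sigma> (k - l) p q\<close>, is absorbed because \<theta> is small.\<close>

lemma lyapunov_bound: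
  fixes \<theta> \<sigma> \<rho> C k0 w p h q k l c1 c2 c3 c4 c5 :: real
  assumes bd: "\<bar>c1\<bar> \<le> C" "\<bar>c2\<bar> \<le> C" "\<bar>c3\<bar> \<le> C" "\<bar>c4\<bar> \<le> C" "\<bar>c5\<bar> \<le> C"
    and kl: "k0 \<le> k" "k0 \<le> l" "\<bar>k - l\<bar> \<le> C" "k0 > 0"
    and \<theta>: "0 < \<theta>" "\<theta> \<le> 1" "\<theta> * C \<le> k0" and \<sigma>: "\<bar>\<sigma>\<bar> = 1" and \<rho>: "\<rho> \<ge> 1"
  shows "\<theta> * (- (- \<rho> * h + c2 * w / \<rho> + c3 * p + c4 * q) * h - p * (\<sigma> * \<rho> * l * q + \<sigma> * c5 * w)
      + \<sigma> * (\<rho> * k * p + c1 * w) * q + \<sigma> * w * (\<sigma> * \<rho> * w))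
      + (\<rho> * k * p + c1 * w) * p + w * (- \<rho> * h + c2 * w / \<rho> + c3 * p + c4 * q)
      + \<sigma> * (\<sigma> * \<rho> * l * q + \<sigma> * c5 * w) * q + \<sigma> * h * (\<sigma> * \<rho> * w)
    \<ge> (\<rho> * min \<theta> (k0 / 2) - 10 * C) * (w\<^sup>2 + p\<^sup>2 + h\<^sup>2 + q\<^sup>2)" (is "?lhs \<ge> _")
proof -
  define S where "S = w\<^sup>2 + p\<^sup>2 + h\<^sup>2 + q\<^sup>2"
  \<comment> \<open>\<open>\<rho> * T\<close> is the part proportional to \<rho>; in it the two
    terms with \<open>w h\<close> have cancelled. The rest, \<open>U\<close> below, has ten terms,
    each at most \<open>C * S\<close>; this is the origin of the constant
    \<open>10 * C\<close>.\<close>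
  define T where "T = \<theta> * (h\<^sup>2 + w\<^sup>2) + \<theta> * \<sigma> * (k - l) * (p * q) + k * p\<^sup>2 + l * q\<^sup>2"
  have \<sigma>2: "\<sigma> * \<sigma> = 1"
    using \<sigma> by (metis abs_mult_self_eq mult.right_neutral)
  have pr: "\<bar>x * y\<bar> \<le> S" if "x \<in> {w, p, h, q}" "y \<in> {w, p, h, q}" for x y
  proof -
    have "2 * \<bar>x * y\<bar> \<le> x\<^sup>2 + y\<^sup>2"
      using zero_le_power2[of "\<bar>x\<bar> - \<bar>y\<bar>"] by (simp add: power2_diff abs_mult)
    moreover have "x\<^sup>2 \<le> S" "y\<^sup>2 \<le> S"
      using that by (auto simp: S_def)
    ultimately show ?thesis by linarith
  qed
  have C0: "C \<ge> 0" using bd(1) by linarith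
  have mem: "w \<in> {w, p, h, q}" "p \<in> {w, p, h, q}" "h \<in> {w, p, h, q}" "q \<in> {w, p, h, q}"
    by auto
  have tb: "\<bar>c * (x * y)\<bar> \<le> C * S" if "\<bar>c\<bar> \<le> C" "x \<in> {w, p, h, q}" "y \<in> {w, p, h, q}" for c x y
    unfolding abs_mult[of c] using that pr[OF that(2,3)] C0 by (intro mult_mono) auto
  have inv: "\<bar>c2 / \<rho>\<bar> \<le> C"
  proof -
    have "\<bar>c2\<bar> / \<rho> \<le> \<bar>c2\<bar> / 1"
      using \<rho> by (intro divide_left_mono) auto
    then show ?thesis using bd(2) \<rho> by simp
  qed
  have shr: "\<bar>\<theta> * c\<bar> \<le> C" if "\<bar>c\<bar> \<le> C" for c
    using mult_mono[of \<theta> 1 "\<bar>c\<bar>" C] \<theta> that by (simp add: abs_mult)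
  have sg: "\<bar>\<sigma> * c\<bar> \<le> C" if "\<bar>c\<bar> \<le> C" for c
    using \<sigma> that by (simp add: abs_mult)
  define U where "U = - (\<theta> * (c2 / \<rho>) * (w * h)) - \<theta> * c3 * (p * h) - \<theta> * c4 * (q * h)
    - \<theta> * (\<sigma> * c5) * (p * w) + \<theta> * (\<sigma> * c1) * (w * q) + c1 * (w * p) + c2 / \<rho> * (w * w)
    + c3 * (w * p) + c4 * (w * q) + c5 * (w * q)"
  have "\<rho> * T + U = ?lhs + (\<sigma> * \<sigma> - 1) * (- (\<theta> * \<rho> * w\<^sup>2) - \<rho> * l * q\<^sup>2 - c5 * w * q - \<rho> * h * w)"
    unfolding T_def U_def by (simp add: algebra_simps power2_eq_square)
  then have eq: "?lhs = \<rho> * T + U"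
    by (simp add: \<sigma>2)
  have U: "\<bar>U\<bar> \<le> 10 * (C * S)"
    unfolding U_def
    using tb[OF shr[OF inv] mem(1) mem(3)] tb[OF shr[OF bd(3)] mem(2) mem(3)] tb[OF shr[OF bd(4)] mem(4) mem(3)]
      tb[OF shr[OF sg[OF bd(5)]] mem(2) mem(1)] tb[OF shr[OF sg[OF bd(1)]] mem(1) mem(4)]
      tb[OF bd(1) mem(1) mem(2)] tb[OF inv mem(1) mem(1)] tb[OF bd(3) mem(1) mem(2)] tb[OF bd(4) mem(1) mem(4)]
      tb[OF bd(5) mem(1) mem(4)]
    unfolding abs_le_iff by (intro conjI; linarith)
  have T: "min \<theta> (k0 / 2) * S \<le> T"
  proof -
    have "\<bar>\<theta> * \<sigma> * (k - l)\<bar> \<le> k0"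
    \<comment> \<open>The cross term is at most \<open>k0 |p q|\<close>, hence at most half of the
      lower bound \<open>k0 (p^2 + q^2)\<close> of the diagonal terms; the other half stays
      available.\<close>
    proof -
      have "\<theta> * \<bar>k - l\<bar> \<le> \<theta> * C" using \<theta> kl by (intro mult_left_mono) auto
      with \<theta>(3) have "\<theta> * \<bar>k - l\<bar> \<le> k0" by linarith
      then show ?thesis using \<theta> \<sigma> by (simp add: abs_mult)
    qed
    then have "\<bar>\<theta> * \<sigma> * (k - l) * (p * q)\<bar> \<le> k0 * \<bar>p * q\<bar>"
      unfolding abs_mult[of _ "p * q"] by (intro mult_right_mono) auto
    also have "\<dots> \<le> k0 * ((p\<^sup>2 + q\<^sup>2) / 2)"
    proof (intro mult_left_mono)
      show "\<bar>p * q\<bar> \<le> (p\<^sup>2 + q\<^sup>2) / 2"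
        using zero_le_power2[of "\<bar>p\<bar> - \<bar>q\<bar>"] by (simp add: power2_diff abs_mult)
    qed (use kl in auto)
    finally have "- (\<theta> * \<sigma> * (k - l) * (p * q)) \<le> k0 * ((p\<^sup>2 + q\<^sup>2) / 2)"
      unfolding abs_le_iff by simp
    moreover have "k0 * ((p\<^sup>2 + q\<^sup>2) / 2) = k0 / 2 * p\<^sup>2 + k0 / 2 * q\<^sup>2"
      by (simp add: field_simps)
    ultimately have "\<theta> * (h\<^sup>2 + w\<^sup>2) + (k - k0 / 2) * p\<^sup>2 + (l - k0 / 2) * q\<^sup>2 \<le> T"
      unfolding T_def left_diff_distrib by linarith
    moreover have "min \<theta> (k0 / 2) * p\<^sup>2 \<le> (k - k0 / 2) * p\<^sup>2" "min \<theta> (k0 / 2) * q\<^sup>2 \<le> (l - k0 / 2) * q\<^sup>2"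
      "min \<theta> (k0 / 2) * (h\<^sup>2 + w\<^sup>2) \<le> \<theta> * (h\<^sup>2 + w\<^sup>2)"
      using kl by (simp_all add: mult_right_mono)
    ultimately show ?thesis by (simp add: S_def algebra_simps)
  qed
  have "\<rho> * (min \<theta> (k0 / 2) * S) \<le> \<rho> * T"
    using T \<rho> by (intro mult_left_mono) auto
  then show ?thesis
    unfolding eq S_def[symmetric] using U by (simp add: algebra_simps)
qed

lemma continuous_on_vec_4:
  fixes f :: "real \<Rightarrow> 'a::real_normed_vector ^ 4"
  assumes "continuous_on S (\<lambda>x. f x $ 1)" "continuous_on S (\<lambda>x. f x $ 2)"
    "continuous_on S (\<lambda>x. f x $ 3)" "continuous_on S (\<lambda>x. f x $ 4)"
  shows "continuous_on S f"
proof -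
  have "continuous_on S (\<lambda>x. \<chi> i. f x $ i)"
    by (rule continuous_on_vec_lambda) (use assms exhaust_4 in metis)
  then show ?thesis by simp
qed

lemma det_zero_kernel:
  fixes A :: "real ^ 'n ^ 'n"
  assumes "det A = 0" obtains y where "y \<noteq> 0" "A *v y = 0"
  using assms by (metis invertible_det_nz invertible_left_inverse matrix_left_invertible_ker)

text \<open>In the application \<open>k\<close> and \<open>l\<close> are the reciprocals of the
  second derivatives of \<open>E\<close> in \<open>v_x\<close> and of \<open>I\<close> in
  \<open>u\<close>, so that their positivity is strong convexity.\<close>

locale wave_system =
  fixes k l c1 c2 c3 c4 c5 :: "real \<Rightarrow> real" and b X :: real
  assumes cont: "continuous_on UNIV k" "continuous_on UNIV l" "continuous_on UNIV c1"
      "continuous_on UNIV c2" "continuous_on UNIV c3" "continuous_on UNIV c4" "continuous_on UNIV c5"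
    and k_pos: "\<And>x. k x > 0" and l_pos: "\<And>x. l x > 0" and b_nz: "b \<noteq> 0" and X_pos: "X > 0"
begin

text \<open>The unknown is \<open>Y = (w, P, g\<^sub>1, g\<^sub>2)\<close>; the \<open>u\<close>-component of the perturbation has been eliminated and
  equals \<open>l g\<^sub>2 - c\<^sub>4 w\<close>.\<close>

definition M :: "real \<Rightarrow> real \<Rightarrow> real ^ 4 ^ 4" where
  "M r x = vector [vector [c1 x, k x, 0, 0], vector [c2 x, c3 x, - 1, c4 x],
     vector [r * b * c5 x, 0, 0, r * b * l x], vector [r * b, 0, 0, 0]]"

text \<open>The derivative of \<open>M r x\<close> in \<open>r\<close>. Its last two components give
  \<open>B^-1 W\<close>, because \<open>b * c5 = a - b * c4\<close> in the application.\<close>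

definition N :: "real \<Rightarrow> real ^ 4 ^ 4" where
  "N x = vector [0, 0, vector [b * c5 x, 0, 0, b * l x], vector [b, 0, 0, 0]]"

lemma M_diff: "M r x - M s x = (r - s) *\<^sub>R N x"
  by (simp add: M_def N_def vec_eq_iff forall_4 algebra_simps)

lemma M_eq: "M r x = M s x + (r - s) *\<^sub>R N x"
  unfolding M_diff[symmetric] by simp

lemma M_mult: "M r x *v Y = vector [c1 x * Y $ 1 + k x * Y $ 2,
    c2 x * Y $ 1 + c3 x * Y $ 2 - Y $ 3 + c4 x * Y $ 4,
    r * b * (c5 x * Y $ 1 + l x * Y $ 4), r * b * Y $ 1]"
  by (simp add: M_def vec_eq_iff forall_4 matrix_vector_mult_def sum_4 algebra_simps)

lemma N_mult: "N x *v Y = vector [0, 0, b * (c5 x * Y $ 1 + l x * Y $ 4), b * Y $ 1]"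
  by (simp add: N_def vec_eq_iff forall_4 matrix_vector_mult_def sum_4 algebra_simps)

lemma continuous_M: "continuous_on UNIV (M r)"
  by (intro continuous_on_vec_4; simp add: M_def; intro continuous_intros cont)

lemma continuous_N: "continuous_on UNIV N"
  by (intro continuous_on_vec_4; simp add: N_def; intro continuous_intros cont)

definition Phi :: "real \<Rightarrow> real \<Rightarrow> real ^ 4 ^ 4" where
  "Phi r = (SOME Y. Y 0 = mat 1 \<and> (\<forall>x. (Y has_vector_derivative M r x ** Y x) (at x)))"

lemma Phi_0: "Phi r 0 = mat 1"
  and Phi_deriv: "(Phi r has_vector_derivative M r x ** Phi r x) (at x)"
proof -
  obtain Y where "Y 0 = mat 1" "\<And>x. (Y has_vector_derivative M r x ** Y x) (at x)"
    using linear_ode_exists[OF bounded_bilinear_matrix_matrix continuous_M] by blast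
  then have "\<exists>Y. Y 0 = mat 1 \<and> (\<forall>x. (Y has_vector_derivative M r x ** Y x) (at x))"
    by blast
  from someI_ex[OF this] show "Phi r 0 = mat 1"
    "(Phi r has_vector_derivative M r x ** Phi r x) (at x)"
    unfolding Phi_def by auto
qed

definition sol :: "real \<Rightarrow> (real \<Rightarrow> real ^ 4) \<Rightarrow> bool" where
  "sol r Y \<longleftrightarrow> (\<forall>x. (Y has_vector_derivative M r x *v Y x) (at x))"

lemma solD: "sol r Y \<Longrightarrow> (Y has_vector_derivative M r x *v Y x) (at x)"
  by (simp add: sol_def)

lemma sol_Phi: "sol r (\<lambda>x. Phi r x *v y)"
  unfolding sol_def
proof
  fix x
  have "bounded_linear (\<lambda>A :: real ^ 4 ^ 4. A *v y)"
    by (rule bounded_bilinear.bounded_linear_left[OF bounded_bilinear_matrix_vector])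
  from bounded_linear.has_vector_derivative[OF this Phi_deriv]
  show "((\<lambda>x. Phi r x *v y) has_vector_derivative M r x *v (Phi r x *v y)) (at x)"
    by (simp add: matrix_vector_mul_assoc)
qed

lemma sol_unique: "sol r Y \<Longrightarrow> sol r Z \<Longrightarrow> Y 0 = Z 0 \<Longrightarrow> Y x = Z x"
  by (rule linear_ode_unique[OF bounded_bilinear_matrix_vector continuous_M]) (auto simp: sol_def)

lemma sol_eq_Phi: "sol r Y \<Longrightarrow> Y x = Phi r x *v Y 0"
  by (rule sol_unique[OF _ sol_Phi]) (auto simp: Phi_0)

lemma sol_nonzero:
  assumes "sol r Y" "Y x0 = 0" shows "Y x = 0"
proof -
  have "Y (x0 + (x - x0)) = 0"
  proof (rule linear_ode_unique_zero[OF bounded_bilinear_matrix_vector,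
        where M = "\<lambda>x. M r (x0 + x)" and Z = "\<lambda>x. Y (x0 + x)"])
    show "continuous_on UNIV (\<lambda>x. M r (x0 + x))"
      by (rule continuous_on_compose2[OF continuous_M]) (auto intro!: continuous_intros)
    fix y
    have "((\<lambda>x. x0 + x) has_vector_derivative 1) (at y)"
      by (auto intro!: derivative_eq_intros simp: has_real_derivative_iff_has_vector_derivative[symmetric])
    from vector_diff_chain_at[OF this solD[OF assms(1)]]
    show "((\<lambda>x. Y (x0 + x)) has_vector_derivative M r (x0 + y) *v Y (x0 + y)) (at y)"
      by (simp add: o_def)
  qed (use assms in simp)
  then show ?thesis by simp
qed

lemmas norm_N_le = bilinear_bound_on_interval[OF bounded_bilinear_matrix_vector continuous_N, of 0 X]
lemmas norm_M_le = bilinear_bound_on_interval[OF bounded_bilinear_matrix_vector continuous_M, of 0 X]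

text \<open>Continuous dependence on the spectral parameter with a constant that is uniform in
  \<open>r\<close>, in the solution and in the forcing. It is used for the continuity of
  \<open>Phi\<close> in \<open>r\<close> and for the expansion at \<open>r = 0\<close>.\<close>

lemma perturbation_bound:
  assumes "C \<ge> 0"
  obtains K where "\<And>r Z f x. \<bar>r - r0\<bar> \<le> 1 \<Longrightarrow>
    (\<And>x. (Z has_vector_derivative M r x *v Z x + f x) (at x)) \<Longrightarrow> Z 0 = 0 \<Longrightarrow>
    (\<And>x. x \<in> {0..X} \<Longrightarrow> norm (f x) \<le> C * \<bar>r - r0\<bar>) \<Longrightarrow> x \<in> {0..X} \<Longrightarrow>
    norm (Z x) \<le> K * \<bar>r - r0\<bar>"
proof -
  obtain C1 where C1: "C1 \<ge> 0" "\<And>x y. x \<in> {0..X} \<Longrightarrow> norm (N x *v y) \<le> C1 * norm y"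
    by (rule norm_N_le) blast
  obtain C2 where C2: "C2 \<ge> 0" "\<And>x y. x \<in> {0..X} \<Longrightarrow> norm (M r0 x *v y) \<le> C2 * norm y"
    by (rule norm_M_le) blast
  define A where "A = C2 + C1"
  have A: "norm (M r x *v y) \<le> A * norm y" if "x \<in> {0..X}" "\<bar>r - r0\<bar> \<le> 1" for r x y
  proof -
    have eq: "M r x *v y = M r0 x *v y + (r - r0) *\<^sub>R (N x *v y)"
      unfolding M_eq[of r x r0] by (simp add: matrix_vector_mult_add_rdistrib scaleR_matrix_vector_assoc)
    have "norm (M r x *v y) \<le> norm (M r0 x *v y) + \<bar>r - r0\<bar> * norm (N x *v y)"
      unfolding eq by (rule order_trans[OF norm_triangle_ineq]) simp
    also have "\<dots> \<le> C2 * norm y + 1 * (C1 * norm y)"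
    proof (rule add_mono)
      show "norm (M r0 x *v y) \<le> C2 * norm y" by (rule C2(2)[OF that(1)])
      show "\<bar>r - r0\<bar> * norm (N x *v y) \<le> 1 * (C1 * norm y)"
        by (rule mult_mono[OF that(2) C1(2)[OF that(1)] zero_le_one norm_ge_zero])
    qed
    finally show ?thesis unfolding A_def distrib_right mult_1 .
  qed
  \<comment> \<open>The square root of the Gronwall factor at \<open>x = X\<close>, for zero initial
    value and forcing at most \<open>C * |r - r0|\<close>.\<close>
  define K where "K = sqrt (exp ((2 * A + 1) * X) * X) * C"
  show thesis
  proof (rule that[of K])
    fix r x and Z f :: "real \<Rightarrow> real ^ 4"
    assume r: "\<bar>r - r0\<bar> \<le> 1" and Z: "\<And>x. (Z has_vector_derivative M r x *v Z x + f x) (at x)"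
      and Z0: "Z 0 = 0" and f: "\<And>x. x \<in> {0..X} \<Longrightarrow> norm (f x) \<le> C * \<bar>r - r0\<bar>" and x: "x \<in> {0..X}"
    have A0: "A \<ge> 0" using C1 C2 by (simp add: A_def)
    have "(norm (Z x))\<^sup>2 \<le> exp ((2 * A + 1) * x) * ((norm (Z 0))\<^sup>2 + (C * \<bar>r - r0\<bar>)\<^sup>2 * x)"
      by (rule gronwall[OF Z _ A0 x])
         (rule order_trans[OF norm_triangle_ineq add_mono[OF A[OF _ r] f]])
    also have "\<dots> = exp ((2 * A + 1) * x) * x * (C * \<bar>r - r0\<bar>)\<^sup>2"
      by (simp add: Z0)
    also have "\<dots> \<le> exp ((2 * A + 1) * X) * X * (C * \<bar>r - r0\<bar>)\<^sup>2"
    proof (rule mult_right_mono[OF mult_mono])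
      show "exp ((2 * A + 1) * x) \<le> exp ((2 * A + 1) * X)"
        unfolding exp_le_cancel_iff using x A0 by (intro mult_left_mono) auto
    qed (use x in auto)
    also have "\<dots> = (K * \<bar>r - r0\<bar>)\<^sup>2"
      using X_pos by (simp add: K_def power_mult_distrib)
    finally show "norm (Z x) \<le> K * \<bar>r - r0\<bar>"
      using X_pos assms by (intro power2_le_imp_le[of "norm (Z x)"]) (auto simp: K_def)
  qed
qed

lemma sol_continuous: "sol r Y \<Longrightarrow> continuous_on S Y"
  unfolding sol_def by (blast intro: continuous_at_imp_continuous_on has_vector_derivative_continuous)

lemma Phi_limit:
  assumes "x \<in> {0..X}"
  shows "((\<lambda>r. Phi r x $ i $ j) \<longlongrightarrow> Phi r0 x $ i $ j) (at r0)"
proof -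
  let ?y = "axis j 1 :: real ^ 4"
  obtain C1 where C1: "C1 \<ge> 0" "\<And>x y. x \<in> {0..X} \<Longrightarrow> norm (N x *v y) \<le> C1 * norm y"
    by (rule norm_N_le) blast
  obtain B where B0: "B \<ge> 0" and B: "\<And>x. x \<in> {0..X} \<Longrightarrow> norm (Phi r0 x *v ?y) \<le> B"
    by (rule continuous_on_compact_bound[OF compact_Icc sol_continuous[OF sol_Phi]]) (rule that)
  obtain K where K: "\<And>r Z f x. \<bar>r - r0\<bar> \<le> 1 \<Longrightarrow>
    (\<And>x. (Z has_vector_derivative M r x *v Z x + f x) (at x)) \<Longrightarrow> Z 0 = 0 \<Longrightarrow>
    (\<And>x. x \<in> {0..X} \<Longrightarrow> norm (f x) \<le> (C1 * B) * \<bar>r - r0\<bar>) \<Longrightarrow> x \<in> {0..X} \<Longrightarrow>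
    norm (Z x) \<le> K * \<bar>r - r0\<bar>"
    by (rule perturbation_bound[of "C1 * B" r0]) (use C1 B0 in auto)
  have "\<bar>Phi r x $ i $ j - Phi r0 x $ i $ j\<bar> \<le> K * \<bar>r - r0\<bar>" if r: "\<bar>r - r0\<bar> \<le> 1" for r
  proof -
    have "norm (Phi r x *v ?y - Phi r0 x *v ?y) \<le> K * \<bar>r - r0\<bar>"
    \<comment> \<open>The difference of two solutions with equal initial values solves the system
      for \<open>r\<close>, forced by \<open>(r - r0) N\<close> applied to the solution for
      \<open>r0\<close>.\<close>
    proof (rule K[OF r _ _ _ assms, of "\<lambda>x. Phi r x *v ?y - Phi r0 x *v ?y"
          "\<lambda>x. (r - r0) *\<^sub>R (N x *v (Phi r0 x *v ?y))"])
      fix y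
      have "M r y *v (Phi r y *v ?y) - M r0 y *v (Phi r0 y *v ?y)
        = M r y *v (Phi r y *v ?y - Phi r0 y *v ?y) + (r - r0) *\<^sub>R (N y *v (Phi r0 y *v ?y))"
        unfolding scaleR_matrix_vector_assoc M_diff[of r y r0, symmetric]
          matrix_vector_mult_diff_rdistrib matrix_vector_mult_diff_distrib by simp
      then show "((\<lambda>x. Phi r x *v ?y - Phi r0 x *v ?y) has_vector_derivative
          M r y *v (Phi r y *v ?y - Phi r0 y *v ?y) + (r - r0) *\<^sub>R (N y *v (Phi r0 y *v ?y))) (at y)"
        using has_vector_derivative_diff[OF solD[OF sol_Phi[of r ?y], of y] solD[OF sol_Phi[of r0 ?y], of y]]
        by (simp only:)
    next
      fix x assume x: "x \<in> {0..X}"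
      have "norm (N x *v (Phi r0 x *v ?y)) \<le> C1 * B"
        using C1(2)[OF x] mult_left_mono[OF B[OF x] C1(1)] order_trans by blast
      then show "norm ((r - r0) *\<^sub>R (N x *v (Phi r0 x *v ?y))) \<le> C1 * B * \<bar>r - r0\<bar>"
        by (simp add: mult.commute[of "\<bar>r - r0\<bar>"] mult_right_mono)
    qed (simp add: Phi_0)
    moreover have "\<bar>Phi r x $ i $ j - Phi r0 x $ i $ j\<bar> \<le> norm (Phi r x *v ?y - Phi r0 x *v ?y)"
      using component_le_norm_cart[of "Phi r x *v ?y - Phi r0 x *v ?y" i]
      by (simp add: matrix_vector_mult_basis column_def)
    ultimately show ?thesis by linarith
  qed
  then have ev: "\<forall>\<^sub>F r in at r0. norm (Phi r x $ i $ j - Phi r0 x $ i $ j) \<le> K * \<bar>r - r0\<bar>"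
    unfolding eventually_at by (intro exI[of _ 1]) (auto simp: dist_real_def)
  have "((\<lambda>r. K * \<bar>r - r0\<bar>) \<longlongrightarrow> K * \<bar>r0 - r0\<bar>) (at r0)"
    by (intro tendsto_intros)
  then have "((\<lambda>r. Phi r x $ i $ j - Phi r0 x $ i $ j) \<longlongrightarrow> 0) (at r0)"
    by (intro Lim_null_comparison[OF ev]) simp
  then show ?thesis by (rule LIM_zero_cancel)
qed

text \<open>The length is a separate argument because it is varied, at fixed \<open>r\<close>, to
  find the sign for large \<open>r\<close>.\<close>

definition Dt :: "real \<Rightarrow> real \<Rightarrow> real" where
  "Dt r L = det (Phi r L - mat 1)"

lemma Dt_continuous: "isCont (\<lambda>r. Dt r X) r0"
  unfolding Dt_def isCont_def
  by (intro tendsto_det_4) (simp, intro tendsto_diff tendsto_const Phi_limit, use X_pos in auto)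

lemma Dt_continuous_length: "isCont (\<lambda>L. Dt r L) L"
proof -
  have "isCont (Phi r) L" by (rule has_vector_derivative_continuous[OF Phi_deriv])
  then show ?thesis
    unfolding Dt_def isCont_def
    by (intro tendsto_det_4) (simp, intro tendsto_diff tendsto_const tendsto_vec_nth)
qed

end

section \<open>Sign of the determinant for large spectral parameter\<close>

lemma det_scaleR_4:
  fixes A :: "real ^ 4 ^ 4"
  shows "det (c *\<^sub>R A) = c ^ 4 * det A"
  unfolding det_4 vector_scaleR_component real_scaleR_def by algebra

lemma lyapunov_derivative:
  assumes "(w has_real_derivative w') (at x)" "(p has_real_derivative p') (at x)"
    "(h has_real_derivative h') (at x)" "(q has_real_derivative q') (at x)"
  shows "((\<lambda>x. \<theta> * (- p x * h x + \<sigma> * w x * q x) + w x * p x + \<sigma> * h x * q x) has_real_derivative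
    \<theta> * (- p' * h x - p x * h' + \<sigma> * w' * q x + \<sigma> * w x * q') + w' * p x + w x * p'
      + \<sigma> * h' * q x + \<sigma> * h x * q') (at x)"
  by (rule derivative_eq_intros assms refl)+ (simp add: algebra_simps)

context wave_system begin

text \<open>\<open>Phi r L - 1\<close> is \<open>L * M r 0\<close> to first order, so
  \<open>Dt r L / L^4\<close> tends to \<open>det (M r 0) = (r b)^2 k l\<close>, which is positive
  whatever the signs of \<open>r\<close> and \<open>b\<close>.\<close>

lemma Dt_small_length:
  assumes "r \<noteq> 0"
  shows "\<forall>\<^sub>F L in at_right 0. Dt r L > 0"
proof -
  have lim: "((\<lambda>L. ((1 / L) *\<^sub>R (Phi r L - mat 1)) $ i $ j) \<longlongrightarrow> M r 0 $ i $ j) (at 0)" for i j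
  proof -
    have "((\<lambda>L. Phi r L $ i $ j) has_real_derivative (M r 0 ** Phi r 0) $ i $ j) (at 0)"
      unfolding has_real_derivative_iff_has_vector_derivative
      by (intro has_vector_derivative_vec_nth Phi_deriv)
    from DERIV_D[OF this] show ?thesis
      by (simp add: Phi_0 divide_inverse mult.commute)
  qed
  have "((\<lambda>L. det ((1 / L) *\<^sub>R (Phi r L - mat 1))) \<longlongrightarrow> det (M r 0)) (at 0)"
    by (intro tendsto_det_4 lim)
  moreover have "det ((1 / L) *\<^sub>R A) = det A / L ^ 4" for L and A :: "real ^ 4 ^ 4"
    unfolding det_scaleR_4 by (simp add: power_one_over)
  ultimately have "((\<lambda>L. Dt r L / L ^ 4) \<longlongrightarrow> det (M r 0)) (at 0)"
    by (simp add: Dt_def)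
  moreover have "det (M r 0) = (r * b)\<^sup>2 * k 0 * l 0"
    by (simp add: det_4 M_def power2_eq_square)
  then have "det (M r 0) > 0"
    using assms b_nz k_pos l_pos by simp
  ultimately have "\<forall>\<^sub>F L in at 0. Dt r L / L ^ 4 > 0"
    by (auto dest: order_tendstoD(1))
  then have "\<forall>\<^sub>F L in at_right 0. Dt r L / L ^ 4 > 0"
    by (simp add: eventually_at_split)
  then show ?thesis
    using eventually_at_right_less[of "0::real"]
    by eventually_elim (simp add: zero_less_divide_iff)
qed

lemma Dt_zero_solution:
  assumes "Dt r L = 0"
  obtains Y where "sol r Y" "Y L = Y 0" "\<And>x. Y x \<noteq> 0"
proof -
  obtain y where y: "y \<noteq> 0" "(Phi r L - mat 1) *v y = 0"
    using assms det_zero_kernel unfolding Dt_def by blast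
  let ?Y = "\<lambda>x. Phi r x *v y"
  have "?Y x \<noteq> 0" for x
  proof
    assume "?Y x = 0"
    from sol_nonzero[OF sol_Phi this, of 0] y show False by (simp add: Phi_0)
  qed
  moreover have "?Y L = ?Y 0"
    using y by (simp add: Phi_0 matrix_vector_mult_diff_rdistrib)
  ultimately show thesis
    using that[OF sol_Phi] by blast
qed

text \<open>After the parabolic scaling \<open>P \<sim> \<rho>\<close>, \<open>g\<^sub>1 \<sim> \<rho>\<^sup>2\<close>, \<open>g\<^sub>2 \<sim> \<rho>\<close> with
  \<open>\<rho>\<^sup>2 = r \<bar>b\<bar>\<close> an indefinite quadratic form increases strictly along every nonzero solution,
  so that no solution returns to its initial value.\<close>

lemma Dt_nonzero_large:
  obtains r1 where "r1 > 0" "\<And>r L. r \<ge> r1 \<Longrightarrow> L \<in> {0<..X} \<Longrightarrow> Dt r L \<noteq> 0"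
proof -
  have "\<exists>B. \<forall>x\<in>{0..X}. \<bar>f x\<bar> \<le> B" if f: "continuous_on UNIV f" for f :: "real \<Rightarrow> real"
  proof -
    obtain B where "\<And>x. x \<in> {0..X} \<Longrightarrow> norm (f x) \<le> B"
      by (rule continuous_on_compact_bound[OF compact_Icc continuous_on_subset[OF f subset_UNIV]]) (rule that)
    then show ?thesis by (intro exI[of _ B]) simp
  qed
  note bounded = this[THEN exE]
  have diff: "continuous_on UNIV (\<lambda>x. k x - l x)"
    by (intro continuous_intros cont)
  obtain B1 B2 B3 B4 B5 B6 where B: "\<forall>x\<in>{0..X}. \<bar>c1 x\<bar> \<le> B1" "\<forall>x\<in>{0..X}. \<bar>c2 x\<bar> \<le> B2"
    "\<forall>x\<in>{0..X}. \<bar>c3 x\<bar> \<le> B3" "\<forall>x\<in>{0..X}. \<bar>c4 x\<bar> \<le> B4" "\<forall>x\<in>{0..X}. \<bar>c5 x\<bar> \<le> B5" "\<forall>x\<in>{0..X}. \<bar>k x - l x\<bar> \<le> B6"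
    by (rule bounded[OF cont(3)], rule bounded[OF cont(4)], rule bounded[OF cont(5)],
        rule bounded[OF cont(6)], rule bounded[OF cont(7)], rule bounded[OF diff]) (rule that)
  define C where "C = Max {1, B1, B2, B3, B4, B5, B6}"
  have C: "1 \<le> C" "B1 \<le> C" "B2 \<le> C" "B3 \<le> C" "B4 \<le> C" "B5 \<le> C" "B6 \<le> C"
    unfolding C_def by (rule Max_ge; simp)+
  have minimum: "\<exists>m>0. \<forall>x\<in>{0..X}. m \<le> f x" if "continuous_on UNIV f" "\<And>x. f x > 0" for f :: "real \<Rightarrow> real"
  proof -
    have "continuous_on {0..X} f"
      by (rule continuous_on_subset[OF that(1)]) simp
    then obtain y where "y \<in> {0..X}" "\<And>x. x \<in> {0..X} \<Longrightarrow> f y \<le> f x"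
      using continuous_attains_inf[of "{0..X}" f] X_pos by fastforce
    then show ?thesis using that(2)[of y] by blast
  qed
  obtain k1 where k1: "k1 > 0" "\<And>x. x \<in> {0..X} \<Longrightarrow> k1 \<le> k x"
    using minimum[OF cont(1) k_pos] by blast
  obtain l1 where l1: "l1 > 0" "\<And>x. x \<in> {0..X} \<Longrightarrow> l1 \<le> l x"
    using minimum[OF cont(2) l_pos] by blast
  define k0 where "k0 = min k1 l1"
  have k0: "k0 > 0" "\<And>x. x \<in> {0..X} \<Longrightarrow> k0 \<le> k x" "\<And>x. x \<in> {0..X} \<Longrightarrow> k0 \<le> l x"
    using k1 l1 by (auto simp: k0_def intro: order_trans[OF min.cobounded1] order_trans[OF min.cobounded2])
  \<comment> \<open>As large as the absorption of the cross term in \<open>lyapunov_bound\<close>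
    permits.\<close>
  define \<theta> where "\<theta> = min 1 (k0 / C)"
  have "\<theta> \<le> k0 / C" by (simp add: \<theta>_def)
  then have "\<theta> * C \<le> k0"
    using C by (simp add: pos_le_divide_eq)
  moreover have "0 < \<theta>" "\<theta> \<le> 1"
    using k0 C by (auto simp: \<theta>_def)
  ultimately have \<theta>: "0 < \<theta>" "\<theta> \<le> 1" "\<theta> * C \<le> k0" by auto
  define \<mu> where "\<mu> = min \<theta> (k0 / 2)"
  have \<mu>: "\<mu> > 0" using \<theta> k0 by (simp add: \<mu>_def)
  \<comment> \<open>Chosen so that \<open>R * \<mu> = 10 * C + \<mu>\<close>; then \<rho> at least
    \<open>R\<close> makes the coefficient in \<open>lyapunov_bound\<close> positive.\<close>
  define R where "R = 10 * C / \<mu> + 1"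
  have R: "R \<ge> 1" using C \<mu> by (simp add: R_def)
  \<comment> \<open>\<open>r \<ge> r1\<close> is exactly \<rho> at least \<open>R\<close>, since
    \<open>\<rho>^2 = r * |b|\<close>.\<close>
  define r1 where "r1 = R\<^sup>2 / \<bar>b\<bar>"
  show thesis
  proof (rule that[of r1])
    show "r1 > 0" using R b_nz by (simp add: r1_def)
    fix r L assume r: "r \<ge> r1" and L: "L \<in> {0<..X}"
    define \<rho> where "\<rho> = sqrt (r * \<bar>b\<bar>)"
    have rb: "r * \<bar>b\<bar> \<ge> R\<^sup>2" using r b_nz by (simp add: r1_def field_simps)
    have \<rho>R: "\<rho> \<ge> R" unfolding \<rho>_def by (rule real_le_rsqrt[OF rb])
    have \<rho>1: "\<rho> \<ge> 1" using \<rho>R R by linarith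
    have \<rho>2: "\<rho> * \<rho> = r * \<bar>b\<bar>"
      unfolding \<rho>_def by (rule real_sqrt_mult_self[THEN trans], rule abs_of_nonneg) (rule order_trans[OF zero_le_power2 rb])
    \<comment> \<open>The sign of \<open>b\<close> is carried by \<sigma>, so that
      \<open>r * b = \<sigma> * \<rho>^2\<close> and one form covers both signs.\<close>
    define \<sigma> where "\<sigma> = sgn b"
    have \<sigma>: "\<bar>\<sigma>\<bar> = 1" using b_nz by (simp add: \<sigma>_def)
    have rb\<sigma>: "r * b = \<sigma> * (\<rho> * \<rho>)"
      unfolding \<rho>2 \<sigma>_def using mult_sgn_abs[of b] by (simp add: algebra_simps)
    have pos: "\<rho> * \<mu> - 10 * C > 0"
    proof -
      have "R * \<mu> \<le> \<rho> * \<mu>" using \<rho>R \<mu> by (intro mult_right_mono) auto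
      moreover have "R * \<mu> = 10 * C + \<mu>" using \<mu> by (simp add: R_def field_simps)
      ultimately show ?thesis using \<mu> by linarith
    qed
    show "Dt r L \<noteq> 0"
    proof
      assume "Dt r L = 0"
      then obtain Y where Y: "sol r Y" "Y L = Y 0" "\<And>x. Y x \<noteq> 0"
        using Dt_zero_solution by blast
      define w where "w x = Y x $ 1" for x
      define p where "p x = Y x $ 2 / \<rho>" for x
      define h where "h x = Y x $ 3 / (\<rho> * \<rho>)" for x
      define q where "q x = Y x $ 4 / \<rho>" for x
      have comp: "((\<lambda>x. Y x $ i) has_real_derivative (M r x *v Y x) $ i) (at x)" for i x
        unfolding has_real_derivative_iff_has_vector_derivative
        by (rule has_vector_derivative_vec_nth[OF solD[OF Y(1)]])
      have Yc: "Y x $ 1 = w x" "Y x $ 2 = \<rho> * p x" "Y x $ 3 = \<rho> * \<rho> * h x" "Y x $ 4 = \<rho> * q x" for x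
        using \<rho>1 by (auto simp: w_def p_def h_def q_def)
      have dw: "(w has_real_derivative \<rho> * k x * p x + c1 x * w x) (at x)" for x
        using comp[of 1 x] unfolding M_mult Yc by (simp add: algebra_simps)
      have dp: "(p has_real_derivative - \<rho> * h x + c2 x * w x / \<rho> + c3 x * p x + c4 x * q x) (at x)" for x
        using DERIV_cdivide[OF comp[of 2 x], of \<rho>] \<rho>1 unfolding M_mult Yc p_def[abs_def, symmetric]
        by (simp add: field_simps)
      have dh: "(h has_real_derivative \<sigma> * \<rho> * l x * q x + \<sigma> * c5 x * w x) (at x)" for x
      proof -
        have "\<sigma> * (\<rho> * \<rho>) * (c5 x * w x + l x * (\<rho> * q x)) / (\<rho> * \<rho>) = \<sigma> * \<rho> * l x * q x + \<sigma> * c5 x * w x"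
          using \<rho>1 by (subst nonzero_divide_eq_eq) (auto simp: algebra_simps)
        then show ?thesis
          using DERIV_cdivide[OF comp[of 3 x], of "\<rho> * \<rho>"] \<rho>1 unfolding M_mult Yc rb\<sigma> h_def[abs_def, symmetric]
          by simp
      qed
      have dq: "(q has_real_derivative \<sigma> * \<rho> * w x) (at x)" for x
        using DERIV_cdivide[OF comp[of 4 x], of \<rho>] \<rho>1 unfolding M_mult Yc rb\<sigma> q_def[abs_def, symmetric]
        by (simp add: field_simps)
      define F where "F x = \<theta> * (- p x * h x + \<sigma> * w x * q x) + w x * p x + \<sigma> * h x * q x" for x
      have "\<exists>d. (F has_real_derivative d) (at x) \<and> d > 0" if x: "x \<in> {0..X}" for x
      proof -
        have "\<bar>f x\<bar> \<le> C" if "\<forall>x\<in>{0..X}. \<bar>f x\<bar> \<le> B" "B \<le> C" for f B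
          using that x by force
        note bd = this[OF B(1) C(2)] this[OF B(2) C(3)] this[OF B(3) C(4)] this[OF B(4) C(5)] this[OF B(5) C(6)]
        note bd6 = order_trans[OF B(6)[rule_format, OF x] C(7)]
        note derivative = lyapunov_derivative[OF dw dp dh dq, of \<theta> \<sigma> x, folded F_def]
        note lower = lyapunov_bound[OF bd k0(2)[OF x] k0(3)[OF x] bd6 k0(1) \<theta> \<sigma> \<rho>1]
        have "(w x)\<^sup>2 + (p x)\<^sup>2 + (h x)\<^sup>2 + (q x)\<^sup>2 > 0"
        proof (rule ccontr)
          assume "\<not> ?thesis"
          then have "(w x)\<^sup>2 = 0" "(p x)\<^sup>2 = 0" "(h x)\<^sup>2 = 0" "(q x)\<^sup>2 = 0"
            using zero_le_power2[of "w x"] zero_le_power2[of "p x"] zero_le_power2[of "h x"] zero_le_power2[of "q x"]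
            by linarith+
          then have "Y x = 0"
            using Yc[of x] by (simp add: vec_eq_iff forall_4)
          with Y(3) show False by blast
        qed
        then have "(\<rho> * min \<theta> (k0 / 2) - 10 * C) * ((w x)\<^sup>2 + (p x)\<^sup>2 + (h x)\<^sup>2 + (q x)\<^sup>2) > 0"
          using pos unfolding \<mu>_def by (intro mult_pos_pos)
        then show ?thesis
          using derivative less_le_trans[OF _ lower] by blast
      qed
      note inc = this
      have "F 0 < F L"
      \<comment> \<open>Positivity of the derivative holds on all of \<open>[0, X]\<close>, which
        contains \<open>[0, L]\<close>; no sign of \<open>F\<close> itself enters.\<close>
      proof (rule DERIV_pos_imp_increasing[where f = F])
        show "\<exists>d. (F has_real_derivative d) (at x) \<and> d > 0" if "0 \<le> x" "x \<le> L" for x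
          by (rule inc) (use that L in auto)
      qed (use L in auto)
      moreover have "F L = F 0"
        by (simp add: F_def w_def p_def h_def q_def Y(2))
      ultimately show False by simp
    qed
  qed
qed

lemma Dt_positive_large: "\<forall>\<^sub>F r in at_top. Dt r X > 0"
proof -
  obtain r1 where r1: "r1 > 0" "\<And>r L. r \<ge> r1 \<Longrightarrow> L \<in> {0<..X} \<Longrightarrow> Dt r L \<noteq> 0"
    using Dt_nonzero_large by blast
  have "Dt r X > 0" if "r \<ge> r1" for r
  proof (rule ccontr)
    assume "\<not> Dt r X > 0"
    have "\<forall>\<^sub>F L in at_right 0. Dt r L > 0 \<and> L \<in> {0<..<X}"
      by (rule eventually_conj[OF Dt_small_length eventually_at_right_real[OF X_pos]]) (use that r1 in auto)
    then obtain L0 where L0: "0 < L0" "L0 < X" "Dt r L0 > 0"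
      by (metis (no_types, lifting) eventually_happens trivial_limit_at_right_real greaterThanLessThan_iff)
    have "\<exists>L\<ge>L0. L \<le> X \<and> Dt r L = 0"
      by (rule IVT2) (use L0 \<open>\<not> Dt r X > 0\<close> Dt_continuous_length in auto)
    then show False using r1(2)[OF that] L0 by fastforce
  qed
  then show ?thesis
    unfolding eventually_at_top_linorder by blast
qed

end

section \<open>Small spectral parameter\<close>

lemma tendsto_of_linear_bound:
  fixes f :: "real \<Rightarrow> real"
  assumes "\<And>r. r \<noteq> 0 \<Longrightarrow> \<bar>r\<bar> \<le> 1 \<Longrightarrow> \<bar>f r - z\<bar> \<le> K * \<bar>r\<bar>"
  shows "(f \<longlongrightarrow> z) (at 0)"
proof -
  have ev: "\<forall>\<^sub>F r in at 0. norm (f r - z) \<le> K * \<bar>r\<bar>"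
    unfolding eventually_at by (intro exI[of _ 1]) (use assms in \<open>auto simp: dist_real_def\<close>)
  have "((\<lambda>r. K * \<bar>r\<bar>) \<longlongrightarrow> K * \<bar>0\<bar>) (at 0)"
    by (intro tendsto_mult tendsto_const tendsto_rabs tendsto_ident_at)
  then have "((\<lambda>r. f r - z) \<longlongrightarrow> 0) (at 0)"
    by (intro Lim_null_comparison[OF ev]) simp
  then show ?thesis by (rule LIM_zero_cancel)
qed

text \<open>\<open>Yx\<close> is the translational solution \<open>U\<^sub>x\<close>; \<open>Yp j\<close> and \<open>Xp j\<close> are the derivatives of the profile and
  of the period with respect to the \<open>j\<close>-th parameter, in the order \<open>\<mu>, \<lambda>\<^sub>1, \<lambda>\<^sub>2, c\<close>.\<close>

locale wave_family = wave_system k l c1 c2 c3 c4 c5 b X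
  for k l c1 c2 c3 c4 c5 :: "real \<Rightarrow> real" and b X :: real +
  fixes a :: real and v u :: "real \<Rightarrow> real" and Yx :: "real \<Rightarrow> real ^ 4"
    and Yp :: "4 \<Rightarrow> real \<Rightarrow> real ^ 4" and Xp :: "4 \<Rightarrow> real"
  assumes c3: "\<And>x. c3 x = - c1 x" and c5: "\<And>x. b * c5 x = a - b * c4 x"
    and dv: "\<And>x. (v has_real_derivative Yx x $ 1) (at x)"
    and du: "\<And>x. (u has_real_derivative - c4 x * Yx x $ 1) (at x)"
    and Yx: "sol 0 Yx" and Yx34: "\<And>x. Yx x $ 3 = 0" "\<And>x. Yx x $ 4 = 0"
    and Yp: "\<And>j x. (Yp j has_vector_derivative M 0 x *v Yp j x - (if j = 4 then N x *v Yx x else 0)) (at x)"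
    and Yp34: "\<And>j. j \<noteq> 4 \<Longrightarrow> Yp j 0 $ 3 = (if j = 2 then 1 else 0)"
      "\<And>j. j \<noteq> 4 \<Longrightarrow> Yp j 0 $ 4 = (if j = 3 then 1 else 0)"
    and per: "v X = v 0" "u X = u 0" "Yx X = Yx 0"
    and jump: "\<And>j. Yp j X $ 1 - Yp j 0 $ 1 = - Xp j * Yx 0 $ 1"
      "\<And>j. Yp j X $ 2 - Yp j 0 $ 2 = - Xp j * Yx 0 $ 2"
    and wronskian: "Yx 0 $ 1 * Yp 1 0 $ 2 - Yx 0 $ 2 * Yp 1 0 $ 1 = 1"
begin

lemma DERIV_Yx: "((\<lambda>x. Yx x $ 1) has_real_derivative c1 x * Yx x $ 1 + k x * Yx x $ 2) (at x)"
  "((\<lambda>x. Yx x $ 2) has_real_derivative c2 x * Yx x $ 1 + c3 x * Yx x $ 2) (at x)"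
  using has_vector_derivative_vec_nth[OF solD[OF Yx], of 1 x] has_vector_derivative_vec_nth[OF solD[OF Yx], of 2 x]
  by (simp_all add: has_real_derivative_iff_has_vector_derivative M_mult Yx34)

lemma NYx: "N x *v Yx x = vector [0, 0, a * Yx x $ 1 + b * (- c4 x * Yx x $ 1), b * Yx x $ 1]"
proof -
  have "b * (c5 x * Yx x $ 1 + l x * 0) = (a - b * c4 x) * Yx x $ 1"
    unfolding c5[symmetric] by simp
  also have "\<dots> = a * Yx x $ 1 + b * (- c4 x * Yx x $ 1)"
    by (simp add: algebra_simps)
  finally show ?thesis
    unfolding N_mult Yx34 by (rule arg_cong)
qed

section \<open>Jumps over one period\<close>

definition row3 :: "(real \<Rightarrow> real ^ 4) \<Rightarrow> real" where "row3 T = integral {0..X} (\<lambda>x. (N x *v T x) $ 3)"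
definition row4 :: "(real \<Rightarrow> real ^ 4) \<Rightarrow> real" where "row4 T = integral {0..X} (\<lambda>x. (N x *v T x) $ 4)"
definition row2 :: "(real \<Rightarrow> real ^ 4) \<Rightarrow> real" where
  "row2 T = integral {0..X} (\<lambda>x. v x * (N x *v T x) $ 3 + u x * (N x *v T x) $ 4)"
text \<open>The flux row pairs the first two jumps with the vector orthogonal to
  \<open>(Yx 0 $ 1, Yx 0 $ 2)\<close>, so this row supplies the component along that vector. Unlike
  the other three it carries no factor \<open>r\<close>.\<close>

definition row1 :: "(real \<Rightarrow> real ^ 4) \<Rightarrow> real" where
  "row1 T = Yx 0 $ 1 * (T X $ 1 - T 0 $ 1) + Yx 0 $ 2 * (T X $ 2 - T 0 $ 2)"

text \<open>\<open>g'\<close> stands for the contribution of the forcing \<open>N *v Yx\<close>. It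
  has a primitive with equal values at both ends, so only the part with the factor \<open>r\<close>
  survives over the period.\<close>

lemma integral_derivative:
  assumes "\<And>x. (f has_real_derivative r * g x + g' x) (at x)" "\<And>x. (h has_real_derivative g' x) (at x)"
    "h X = h 0" "continuous_on {0..X} g"
  shows "f X - f 0 = r * integral {0..X} g"
proof -
  have D: "((\<lambda>x. f x - h x) has_real_derivative r * g x) (at x)" for x
    by (rule DERIV_cong[OF DERIV_diff[OF assms(1,2)]]) simp
  have "((\<lambda>x. r * g x) has_integral ((f X - h X) - (f 0 - h 0))) {0..X}"
  proof (rule fundamental_theorem_of_calculus)
    show "((\<lambda>x. f x - h x) has_vector_derivative r * g x) (at x within {0..X})" for x
      by (rule has_vector_derivative_at_within)
         (rule D[unfolded has_real_derivative_iff_has_vector_derivative])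
  qed (use X_pos in simp)
  moreover have "((\<lambda>x. r * g x) has_integral (r * integral {0..X} g)) {0..X}"
    by (rule has_integral_mult_right[OF integrable_integral[OF integrable_continuous_real[OF assms(4)]]])
  ultimately have "(f X - h X) - (f 0 - h 0) = r * integral {0..X} g"
    by (rule has_integral_unique)
  then show ?thesis
    using assms(3) by simp
qed

lemma continuous_vu: "continuous_on S v" "continuous_on S u"
  by (intro continuous_at_imp_continuous_on ballI DERIV_isCont[OF dv] DERIV_isCont[OF du])+

lemma continuous_N_mult: "continuous_on {0..X} T \<Longrightarrow> continuous_on {0..X} (\<lambda>x. (N x *v T x) $ i)"
  by (intro continuous_on_component bounded_bilinear.continuous_on[OF bounded_bilinear_matrix_vector]
      continuous_on_subset[OF continuous_N]) auto

text \<open>The self-adjointness of the second variation enters through the flux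
  \<open>v\<^sub>x P - \<pi>\<^sub>x w + U \<bullet> g\<close>, whose derivative along solutions is \<open>r\<close> times the linearised impulse.\<close>

lemma jump_identities:
  assumes T: "\<And>x. (T has_vector_derivative M r x *v T x + \<epsilon> *\<^sub>R (N x *v Yx x)) (at x)"
  shows "T X $ 3 - T 0 $ 3 = r * row3 T" (is ?g1)
    and "T X $ 4 - T 0 $ 4 = r * row4 T" (is ?g2)
    and "Yx 0 $ 1 * (T X $ 2 - T 0 $ 2) - Yx 0 $ 2 * (T X $ 1 - T 0 $ 1)
      + v 0 * (T X $ 3 - T 0 $ 3) + u 0 * (T X $ 4 - T 0 $ 4) = r * row2 T" (is ?g3)
proof -
  have contT: "continuous_on {0..X} T"
    by (intro continuous_at_imp_continuous_on ballI has_vector_derivative_continuous[OF T])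
  have D: "((\<lambda>x. T x $ i) has_real_derivative (M r x *v T x + \<epsilon> *\<^sub>R (N x *v Yx x)) $ i) (at x)" for i x
    unfolding has_real_derivative_iff_has_vector_derivative by (rule has_vector_derivative_vec_nth[OF T])
  have D1: "((\<lambda>x. T x $ 1) has_real_derivative c1 x * T x $ 1 + k x * T x $ 2) (at x)" for x
    using D[of 1 x] by (simp add: M_mult N_mult)
  have D2: "((\<lambda>x. T x $ 2) has_real_derivative c2 x * T x $ 1 + c3 x * T x $ 2 - T x $ 3 + c4 x * T x $ 4) (at x)" for x
    using D[of 2 x] by (simp add: M_mult N_mult)
  have D3: "((\<lambda>x. T x $ 3) has_real_derivative
      r * (N x *v T x) $ 3 + \<epsilon> * (a * Yx x $ 1 + b * (- c4 x * Yx x $ 1))) (at x)" for x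
    using D[of 3 x] by (simp add: M_mult NYx) (simp add: N_mult mult.assoc)
  have D4: "((\<lambda>x. T x $ 4) has_real_derivative r * (N x *v T x) $ 4 + \<epsilon> * (b * Yx x $ 1)) (at x)" for x
    using D[of 4 x] by (simp add: M_mult NYx) (simp add: N_mult mult.assoc)
  show ?g1 unfolding row3_def
  \<comment> \<open>\<open>N *v Yx\<close> is the x-derivative of
    \<open>B^-1 U = (a v + b u, b v)\<close>, which takes equal values at both ends.\<close>
  proof (rule integral_derivative[where h = "\<lambda>x. \<epsilon> * (a * v x + b * u x)", OF D3])
    show "((\<lambda>x. \<epsilon> * (a * v x + b * u x)) has_real_derivative
        \<epsilon> * (a * Yx x $ 1 + b * (- c4 x * Yx x $ 1))) (at x)" for x
      by (intro DERIV_cmult DERIV_add dv du)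
  qed (use per contT continuous_N_mult in auto)
  show ?g2 unfolding row4_def
  proof (rule integral_derivative[where h = "\<lambda>x. \<epsilon> * (b * v x)", OF D4])
    show "((\<lambda>x. \<epsilon> * (b * v x)) has_real_derivative \<epsilon> * (b * Yx x $ 1)) (at x)" for x
      by (intro DERIV_cmult dv)
  qed (use per contT continuous_N_mult in auto)
  define f where "f x = Yx x $ 1 * T x $ 2 - Yx x $ 2 * T x $ 1 + v x * T x $ 3 + u x * T x $ 4" for x
  have "f X - f 0 = r * row2 T"
    unfolding row2_def
  \<comment> \<open>The primitive is \<epsilon> times the impulse \<open>Q(U)\<close>.\<close>
  proof (rule integral_derivative[where h = "\<lambda>x. \<epsilon> * (a / 2 * (v x * v x) + b * (v x * u x))"
        and g' = "\<lambda>x. \<epsilon> * (v x * (a * Yx x $ 1 + b * (- c4 x * Yx x $ 1)) + u x * (b * Yx x $ 1))"])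
    fix x
    show "(f has_real_derivative r * (v x * (N x *v T x) $ 3 + u x * (N x *v T x) $ 4)
        + \<epsilon> * (v x * (a * Yx x $ 1 + b * (- c4 x * Yx x $ 1)) + u x * (b * Yx x $ 1))) (at x)"
      unfolding f_def[abs_def]
      \<comment> \<open>The terms with \<open>k\<close> and \<open>c2\<close> cancel by
        antisymmetry, those with \<open>c1\<close> because \<open>c3 = - c1\<close>, and those with
        \<open>c4\<close> because \<open>u_x = - c4 v_x\<close>. Only \<open>v\<close> and
        \<open>u\<close> times the derivatives of the last two components of \<open>T\<close>
        remain.\<close>
      by (rule derivative_eq_intros DERIV_Yx D1 D2 D3 D4 dv du refl)+ (simp add: c3 algebra_simps)
    show "((\<lambda>x. \<epsilon> * (a / 2 * (v x * v x) + b * (v x * u x))) has_real_derivative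
      \<epsilon> * (v x * (a * Yx x $ 1 + b * (- c4 x * Yx x $ 1)) + u x * (b * Yx x $ 1))) (at x)"
      by (rule DERIV_cong[OF DERIV_cmult[OF DERIV_add[OF DERIV_cmult[OF DERIV_mult[OF dv dv]]
            DERIV_cmult[OF DERIV_mult[OF dv du]]], of \<epsilon> "a / 2" b x]]) (simp add: field_simps)
  next
    show "continuous_on {0..X} (\<lambda>x. v x * (N x *v T x) $ 3 + u x * (N x *v T x) $ 4)"
      by (intro continuous_on_add continuous_on_mult continuous_vu continuous_N_mult contT)
  qed (use per in auto)
  then show ?g3
    by (simp add: f_def per algebra_simps)
qed

text \<open>The columns are arranged in the order \<open>- c, \<mu>, \<lambda>\<^sub>1, \<lambda>\<^sub>2\<close>.\<close>

definition nx :: "4 \<Rightarrow> 4" where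
  "nx j = (if j = 2 then 1 else if j = 3 then 2 else 3)"

text \<open>\<open>Yx\<close> is periodic, so subtracting it leaves the jump unchanged; the jump of
  the solution that starts at \<open>Yx 0 - r *\<^sub>R Yp 4 0\<close> is thus exactly
  \<open>r\<close> times the jump of \<open>col1\<close>. Subtraction also makes the quotient
  converge to \<open>- Yp 4\<close>, at the price of the forcing \<open>N *v Yx\<close>.\<close>

definition col1 :: "real \<Rightarrow> real \<Rightarrow> real ^ 4" where
  "col1 r x = (1 / r) *\<^sub>R (Phi r x *v (Yx 0 - r *\<^sub>R Yp 4 0) - Yx x)"

definition col :: "4 \<Rightarrow> real \<Rightarrow> real \<Rightarrow> real ^ 4" where
  "col j r x = (if j = 1 then col1 r x else Phi r x *v Yp (nx j) 0)"

definition col0 :: "4 \<Rightarrow> real \<Rightarrow> real ^ 4" where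
  "col0 j x = (if j = 1 then - Yp 4 x else Yp (nx j) x)"

lemma col_deriv:
  assumes "r \<noteq> 0"
  shows "(col j r has_vector_derivative M r x *v col j r x + (if j = 1 then 1 else 0) *\<^sub>R (N x *v Yx x)) (at x)"
proof (cases "j = 1")
  case True
  let ?R = "\<lambda>x. Phi r x *v (Yx 0 - r *\<^sub>R Yp 4 0)"
  have "((\<lambda>x. (1 / r) *\<^sub>R (?R x - Yx x)) has_vector_derivative (1 / r) *\<^sub>R (M r x *v ?R x - M 0 x *v Yx x)) (at x)"
    by (intro bounded_linear.has_vector_derivative[OF bounded_linear_scaleR_right]
        has_vector_derivative_diff solD[OF sol_Phi] solD[OF Yx])
  moreover have "(1 / r) *\<^sub>R (M r x *v ?R x - M 0 x *v Yx x) = M r x *v ((1 / r) *\<^sub>R (?R x - Yx x)) + N x *v Yx x"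
  proof -
    have "M r x *v Yx x = M 0 x *v Yx x + r *\<^sub>R (N x *v Yx x)"
      unfolding M_eq[of r x 0] by (simp add: matrix_vector_mult_add_rdistrib scaleR_matrix_vector_assoc)
    then show ?thesis
      using assms by (simp add: matrix_vector_mult_scaleR matrix_vector_mult_diff_distrib scaleR_diff_right scaleR_add_right)
  qed
  ultimately show ?thesis
    by (simp add: True col_def[abs_def] col1_def)
next
  case False
  then show ?thesis
    using solD[OF sol_Phi[of r "Yp (nx j) 0"], of x] by (simp add: col_def[abs_def])
qed

lemma col0_deriv:
  "(col0 j has_vector_derivative M 0 x *v col0 j x + (if j = 1 then 1 else 0) *\<^sub>R (N x *v Yx x)) (at x)"
proof (cases "j = 1")
  case True
  have "((\<lambda>x. - Yp 4 x) has_vector_derivative - (M 0 x *v Yp 4 x - N x *v Yx x)) (at x)"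
    using has_vector_derivative_minus[OF Yp[of 4 x]] by simp
  moreover have "M 0 x *v (- Yp 4 x) = - (M 0 x *v Yp 4 x)"
    using matrix_vector_mult_diff_distrib[of "M 0 x" 0 "Yp 4 x"] by simp
  ultimately show ?thesis by (simp add: True col0_def[abs_def])
next
  case False
  moreover have "nx j \<noteq> 4" by (simp add: nx_def)
  ultimately show ?thesis
    using Yp[of "nx j" x] by (simp add: col0_def[abs_def])
qed

lemma continuous_col0: "continuous_on {0..X} (col0 j)"
  by (intro continuous_at_imp_continuous_on ballI has_vector_derivative_continuous[OF col0_deriv])

lemma col_initial: "r \<noteq> 0 \<Longrightarrow> col j r 0 = col0 j 0"
  by (simp add: col_def col1_def col0_def Phi_0)

text \<open>The initial values agree exactly and the forcing terms cancel, so the difference solves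
  the system for \<open>r\<close> with forcing \<open>r\<close> times \<open>N *v col0\<close>;
  \<open>perturbation_bound\<close> at 0 applies.\<close>

lemma col_approx:
  obtains K where "\<And>r x. r \<noteq> 0 \<Longrightarrow> \<bar>r\<bar> \<le> 1 \<Longrightarrow> x \<in> {0..X} \<Longrightarrow> norm (col j r x - col0 j x) \<le> K * \<bar>r\<bar>"
proof -
  obtain C1 where C1: "C1 \<ge> 0" "\<And>x y. x \<in> {0..X} \<Longrightarrow> norm (N x *v y) \<le> C1 * norm y"
    by (rule norm_N_le) blast
  obtain B where B0: "B \<ge> 0" and B: "\<And>x. x \<in> {0..X} \<Longrightarrow> norm (col0 j x) \<le> B"
    by (rule continuous_on_compact_bound[OF compact_Icc continuous_col0]) (rule that)
  obtain K where K: "\<And>r Z f x. \<bar>r - 0\<bar> \<le> 1 \<Longrightarrow>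
    (\<And>x. (Z has_vector_derivative M r x *v Z x + f x) (at x)) \<Longrightarrow> Z 0 = 0 \<Longrightarrow>
    (\<And>x. x \<in> {0..X} \<Longrightarrow> norm (f x) \<le> (C1 * B) * \<bar>r - 0\<bar>) \<Longrightarrow> x \<in> {0..X} \<Longrightarrow>
    norm (Z x) \<le> K * \<bar>r - 0\<bar>"
    by (rule perturbation_bound[of "C1 * B" 0]) (use C1 B0 in auto)
  show thesis
  proof (rule that[of K])
    fix r x :: real assume r: "r \<noteq> 0" "\<bar>r\<bar> \<le> 1" and x: "x \<in> {0..X}"
    have "norm (col j r x - col0 j x) \<le> K * \<bar>r - 0\<bar>"
    proof (rule K[of r "\<lambda>x. col j r x - col0 j x" "\<lambda>x. r *\<^sub>R (N x *v col0 j x)"])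
      fix x
      have "M r x *v (col j r x - col0 j x) + r *\<^sub>R (N x *v col0 j x) = M r x *v col j r x - M 0 x *v col0 j x"
      proof -
        have "M r x *v col0 j x = M 0 x *v col0 j x + r *\<^sub>R (N x *v col0 j x)"
          unfolding M_eq[of r x 0] by (simp add: matrix_vector_mult_add_rdistrib scaleR_matrix_vector_assoc)
        then show ?thesis by (simp add: matrix_vector_mult_diff_distrib)
      qed
      then show "((\<lambda>x. col j r x - col0 j x) has_vector_derivative
          M r x *v (col j r x - col0 j x) + r *\<^sub>R (N x *v col0 j x)) (at x)"
        using has_vector_derivative_diff[OF col_deriv[OF r(1), of j x] col0_deriv[of j x]] by simp
    next
      fix x assume x: "x \<in> {0..X}"
      have "norm (N x *v col0 j x) \<le> C1 * B"
        by (rule order_trans[OF C1(2)[OF x] mult_left_mono[OF B[OF x] C1(1)]])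
      then show "norm (r *\<^sub>R (N x *v col0 j x)) \<le> C1 * B * \<bar>r - 0\<bar>"
        by (simp add: mult.commute[of "\<bar>r\<bar>"] mult_right_mono)
    qed (use r x col_initial in auto)
    then show "norm (col j r x - col0 j x) \<le> K * \<bar>r\<bar>" by simp
  qed
qed

text \<open>A common form of rows two, three and four, for which the limit is computed only
  once.\<close>

definition wrow :: "(real \<Rightarrow> real) \<Rightarrow> (real \<Rightarrow> real) \<Rightarrow> (real \<Rightarrow> real ^ 4) \<Rightarrow> real" where
  "wrow \<alpha> \<beta> T = integral {0..X} (\<lambda>x. \<alpha> x * (N x *v T x) $ 3 + \<beta> x * (N x *v T x) $ 4)"

lemma row_wrow: "row2 = wrow v u" "row3 = wrow (\<lambda>_. 1) (\<lambda>_. 0)" "row4 = wrow (\<lambda>_. 0) (\<lambda>_. 1)"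
  by (simp_all add: fun_eq_iff wrow_def row2_def row3_def row4_def)

lemma col_limit:
  assumes "x \<in> {0..X}"
  shows "((\<lambda>r. col j r x $ i) \<longlongrightarrow> col0 j x $ i) (at 0)"
proof -
  obtain K where K: "\<And>r x. r \<noteq> 0 \<Longrightarrow> \<bar>r\<bar> \<le> 1 \<Longrightarrow> x \<in> {0..X} \<Longrightarrow> norm (col j r x - col0 j x) \<le> K * \<bar>r\<bar>"
    using col_approx[of j] by blast
  show ?thesis
  proof (rule tendsto_of_linear_bound)
    show "\<bar>col j r x $ i - col0 j x $ i\<bar> \<le> K * \<bar>r\<bar>" if "r \<noteq> 0" "\<bar>r\<bar> \<le> 1" for r
      using order_trans[OF component_le_norm_cart K[OF that assms]] by simp
  qed
qed

lemma wrow_limit: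
  assumes \<alpha>: "continuous_on {0..X} \<alpha>" and \<beta>: "continuous_on {0..X} \<beta>"
  shows "((\<lambda>r. wrow \<alpha> \<beta> (col j r)) \<longlongrightarrow> wrow \<alpha> \<beta> (col0 j)) (at 0)"
proof -
  obtain K where K: "\<And>r x. r \<noteq> 0 \<Longrightarrow> \<bar>r\<bar> \<le> 1 \<Longrightarrow> x \<in> {0..X} \<Longrightarrow> norm (col j r x - col0 j x) \<le> K * \<bar>r\<bar>"
    using col_approx[of j] by blast
  obtain C1 where C1: "C1 \<ge> 0" "\<And>x y. x \<in> {0..X} \<Longrightarrow> norm (N x *v y) \<le> C1 * norm y"
    by (rule norm_N_le) blast
  obtain A where A0: "A \<ge> 0" and A: "\<And>x. x \<in> {0..X} \<Longrightarrow> \<bar>\<alpha> x\<bar> \<le> A"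
    by (rule continuous_on_compact_bound[OF compact_Icc \<alpha>, unfolded real_norm_def]) (rule that)
  obtain B where B0: "B \<ge> 0" and B: "\<And>x. x \<in> {0..X} \<Longrightarrow> \<bar>\<beta> x\<bar> \<le> B"
    by (rule continuous_on_compact_bound[OF compact_Icc \<beta>, unfolded real_norm_def]) (rule that)
  show ?thesis
  proof (rule tendsto_of_linear_bound)
    fix r :: real assume r: "r \<noteq> 0" "\<bar>r\<bar> \<le> 1"
    let ?f = "\<lambda>T x. \<alpha> x * (N x *v T x) $ 3 + \<beta> x * (N x *v T x) $ 4"
    have cT: "continuous_on {0..X} (col j r)"
      by (intro continuous_at_imp_continuous_on ballI has_vector_derivative_continuous[OF col_deriv[OF r(1)]])
    have cont: "continuous_on {0..X} (?f T)" if "continuous_on {0..X} T" for T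
      by (intro continuous_on_add continuous_on_mult \<alpha> \<beta> continuous_N_mult that)
    have int: "?f T integrable_on {0..X}" if "continuous_on {0..X} T" for T
      by (rule integrable_continuous_real[OF cont[OF that]])
    have eq: "wrow \<alpha> \<beta> (col j r) - wrow \<alpha> \<beta> (col0 j) = integral {0..X} (\<lambda>x. ?f (col j r) x - ?f (col0 j) x)"
      unfolding wrow_def by (rule Henstock_Kurzweil_Integration.integral_diff[symmetric]) (intro int cT continuous_col0)+
    have "norm (integral {0..X} (\<lambda>x. ?f (col j r) x - ?f (col0 j) x)) \<le> (A + B) * (C1 * (K * \<bar>r\<bar>)) * (X - 0)"
    proof (rule integral_bound)
      show "continuous_on {0..X} (\<lambda>x. ?f (col j r) x - ?f (col0 j) x)"
        by (rule continuous_on_diff[OF cont[OF cT] cont[OF continuous_col0]])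
      fix x assume x: "x \<in> {0..X}"
      let ?d = "N x *v (col j r x - col0 j x)"
      have nd: "\<bar>?d $ i\<bar> \<le> C1 * (K * \<bar>r\<bar>)" for i
        by (rule order_trans[OF component_le_norm_cart order_trans[OF C1(2)[OF x] mult_left_mono[OF K[OF r x] C1(1)]]])
      have eqd: "?f (col j r) x - ?f (col0 j) x = \<alpha> x * ?d $ 3 + \<beta> x * ?d $ 4"
        by (simp add: matrix_vector_mult_diff_distrib) (simp add: algebra_simps)
      have "\<bar>\<alpha> x * ?d $ 3 + \<beta> x * ?d $ 4\<bar> \<le> \<bar>\<alpha> x\<bar> * \<bar>?d $ 3\<bar> + \<bar>\<beta> x\<bar> * \<bar>?d $ 4\<bar>"
        using abs_triangle_ineq[of "\<alpha> x * ?d $ 3" "\<beta> x * ?d $ 4"] by (simp add: abs_mult)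
      also have "\<dots> \<le> A * (C1 * (K * \<bar>r\<bar>)) + B * (C1 * (K * \<bar>r\<bar>))"
        by (rule add_mono[OF mult_mono[OF A[OF x] nd A0 abs_ge_zero] mult_mono[OF B[OF x] nd B0 abs_ge_zero]])
      finally show "norm (?f (col j r) x - ?f (col0 j) x) \<le> (A + B) * (C1 * (K * \<bar>r\<bar>))"
        unfolding eqd real_norm_def distrib_right .
    qed (use X_pos in simp)
    then show "\<bar>wrow \<alpha> \<beta> (col j r) - wrow \<alpha> \<beta> (col0 j)\<bar> \<le> ((A + B) * (C1 * K) * X) * \<bar>r\<bar>"
      unfolding eq by (simp add: mult_ac)
  qed
qed

definition jump_matrix :: "(4 \<Rightarrow> real \<Rightarrow> real ^ 4) \<Rightarrow> real ^ 4 ^ 4" where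
  "jump_matrix T = (\<chi> i j. if i = 1 then row1 (T j) else if i = 2 then row2 (T j) else if i = 3 then row3 (T j) else row4 (T j))"

lemma jump_matrix_limit: "((\<lambda>r. jump_matrix (\<lambda>j. col j r) $ i $ j) \<longlongrightarrow> jump_matrix col0 $ i $ j) (at 0)"
proof -
  have "((\<lambda>r. row1 (col j r)) \<longlongrightarrow> row1 (col0 j)) (at 0)"
    unfolding row1_def
    by (intro tendsto_add tendsto_mult tendsto_diff tendsto_const col_limit) (use X_pos in auto)
  moreover have "((\<lambda>r. row2 (col j r)) \<longlongrightarrow> row2 (col0 j)) (at 0)"
    "((\<lambda>r. row3 (col j r)) \<longlongrightarrow> row3 (col0 j)) (at 0)" "((\<lambda>r. row4 (col j r)) \<longlongrightarrow> row4 (col0 j)) (at 0)"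
    unfolding row_wrow by (intro wrow_limit continuous_vu continuous_on_const)+
  ultimately show ?thesis by (simp add: jump_matrix_def)
qed

text \<open>The initial values of the four solutions whose jumps are computed. The first column is
  undivided, in contrast to \<open>col\<close>.\<close>

definition init_matrix :: "real \<Rightarrow> real ^ 4 ^ 4" where
  "init_matrix r = (\<chi> i j. if j = 1 then Yx 0 $ i - r * Yp 4 0 $ i else Yp (nx j) 0 $ i)"

definition nn :: real where "nn = (Yx 0 $ 1)\<^sup>2 + (Yx 0 $ 2)\<^sup>2"

lemma nn_pos: "nn > 0"
proof -
  have "Yx 0 $ 1 \<noteq> 0 \<or> Yx 0 $ 2 \<noteq> 0" using wronskian by auto
  then show ?thesis unfolding nn_def by (auto simp: add_pos_nonneg add_nonneg_pos)
qed

text \<open>At \<open>r = 0\<close> the matrix is block triangular: \<open>Yp34\<close> makes the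
  lower right block the identity, and the upper left block has the Wronskian as determinant. Hence
  the four solutions form a basis for small \<open>r\<close>.\<close>

lemma det_init_matrix_limit: "((\<lambda>r. det (init_matrix r)) \<longlongrightarrow> 1) (at 0)"
proof -
  have "((\<lambda>r. init_matrix r $ i $ j) \<longlongrightarrow> init_matrix 0 $ i $ j) (at 0)" for i j
  proof -
    have "((\<lambda>r. Yx 0 $ i - r * Yp 4 0 $ i) \<longlongrightarrow> Yx 0 $ i - 0 * Yp 4 0 $ i) (at 0)"
      by (intro tendsto_diff tendsto_mult tendsto_const tendsto_ident_at)
    then show ?thesis by (simp add: init_matrix_def)
  qed
  then have "((\<lambda>r. det (init_matrix r)) \<longlongrightarrow> det (init_matrix 0)) (at 0)"
    by (rule tendsto_det_4)
  moreover have "det (init_matrix 0) = 1"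
    using wronskian Yp34[of 1] Yp34[of 2] Yp34[of 3]
    by (simp add: det_4 init_matrix_def nx_def Yx34 mult.commute)
  ultimately show ?thesis by simp
qed

text \<open>\<open>Dl\<close> holds the jumps of \<open>col\<close>. \<open>E\<close> restores the
  factor \<open>r\<close> divided out of the first column, \<open>T\<close> combines the rows into
  the projection, the flux and the two jumps of \<open>g\<close>, and \<open>D\<close> records the
  factor \<open>r\<close> of the last three. The determinants are \<open>r\<close>,
  \<open>nn\<close> and \<open>r^3\<close>.\<close>

lemma Dt_factorization:
  assumes r: "r \<noteq> 0"
  shows "nn * (Dt r X * det (init_matrix r)) = r ^ 4 * det (jump_matrix (\<lambda>j. col j r))"
proof -
  define Dl :: "real ^ 4 ^ 4" where "Dl = (\<chi> i j. col j r X $ i - col j r 0 $ i)"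
  define E :: "real ^ 4 ^ 4" where "E = vector [vector [r, 0, 0, 0], vector [0, 1, 0, 0], vector [0, 0, 1, 0], vector [0, 0, 0, 1]]"
  define D :: "real ^ 4 ^ 4" where "D = vector [vector [1, 0, 0, 0], vector [0, r, 0, 0], vector [0, 0, r, 0], vector [0, 0, 0, r]]"
  define T :: "real ^ 4 ^ 4" where "T = vector [vector [Yx 0 $ 1, Yx 0 $ 2, 0, 0],
    vector [- Yx 0 $ 2, Yx 0 $ 1, v 0, u 0], vector [0, 0, 1, 0], vector [0, 0, 0, 1]]"
  have eq1: "(Phi r X - mat 1) ** init_matrix r = Dl ** E"
  proof -
    have lhs: "((Phi r X - mat 1) ** init_matrix r) $ i $ j = (Phi r X *v column j (init_matrix r) - column j (init_matrix r)) $ i" for i j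
    proof -
      have "((Phi r X - mat 1) ** init_matrix r) $ i $ j = ((Phi r X - mat 1) *v column j (init_matrix r)) $ i"
        by (simp add: matrix_matrix_mult_def matrix_vector_mult_def column_def)
      then show ?thesis by (simp add: matrix_vector_mult_diff_rdistrib)
    qed
    define y where "y = Yx 0 - r *\<^sub>R Yp 4 0"
    have "column 1 (init_matrix r) = y"
      by (simp add: vec_eq_iff column_def init_matrix_def y_def)
    then have "((Phi r X - mat 1) ** init_matrix r) $ i $ 1 = r * Dl $ i $ 1" for i
      unfolding lhs Dl_def col_def col1_def y_def[symmetric] using r per(3)
      by (simp add: Phi_0 diff_divide_distrib[symmetric])
    moreover have "column j (init_matrix r) = Yp (nx j) 0" if "j \<noteq> 1" for j
      using that by (simp add: vec_eq_iff column_def init_matrix_def)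
    ultimately have "((Phi r X - mat 1) ** init_matrix r) $ i $ j = (if j = 1 then r else 1) * Dl $ i $ j" for i j
      by (cases "j = 1") (auto simp: lhs Dl_def col_def Phi_0)
    moreover have "(Dl ** E) $ i $ j = (if j = 1 then r else 1) * Dl $ i $ j" for i j
      using exhaust_4[of j] by (auto simp: matrix_matrix_mult_def sum_4 E_def)
    ultimately show ?thesis by (simp add: vec_eq_iff)
  qed
  have eq2: "T ** Dl = D ** jump_matrix (\<lambda>j. col j r)"
  proof -
    have "(T ** Dl) $ i $ j = (D ** jump_matrix (\<lambda>j. col j r)) $ i $ j" for i j
    proof -
      note J = jump_identities[OF col_deriv[OF r, of j]]
      have "(T ** Dl) $ 1 $ j = row1 (col j r)" "(T ** Dl) $ 2 $ j = r * row2 (col j r)"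
        "(T ** Dl) $ 3 $ j = r * row3 (col j r)" "(T ** Dl) $ 4 $ j = r * row4 (col j r)"
        unfolding J[symmetric] by (simp_all add: matrix_matrix_mult_def sum_4 T_def Dl_def row1_def)
      moreover have "(D ** jump_matrix (\<lambda>j. col j r)) $ 1 $ j = row1 (col j r)" "(D ** jump_matrix (\<lambda>j. col j r)) $ 2 $ j = r * row2 (col j r)"
        "(D ** jump_matrix (\<lambda>j. col j r)) $ 3 $ j = r * row3 (col j r)" "(D ** jump_matrix (\<lambda>j. col j r)) $ 4 $ j = r * row4 (col j r)"
        by (simp_all add: matrix_matrix_mult_def sum_4 D_def jump_matrix_def)
      ultimately show ?thesis
        using exhaust_4[of i] by (elim disjE) (simp_all only:)
    qed
    then show ?thesis by (simp add: vec_eq_iff)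
  qed
  have dets: "det E = r" "det D = r ^ 3" "det T = nn"
    by (simp_all add: det_4 E_def D_def T_def nn_def power3_eq_cube power2_eq_square)
  have "nn * (Dt r X * det (init_matrix r)) = det T * (det Dl * det E)"
    unfolding Dt_def det_mul[symmetric] dets(3)[symmetric] eq1 by (simp add: det_mul)
  also have "\<dots> = det (T ** Dl) * r"
    by (simp add: det_mul dets)
  also have "\<dots> = r ^ 4 * det (jump_matrix (\<lambda>j. col j r))"
    unfolding eq2 det_mul dets by (simp add: power3_eq_cube power4_eq_xxxx)
  finally show ?thesis .
qed

lemma Dt_limit: "((\<lambda>r. Dt r X / r ^ 4) \<longlongrightarrow> det (jump_matrix col0) / nn) (at 0)"
proof -
  have "((\<lambda>r. det (jump_matrix (\<lambda>j. col j r)) / (nn * det (init_matrix r))) \<longlongrightarrow> det (jump_matrix col0) / (nn * 1)) (at 0)"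
    by (intro tendsto_divide tendsto_mult tendsto_const det_init_matrix_limit tendsto_det_4 jump_matrix_limit) (use nn_pos in simp)
  moreover have "\<forall>\<^sub>F r in at 0. det (init_matrix r) > 0"
    using order_tendstoD(1)[OF det_init_matrix_limit, of 0] by simp
  then have "\<forall>\<^sub>F r in at 0. det (jump_matrix (\<lambda>j. col j r)) / (nn * det (init_matrix r)) = Dt r X / r ^ 4"
    using eventually_neq_at_within[of 0 0 UNIV]
  proof eventually_elim
    case (elim r)
    then show ?case
      using Dt_factorization[of r] nn_pos by (simp add: frac_eq_eq mult_ac)
  qed
  ultimately show ?thesis
    using tendsto_cong by fastforce
qed

lemma wrow_uminus: "wrow \<alpha> \<beta> (\<lambda>x. - T x) = - wrow \<alpha> \<beta> T"
proof -
  have "N x *v (- T x) = - (N x *v T x)" for x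
    using matrix_vector_mult_diff_distrib[of "N x" 0 "T x"] by simp
  then have "(\<lambda>x. \<alpha> x * (N x *v - T x) $ 3 + \<beta> x * (N x *v - T x) $ 4)
    = (\<lambda>x. - (\<alpha> x * (N x *v T x) $ 3 + \<beta> x * (N x *v T x) $ 4))"
    by auto
  then show ?thesis unfolding wrow_def by (simp only: Henstock_Kurzweil_Integration.integral_neg)
qed

text \<open>Row operations turn \<^term>\<open>jump_matrix col0\<close> into the matrix of parameter derivatives of
  \<open>(\<Xi>, - \<integral>v, - \<integral>u, \<integral>Q)\<close>, that is, of the gradient of the action.\<close>

theorem Dt_limit_hessian:
  fixes s1 s2 :: "4 \<Rightarrow> real"
  assumes s: "\<And>j. row3 (Yp j) = a * s1 j + b * s2 j" "\<And>j. row4 (Yp j) = b * s1 j"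
  shows "((\<lambda>r. Dt r X / r ^ 4) \<longlongrightarrow> b\<^sup>2 * det ((\<chi> i j. if i = 1 then Xp j
    else if i = 2 then - (s1 j + Xp j * v 0) else if i = 3 then - (s2 j + Xp j * u 0)
    else row2 (Yp j) + Xp j * q0) :: real ^ 4 ^ 4)) (at 0)" (is "(_ \<longlongrightarrow> _ * det ?J) _")
proof -
  define J where "J = ?J"
  \<comment> \<open>The first column removes the endpoint terms \<open>Xp j * v 0\<close>,
    \<open>Xp j * u 0\<close> and \<open>Xp j * q0\<close>, which come from the moving end of the
    integrals. The block for the mean values of \<open>v\<close> and \<open>u\<close> is
    \<open>- B^-1\<close>, the source of the factor \<open>b^2\<close>.\<close>
  define P :: "real ^ 4 ^ 4" where "P = vector [vector [- nn, 0, 0, 0], vector [- q0, 0, 0, 1],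
    vector [- (a * v 0 + b * u 0), - a, - b, 0], vector [- b * v 0, - b, 0, 0]]"
  \<comment> \<open>Moves the column of \<open>c\<close> to the front and changes its sign. A cyclic
    shift of four columns is odd, so the determinant is 1.\<close>
  define C :: "real ^ 4 ^ 4" where "C = vector [vector [0, 1, 0, 0], vector [0, 0, 1, 0],
    vector [0, 0, 0, 1], vector [- 1, 0, 0, 0]]"
  define S :: "real ^ 4 ^ 4" where "S = (\<chi> i j. if i = 1 then row1 (Yp j) else if i = 2 then row2 (Yp j)
    else if i = 3 then row3 (Yp j) else row4 (Yp j))"
  have row1: "row1 (Yp j) = - nn * Xp j" for j
    unfolding row1_def jump nn_def by (simp add: algebra_simps power2_eq_square)
  have "S = P ** J"
  proof -
    have "S $ i $ j = (P ** J) $ i $ j" for i j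
      using exhaust_4[of i] by (auto simp: matrix_matrix_mult_def sum_4 S_def P_def J_def row1 s algebra_simps)
    then show ?thesis by (simp add: vec_eq_iff)
  qed
  moreover have "jump_matrix col0 = S ** C"
  proof -
    have neg: "row1 (\<lambda>x. - Yp 4 x) = - row1 (Yp 4)" "row2 (\<lambda>x. - Yp 4 x) = - row2 (Yp 4)"
      "row3 (\<lambda>x. - Yp 4 x) = - row3 (Yp 4)" "row4 (\<lambda>x. - Yp 4 x) = - row4 (Yp 4)"
      unfolding row_wrow wrow_uminus by (simp_all add: row1_def algebra_simps)
    have "col0 1 = (\<lambda>x. - Yp 4 x)" "col0 2 = Yp 1" "col0 3 = Yp 2" "col0 4 = Yp 3"
      by (auto simp: col0_def nx_def)
    then have "jump_matrix col0 $ i $ j = (S ** C) $ i $ j" for i j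
      using exhaust_4[of j] exhaust_4[of i] neg
      by (auto simp: matrix_matrix_mult_def sum_4 S_def C_def jump_matrix_def)
    then show ?thesis by (simp add: vec_eq_iff)
  qed
  moreover have "det P = nn * b\<^sup>2" "det C = 1"
    by (simp_all add: det_4 P_def C_def power2_eq_square)
  ultimately have "det (jump_matrix col0) / nn = b\<^sup>2 * det J"
    using nn_pos by (simp add: det_mul)
  then show ?thesis using Dt_limit by (simp add: J_def)
qed

end

section \<open>Smooth functions on open sets\<close>

text \<open>\<open>pd\<close> is a derivative along a line; \<open>dd\<close> is the Frechet
  derivative in the same direction, which is linear in \<open>h\<close> and fits the recursion in
  \<open>Ck_on\<close>. The two agree at points of differentiability.\<close>

definition dd :: "'a::real_normed_vector \<Rightarrow> ('a \<Rightarrow> 'b::real_normed_vector) \<Rightarrow> 'a \<Rightarrow> 'b" where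
  "dd h f x = frechet_derivative f (at x) h"

lemma dd_eqI: "(f has_derivative f') (at x) \<Longrightarrow> dd h f x = f' h"
  unfolding dd_def using frechet_derivative_at by metis

lemma dd_works: "f differentiable (at x) \<Longrightarrow> (f has_derivative (\<lambda>h. dd h f x)) (at x)"
  unfolding dd_def using frechet_derivative_works by blast

lemma dd_add_dir: "f differentiable (at x) \<Longrightarrow> dd (h + k) f x = dd h f x + dd k f x"
  using linear_add[OF has_derivative_linear[OF dd_works]] by blast

lemma dd_scaleR_dir: "f differentiable (at x) \<Longrightarrow> dd (c *\<^sub>R h) f x = c *\<^sub>R dd h f x"
  using linear_scale[OF has_derivative_linear[OF dd_works]] by blast

lemma dd_pair:
  fixes f :: "'a::real_normed_vector \<times> real \<Rightarrow> real"
  assumes "f differentiable (at z)"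
  shows "dd (h, c) f z = dd (h, 0) f z + c * dd (0, 1) f z"
  using dd_add_dir[OF assms, of "(h, 0)" "c *\<^sub>R (0, 1)"] dd_scaleR_dir[OF assms, of c "(0, 1)"] by simp

lemma dd_cong:
  assumes "f differentiable (at x)" "open S" "x \<in> S" "\<And>y. y \<in> S \<Longrightarrow> f y = g y"
  shows "dd h f x = dd h g x"
  unfolding dd_def using frechet_derivative_transform_within_open[OF assms] by simp

lemma dd_path:
  assumes "f differentiable (at (\<gamma> s))" "(\<gamma> has_vector_derivative \<gamma>') (at s)"
  shows "((\<lambda>s. f (\<gamma> s)) has_vector_derivative dd \<gamma>' f (\<gamma> s)) (at s)"
  using vector_derivative_diff_chain_within[OF assms(2), of f "\<lambda>h. dd h f (\<gamma> s)"]
    dd_works[OF assms(1)] has_derivative_at_withinI by (fastforce simp: o_def)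

lemma line_deriv: "((\<lambda>s. x + s *\<^sub>R h) has_vector_derivative h) (at s)"
  by (auto intro!: derivative_eq_intros)

lemma dd_line:
  fixes f :: "_ \<Rightarrow> real"
  assumes "f differentiable (at (x + s *\<^sub>R h))"
  shows "((\<lambda>s. f (x + s *\<^sub>R h)) has_real_derivative dd h f (x + s *\<^sub>R h)) (at s)"
  using dd_path[of f "\<lambda>s. x + s *\<^sub>R h", OF assms line_deriv]
  by (simp add: has_real_derivative_iff_has_vector_derivative)

lemma pd_eq_dd: "f differentiable (at x) \<Longrightarrow> pd h f x = dd h f x"
  using dd_line[of f x 0 h] unfolding pd_def by (simp add: DERIV_imp_deriv)

lemma Ck_on_Suc: "Ck_on (Suc k) S f \<longleftrightarrow> (\<forall>x\<in>S. f differentiable (at x)) \<and> (\<forall>h. Ck_on k S (dd h f))"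
  by (simp add: dd_def[abs_def])

declare Ck_on.simps(2) [simp del]

lemma Ck_on_mono: "Ck_on (Suc k) S f \<Longrightarrow> Ck_on k S f"
proof (induction k arbitrary: f)
  case 0
  then show ?case
    by (auto simp: Ck_on_Suc intro!: continuous_at_imp_continuous_on differentiable_imp_continuous_within)
next
  case (Suc k)
  then show ?case using Ck_on_Suc[of "Suc k" S f] Ck_on_Suc[of k S f] by blast
qed

lemma Ck_on_cong:
  assumes S: "open S" and "\<And>x. x \<in> S \<Longrightarrow> f x = g x" "Ck_on k S f"
  shows "Ck_on k S g"
  using assms(2,3)
proof (induction k arbitrary: f g)
  case 0
  then show ?case by (auto cong: continuous_on_cong)
next
  case (Suc k)
  have f: "\<And>x. x \<in> S \<Longrightarrow> f differentiable (at x)" "\<And>h. Ck_on k S (dd h f)"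
    using Suc.prems(2) by (auto simp: Ck_on_Suc)
  have "g differentiable (at x)" if "x \<in> S" for x
    using has_derivative_transform_within_open[OF dd_works[OF f(1)[OF that]] S that Suc.prems(1)]
    by (auto simp: differentiable_def)
  moreover have "Ck_on k S (dd h g)" for h
    by (rule Suc.IH[OF _ f(2)[of h]]) (rule dd_cong[OF f(1) S _ Suc.prems(1)])
  ultimately show ?case by (simp add: Ck_on_Suc)
qed

lemma smooth_on_imp_differentiable: "smooth_on S f \<Longrightarrow> x \<in> S \<Longrightarrow> f differentiable (at x)"
  unfolding smooth_on_def using Ck_on_Suc by blast

lemma smooth_on_dd: "smooth_on S f \<Longrightarrow> smooth_on S (dd h f)"
  unfolding smooth_on_def using Ck_on_Suc by blast

lemma smooth_on_imp_continuous: "smooth_on S f \<Longrightarrow> continuous_on S f"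
  unfolding smooth_on_def using Ck_on.simps(1) by blast

lemma Ck_on_const:
  fixes S :: "'a::real_normed_vector set"
  shows "Ck_on k S (\<lambda>x. c)"
proof (induction k arbitrary: c)
  case (Suc k)
  have "dd h (\<lambda>x. c) = (\<lambda>x. 0)" for h :: 'a
    by (rule ext) (rule dd_eqI[where f' = "\<lambda>_. 0", OF has_derivative_const])
  with Suc[of 0] show ?case by (simp add: Ck_on_Suc)
qed simp

lemma Ck_on_add:
  assumes S: "open S" and "Ck_on k S f" "Ck_on k S g"
  shows "Ck_on k S (\<lambda>x. f x + g x)"
  using assms(2,3)
proof (induction k arbitrary: f g)
  case 0
  then show ?case by (auto intro: continuous_intros)
next
  case (Suc k)
  have D: "((\<lambda>x. f x + g x) has_derivative (\<lambda>h. dd h f x + dd h g x)) (at x)" if "x \<in> S" for x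
    using Suc.prems that by (intro has_derivative_add dd_works) (auto simp: Ck_on_Suc)
  have "Ck_on k S (dd h (\<lambda>x. f x + g x))" for h
    by (rule Ck_on_cong[OF S _ Suc.IH[of "dd h f" "dd h g"]])
       (use Suc.prems dd_eqI[OF D] in \<open>auto simp: Ck_on_Suc\<close>)
  then show ?case using D by (auto simp: Ck_on_Suc differentiable_def)
qed

lemma Ck_on_mult:
  fixes f g :: "'a::real_normed_vector \<Rightarrow> real"
  assumes S: "open S" and "Ck_on k S f" "Ck_on k S g"
  shows "Ck_on k S (\<lambda>x. f x * g x)"
  using assms(2,3)
proof (induction k arbitrary: f g)
  case 0
  then show ?case by (auto intro: continuous_intros)
next
  case (Suc k)
  have D: "((\<lambda>x. f x * g x) has_derivative (\<lambda>h. f x * dd h g x + dd h f x * g x)) (at x)" if "x \<in> S" for x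
    using Suc.prems that by (intro has_derivative_mult dd_works) (auto simp: Ck_on_Suc)
  have "Ck_on k S (\<lambda>x. f x * dd h g x + dd h f x * g x)" for h
    by (intro Ck_on_add[OF S] Suc.IH Ck_on_mono[OF Suc.prems(1)] Ck_on_mono[OF Suc.prems(2)])
       (use Suc.prems in \<open>auto simp: Ck_on_Suc\<close>)
  then have "Ck_on k S (dd h (\<lambda>x. f x * g x))" for h
    by (rule Ck_on_cong[OF S, rotated]) (simp add: dd_eqI[OF D])
  then show ?case using D by (auto simp: Ck_on_Suc differentiable_def)
qed

lemma Ck_on_linear:
  assumes "bounded_linear f"
  shows "Ck_on k S f"
proof (cases k)
  case 0
  then show ?thesis by (simp add: linear_continuous_on[OF assms])
next
  case (Suc n)
  have D: "(f has_derivative f) (at x)" for x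
    by (rule bounded_linear_imp_has_derivative[OF assms])
  have "dd h f = (\<lambda>x. f h)" for h
    by (rule ext) (rule dd_eqI[OF D])
  then show ?thesis using D by (auto simp: Suc Ck_on_Suc differentiable_def Ck_on_const)
qed

lemma has_derivative_compose2:
  fixes f :: "real \<times> real \<Rightarrow> real"
  assumes f: "f differentiable (at (g1 x, g2 x))" and g: "g1 differentiable (at x)" "g2 differentiable (at x)"
  shows "((\<lambda>x. f (g1 x, g2 x)) has_derivative
    (\<lambda>h. dd (1, 0) f (g1 x, g2 x) * dd h g1 x + dd (0, 1) f (g1 x, g2 x) * dd h g2 x)) (at x)"
proof -
  have "((\<lambda>x. (g1 x, g2 x)) has_derivative (\<lambda>h. (dd h g1 x, dd h g2 x))) (at x)"
    by (intro has_derivative_Pair dd_works g)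
  then have D: "((\<lambda>x. f (g1 x, g2 x)) has_derivative (\<lambda>h. dd (dd h g1 x, dd h g2 x) f (g1 x, g2 x))) (at x)"
    using has_derivative_compose[of "\<lambda>x. (g1 x, g2 x)" _ x UNIV f] dd_works[OF f] by blast
  have split: "dd (s, t) f (g1 x, g2 x) = dd (1, 0) f (g1 x, g2 x) * s + dd (0, 1) f (g1 x, g2 x) * t" for s t
    using dd_add_dir[OF f, of "s *\<^sub>R (1, 0)" "t *\<^sub>R (0, 1)"] dd_scaleR_dir[OF f, of s "(1, 0)"]
      dd_scaleR_dir[OF f, of t "(0, 1)"] by (simp add: mult.commute)
  have fun_eq: "(\<lambda>h. dd (dd h g1 x, dd h g2 x) f (g1 x, g2 x)) =
      (\<lambda>h. dd (1, 0) f (g1 x, g2 x) * dd h g1 x + dd (0, 1) f (g1 x, g2 x) * dd h g2 x)"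
    by (rule ext) (rule split)
  show ?thesis using D unfolding fun_eq .
qed

text \<open>The derivative is a sum of products in which the partial derivatives of \<open>f\<close>
  are composed with the same inner functions; the induction therefore varies
  \<open>f\<close>.\<close>

lemma Ck_on_compose2:
  fixes f :: "real \<times> real \<Rightarrow> real"
  assumes S: "open S" and "Ck_on k UNIV f" "Ck_on k S g1" "Ck_on k S g2"
  shows "Ck_on k S (\<lambda>x. f (g1 x, g2 x))"
  using assms(2-4)
proof (induction k arbitrary: f g1 g2)
  case 0
  then show ?case
    by (auto intro!: continuous_on_compose2[of UNIV f] continuous_intros)
next
  case (Suc k)
  have D: "((\<lambda>x. f (g1 x, g2 x)) has_derivative
    (\<lambda>h. dd (1, 0) f (g1 x, g2 x) * dd h g1 x + dd (0, 1) f (g1 x, g2 x) * dd h g2 x)) (at x)" if "x \<in> S" for x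
    using Suc.prems that by (intro has_derivative_compose2) (auto simp: Ck_on_Suc)
  have "Ck_on k S (\<lambda>x. dd (1, 0) f (g1 x, g2 x) * dd h g1 x + dd (0, 1) f (g1 x, g2 x) * dd h g2 x)" for h
    by (intro Ck_on_add[OF S] Ck_on_mult[OF S] Suc.IH Ck_on_mono[OF Suc.prems(2)] Ck_on_mono[OF Suc.prems(3)])
       (use Suc.prems in \<open>auto simp: Ck_on_Suc\<close>)
  then have "Ck_on k S (dd h (\<lambda>x. f (g1 x, g2 x)))" for h
    by (rule Ck_on_cong[OF S, rotated]) (simp add: dd_eqI[OF D])
  then show ?case using D by (auto simp: Ck_on_Suc differentiable_def)
qed

lemma Ck_on_vec_nth:
  assumes S: "open S" and "Ck_on k S f"
  shows "Ck_on k S (\<lambda>x. f x $ i)"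
  using assms(2)
proof (induction k arbitrary: f)
  case 0
  then show ?case by (auto intro: continuous_intros)
next
  case (Suc k)
  have D: "((\<lambda>x. f x $ i) has_derivative (\<lambda>h. dd h f x $ i)) (at x)" if "x \<in> S" for x
    using Suc.prems that
    by (intro bounded_linear.has_derivative[OF bounded_linear_vec_nth] dd_works) (auto simp: Ck_on_Suc)
  have "Ck_on k S (\<lambda>x. dd h f x $ i)" for h
    by (intro Suc.IH) (use Suc.prems in \<open>auto simp: Ck_on_Suc\<close>)
  then have "Ck_on k S (dd h (\<lambda>x. f x $ i))" for h
    by (rule Ck_on_cong[OF S, rotated]) (simp add: dd_eqI[OF D])
  then show ?case using D by (auto simp: Ck_on_Suc differentiable_def)
qed

lemma smooth_on_const: "smooth_on S (\<lambda>x. c)"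
  and smooth_on_add: "open S \<Longrightarrow> smooth_on S f \<Longrightarrow> smooth_on S g \<Longrightarrow> smooth_on S (\<lambda>x. f x + g x)"
  and smooth_on_mult: "open S \<Longrightarrow> smooth_on S f' \<Longrightarrow> smooth_on S g' \<Longrightarrow> smooth_on S (\<lambda>x. f' x * g' x :: real)"
  and smooth_on_linear: "bounded_linear l \<Longrightarrow> smooth_on S l"
  and smooth_on_vec_nth: "open S \<Longrightarrow> smooth_on S v \<Longrightarrow> smooth_on S (\<lambda>x. v x $ i)"
  unfolding smooth_on_def
  by (auto intro: Ck_on_const Ck_on_add Ck_on_mult Ck_on_linear Ck_on_vec_nth)

lemma smooth_on_compose2:
  fixes f :: "real \<times> real \<Rightarrow> real"
  assumes "open S" "smooth_on UNIV f" "smooth_on S g1" "smooth_on S g2"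
  shows "smooth_on S (\<lambda>x. f (g1 x, g2 x))"
  unfolding smooth_on_def
  by (rule allI, rule Ck_on_compose2) (use assms in \<open>auto simp: smooth_on_def\<close>)

section \<open>Symmetry of second derivatives and integrals depending on parameters\<close>

lemma dd_linear: "bounded_linear f \<Longrightarrow> dd h f x = f h"
  by (rule dd_eqI[OF bounded_linear_imp_has_derivative])

lemma box_in_open:
  fixes x h k :: "'a::real_normed_vector"
  assumes "open S" "x \<in> S"
  obtains \<delta> where "\<delta> > 0" "\<And>s t. \<bar>s\<bar> \<le> \<delta> \<Longrightarrow> \<bar>t\<bar> \<le> \<delta> \<Longrightarrow> x + s *\<^sub>R h + t *\<^sub>R k \<in> S"
proof -
  obtain e where e: "e > 0" "ball x e \<subseteq> S" using assms openE by blast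
  define n where "n = norm h + norm k + 1"
  have n: "n > 0" by (simp add: n_def add_nonneg_pos)
  show thesis
  proof (rule that[of "e / (2 * n)"])
    show "e / (2 * n) > 0" using e n by simp
    fix s t :: real assume st: "\<bar>s\<bar> \<le> e / (2 * n)" "\<bar>t\<bar> \<le> e / (2 * n)"
    have "norm (s *\<^sub>R h + t *\<^sub>R k) \<le> \<bar>s\<bar> * norm h + \<bar>t\<bar> * norm k"
      by (rule order_trans[OF norm_triangle_ineq]) simp
    also have "\<dots> \<le> e / (2 * n) * norm h + e / (2 * n) * norm k"
      using st by (intro add_mono mult_right_mono) auto
    also have "\<dots> \<le> e / (2 * n) * n"
      unfolding distrib_left[symmetric] by (rule mult_left_mono) (use e n in \<open>auto simp: n_def\<close>)
    also have "\<dots> < e" using e n by simp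
    finally have "x + (s *\<^sub>R h + t *\<^sub>R k) \<in> ball x e"
      unfolding mem_ball by (subst dist_commute) (simp add: dist_norm)
    then show "x + s *\<^sub>R h + t *\<^sub>R k \<in> S" using e by (auto simp: add.assoc)
  qed
qed

lemma line_in_open:
  fixes x h :: "'a::real_normed_vector"
  assumes "open S" "x \<in> S"
  obtains \<delta> where "\<delta> > 0" "\<And>s. s \<in> {-\<delta>..\<delta>} \<Longrightarrow> x + s *\<^sub>R h \<in> S"
proof -
  obtain \<delta> where \<delta>: "\<delta> > 0" "\<And>s t. \<bar>s\<bar> \<le> \<delta> \<Longrightarrow> \<bar>t\<bar> \<le> \<delta> \<Longrightarrow> x + s *\<^sub>R h + t *\<^sub>R 0 \<in> S"
    by (rule box_in_open[OF assms]) (rule that)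
  then have "x + s *\<^sub>R h \<in> S" if "s \<in> {-\<delta>..\<delta>}" for s
  proof -
    have "\<bar>s\<bar> \<le> \<delta>" using that by (auto simp: abs_le_iff)
    from \<delta>(2)[OF this, of 0] show ?thesis using \<delta>(1) by simp
  qed
  with \<delta>(1) that show thesis by blast
qed

text \<open>The increment of \<open>f\<close> in the direction \<open>k\<close> is the integral of
  \<open>dd k f\<close>. Differentiating this identity in the direction \<open>h\<close> under the
  integral, and then in the upper limit at 0, gives the two orders of differentiation.\<close>

lemma schwarz:
  fixes f :: "'a::real_normed_vector \<Rightarrow> real"
  assumes S: "open S" "x \<in> S" and f: "smooth_on S f"
  shows "dd h (dd k f) x = dd k (dd h f) x"
proof -
  obtain \<delta> where \<delta>: "\<delta> > 0" "\<And>s t. \<bar>s\<bar> \<le> \<delta> \<Longrightarrow> \<bar>t\<bar> \<le> \<delta> \<Longrightarrow> x + s *\<^sub>R h + t *\<^sub>R k \<in> S"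
    using box_in_open[OF S] by blast
  let ?p = "\<lambda>s t. x + s *\<^sub>R h + t *\<^sub>R k"
  have diff: "g differentiable (at (?p s t))" if "smooth_on S g" "\<bar>s\<bar> \<le> \<delta>" "\<bar>t\<bar> \<le> \<delta>" for g :: "'a \<Rightarrow> real" and s t
    using smooth_on_imp_differentiable[OF that(1) \<delta>(2)[OF that(2,3)]] .
  have dt: "((\<lambda>t. g (?p s t)) has_real_derivative dd k g (?p s t)) (at t)"
    if "smooth_on S g" "\<bar>s\<bar> \<le> \<delta>" "\<bar>t\<bar> \<le> \<delta>" for g :: "'a \<Rightarrow> real" and s t
    using dd_line[of g "x + s *\<^sub>R h" t k] diff[OF that] by blast
  have ds: "((\<lambda>s. g (?p s t)) has_real_derivative dd h g (?p s t)) (at s)"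
    if "smooth_on S g" "\<bar>s\<bar> \<le> \<delta>" "\<bar>t\<bar> \<le> \<delta>" for g :: "'a \<Rightarrow> real" and s t
    using dd_line[of g "x + t *\<^sub>R k" s h] diff[OF that] by (simp add: add_ac)
  have small: "\<bar>s\<bar> \<le> \<delta>" if "s \<in> T" "T \<subseteq> {-\<delta>..\<delta>}" for s T
    using that by (auto simp: subset_eq abs_le_iff minus_le_iff)
  have cont: "continuous_on (T \<times> R) (\<lambda>(s, t). g (?p s t))"
    if "smooth_on S g" "T \<subseteq> {-\<delta>..\<delta>}" "R \<subseteq> {-\<delta>..\<delta>}" for g :: "'a \<Rightarrow> real" and T R
    unfolding split_def
    by (rule continuous_on_compose2[OF smooth_on_imp_continuous[OF that(1)]])
       (use that in \<open>auto intro!: continuous_intros \<delta>(2) elim: small\<close>)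
  have cont1: "continuous_on R (\<lambda>t. g (?p s t))"
    if "smooth_on S g" "\<bar>s\<bar> \<le> \<delta>" "R \<subseteq> {-\<delta>..\<delta>}" for g :: "'a \<Rightarrow> real" and s R
    by (rule continuous_on_compose2[OF smooth_on_imp_continuous[OF that(1)]])
       (use that in \<open>auto intro!: continuous_intros \<delta>(2) elim: small\<close>)
  have eq: "dd h f (?p 0 t) - dd h f (?p 0 0) = integral {0..t} (\<lambda>\<tau>. dd h (dd k f) (?p 0 \<tau>))"
    if t: "t \<in> {0..\<delta>}" for t
  proof -
    have FTC: "integral {0..t} (\<lambda>\<tau>. dd k f (?p s \<tau>)) = f (?p s t) - f (?p s 0)" if s: "\<bar>s\<bar> \<le> \<delta>" for s
    proof (rule integral_unique, rule fundamental_theorem_of_calculus)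
      show "((\<lambda>t. f (?p s t)) has_vector_derivative dd k f (?p s \<tau>)) (at \<tau> within {0..t})" if "\<tau> \<in> {0..t}" for \<tau>
        unfolding has_real_derivative_iff_has_vector_derivative[symmetric]
        by (rule has_field_derivative_at_within, rule dt[OF f s]) (use that t in auto)
    qed (use t in auto)
    have "((\<lambda>s. integral (cbox 0 t) (\<lambda>\<tau>. dd k f (?p s \<tau>))) has_real_derivative
        integral (cbox 0 t) (\<lambda>\<tau>. dd h (dd k f) (?p 0 \<tau>))) (at 0 within {-\<delta>..\<delta>})"
    proof (rule leibniz_rule_field_derivative)
      show "((\<lambda>s. dd k f (?p s \<tau>)) has_real_derivative dd h (dd k f) (?p s \<tau>)) (at s within {-\<delta>..\<delta>})"
        if "s \<in> {-\<delta>..\<delta>}" "\<tau> \<in> cbox 0 t" for s \<tau>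
        by (rule has_field_derivative_at_within, rule ds[OF smooth_on_dd[OF f]]) (use that t in auto)
      show "(\<lambda>\<tau>. dd k f (?p s \<tau>)) integrable_on cbox 0 t" if "s \<in> {-\<delta>..\<delta>}" for s
        by (rule integrable_continuous) (rule cont1[OF smooth_on_dd[OF f]], use that t in auto)
      show "continuous_on ({-\<delta>..\<delta>} \<times> cbox 0 t) (\<lambda>(s, \<tau>). dd h (dd k f) (?p s \<tau>))"
        by (rule cont[OF smooth_on_dd[OF smooth_on_dd[OF f]]]) (use t in auto)
    qed (use \<delta> in auto)
    moreover have "(0::real) \<in> interior {-\<delta>..\<delta>}" using \<delta> by simp
    ultimately have 1: "((\<lambda>s. integral {0..t} (\<lambda>\<tau>. dd k f (?p s \<tau>))) has_real_derivative
        integral {0..t} (\<lambda>\<tau>. dd h (dd k f) (?p 0 \<tau>))) (at 0)"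
      by (simp only: at_within_interior cbox_interval)
    have "((\<lambda>s. f (?p s t) - f (?p s 0)) has_real_derivative
        integral {0..t} (\<lambda>\<tau>. dd h (dd k f) (?p 0 \<tau>))) (at 0)"
      by (rule has_field_derivative_transform_within_open[OF 1 open_greaterThanLessThan[of "-\<delta>" \<delta>]])
         (use FTC \<delta> in auto)
    moreover have "((\<lambda>s. f (?p s t) - f (?p s 0)) has_real_derivative dd h f (?p 0 t) - dd h f (?p 0 0)) (at 0)"
      by (rule DERIV_diff; rule ds[OF f]) (use t \<delta> in auto)
    ultimately show ?thesis by (rule DERIV_unique[symmetric])
  qed
  have "((\<lambda>t. integral {0..t} (\<lambda>\<tau>. dd h (dd k f) (?p 0 \<tau>))) has_vector_derivative dd h (dd k f) (?p 0 0)) (at 0 within {0..\<delta>})"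
    by (rule integral_has_vector_derivative[OF cont1[OF smooth_on_dd[OF smooth_on_dd[OF f]]]]) (use \<delta> in auto)
  then have "((\<lambda>t. dd h f (?p 0 t) - dd h f (?p 0 0)) has_vector_derivative dd h (dd k f) (?p 0 0)) (at 0 within {0..\<delta>})"
    by (rule has_vector_derivative_transform[rotated 2]) (use eq \<delta> in auto)
  moreover have "((\<lambda>t. dd h f (?p 0 t)) has_vector_derivative dd k (dd h f) (?p 0 0)) (at 0)"
    using dt[OF smooth_on_dd[OF f], of 0 0 h] \<delta> by (simp add: has_real_derivative_iff_has_vector_derivative)
  then have "((\<lambda>t. dd h f (?p 0 t) - dd h f (?p 0 0)) has_vector_derivative dd k (dd h f) (?p 0 0)) (at 0 within {0..\<delta>})"
    using has_vector_derivative_diff[OF has_vector_derivative_at_within has_vector_derivative_const] by fastforce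
  ultimately have "dd h (dd k f) (?p 0 0) = dd k (dd h f) (?p 0 0)"
    using \<delta>(1) vector_derivative_unique_within_closed_interval[of 0 \<delta> 0, unfolded cbox_interval] by simp
  then show ?thesis by simp
qed

lemma dd_path_real:
  fixes f :: "_ \<Rightarrow> real"
  assumes "f differentiable (at (\<gamma> s))" "(\<gamma> has_vector_derivative \<gamma>') (at s)"
  shows "((\<lambda>s. f (\<gamma> s)) has_real_derivative dd \<gamma>' f (\<gamma> s)) (at s)"
  unfolding has_real_derivative_iff_has_vector_derivative by (rule dd_path[OF assms])

lemma has_vector_derivative_Pair':
  assumes "(f has_vector_derivative f') (at s)" "(g has_vector_derivative g') (at s)"
  shows "((\<lambda>s. (f s, g s)) has_vector_derivative (f', g')) (at s)"
  using has_derivative_Pair[OF assms[unfolded has_vector_derivative_def]]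
  by (simp add: has_vector_derivative_def)

lemma smooth_deriv_x:
  fixes f :: "'a::real_normed_vector \<times> real \<Rightarrow> real"
  assumes "smooth_on (\<Omega> \<times> UNIV) f" "q \<in> \<Omega>"
  shows "((\<lambda>x. f (q, x)) has_real_derivative dd (0, 1) f (q, x)) (at x)"
proof (rule dd_path_real)
  show "f differentiable (at (q, x))"
    by (rule smooth_on_imp_differentiable[OF assms(1)]) (use assms in simp)
  show "((\<lambda>x. (q, x)) has_vector_derivative (0, 1)) (at x)"
    by (intro has_vector_derivative_Pair' has_vector_derivative_const has_vector_derivative_id)
qed

lemma smooth_continuous_x:
  fixes f :: "'a::real_normed_vector \<times> real \<Rightarrow> real"
  assumes "smooth_on (\<Omega> \<times> UNIV) f" "q \<in> \<Omega>"
  shows "continuous_on S (\<lambda>x. f (q, x))"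
  by (intro continuous_at_imp_continuous_on ballI DERIV_isCont[OF smooth_deriv_x[OF assms]])

lemma integral_DERIV:
  fixes F :: "real \<Rightarrow> real"
  assumes "\<And>x. (F has_real_derivative f x) (at x)" "0 \<le> X"
  shows "integral {0..X} f = F X - F 0"
proof (rule integral_unique, rule fundamental_theorem_of_calculus[OF assms(2)])
  show "(F has_vector_derivative f x) (at x within {0..X})" for x
    by (rule has_vector_derivative_at_within)
       (rule assms(1)[unfolded has_real_derivative_iff_has_vector_derivative])
qed

text \<open>The substitution \<open>x = X y\<close> fixes the interval, so that the parameter acts
  only on the integrand and the Leibniz rule for a fixed interval applies.\<close>

lemma leibniz_moving:
  fixes f :: "'a::real_normed_vector \<times> real \<Rightarrow> real" and X :: "'a \<Rightarrow> real"
  assumes \<Omega>: "open \<Omega>" "q \<in> \<Omega>" and f: "smooth_on (\<Omega> \<times> UNIV) f" and X: "smooth_on \<Omega> X"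
    and pos: "\<And>q. q \<in> \<Omega> \<Longrightarrow> X q > 0"
  shows "((\<lambda>s. integral {0..X (q + s *\<^sub>R h)} (\<lambda>x. f (q + s *\<^sub>R h, x))) has_real_derivative
    dd h X q * f (q, X q) + integral {0..X q} (\<lambda>x. dd (h, 0) f (q, x))) (at 0)"
proof -
  obtain \<delta> where \<delta>: "\<delta> > 0" and Q: "\<And>s. s \<in> {-\<delta>..\<delta>} \<Longrightarrow> q + s *\<^sub>R h \<in> \<Omega>"
    by (rule line_in_open[OF \<Omega>]) (rule that)
  let ?Q = "\<lambda>s. q + s *\<^sub>R h"
  let ?g = "\<lambda>s y. X (?Q s) * f (?Q s, X (?Q s) * y)"
  let ?g' = "\<lambda>s y. X (?Q s) * (dd (h, 0) f (?Q s, X (?Q s) * y) + dd h X (?Q s) * y * dd (0, 1) f (?Q s, X (?Q s) * y))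
      + dd h X (?Q s) * f (?Q s, X (?Q s) * y)"
  have fd: "f differentiable (at (q', x))" if "q' \<in> \<Omega>" for q' x
    by (rule smooth_on_imp_differentiable[OF f]) (use that in simp)
  have Xd: "X differentiable (at q')" if "q' \<in> \<Omega>" for q'
    by (rule smooth_on_imp_differentiable[OF X that])
  have rescale: "integral {0..X q'} (\<lambda>x. f (q', x)) = integral {0..1} (\<lambda>y. X q' * f (q', X q' * y))" if q': "q' \<in> \<Omega>" for q'
  proof -
    obtain G where G: "\<And>x. (G has_vector_derivative f (q', x)) (at x)"
      using continuous_antiderivative[OF smooth_continuous_x[OF f q']] by blast
    have G': "(G has_real_derivative f (q', x)) (at x)" for x
      using G by (simp add: has_real_derivative_iff_has_vector_derivative)
    have "((\<lambda>y. G (X q' * y)) has_real_derivative X q' * f (q', X q' * y)) (at y)" for y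
      using DERIV_chain'[OF DERIV_cmult_Id G', of "X q'"] by (simp add: mult.commute)
    from integral_DERIV[OF this] integral_DERIV[OF G', of "X q'"] pos[OF that] show ?thesis by simp
  qed
  have deriv_g: "((\<lambda>s. ?g s y) has_real_derivative ?g' s y) (at s)" if "s \<in> {-\<delta>..\<delta>}" for s y
  proof -
    have DX: "((\<lambda>s. X (?Q s)) has_real_derivative dd h X (?Q s)) (at s)"
      by (rule dd_path_real[OF Xd[OF Q[OF that]] line_deriv])
    have "((\<lambda>s. (?Q s, X (?Q s) * y)) has_vector_derivative (h, dd h X (?Q s) * y)) (at s)"
      by (intro has_vector_derivative_Pair' line_deriv)
         (use DERIV_cmult_right[OF DX] in \<open>simp add: has_real_derivative_iff_has_vector_derivative\<close>)
    note D = dd_path_real[OF fd[OF Q[OF that]] this]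
    from DERIV_cong[OF D dd_pair[OF fd[OF Q[OF that]]]]
    have "((\<lambda>s. f (?Q s, X (?Q s) * y)) has_real_derivative
        dd (h, 0) f (?Q s, X (?Q s) * y) + dd h X (?Q s) * y * dd (0, 1) f (?Q s, X (?Q s) * y)) (at s)" .
    from DERIV_mult'[OF DX this] show ?thesis .
  qed
  have contQ: "continuous_on ({-\<delta>..\<delta>} \<times> T) (\<lambda>z. F (?Q (fst z)))" if "smooth_on \<Omega> F" for F :: "'a \<Rightarrow> real" and T :: "real set"
    by (rule continuous_on_compose2[OF smooth_on_imp_continuous[OF that]])
       (use Q in \<open>auto intro!: continuous_intros\<close>)
  have contF: "continuous_on ({-\<delta>..\<delta>} \<times> T) (\<lambda>z. F (?Q (fst z), X (?Q (fst z)) * snd z))"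
    if "smooth_on (\<Omega> \<times> UNIV) F" for F :: "'a \<times> real \<Rightarrow> real" and T :: "real set"
    by (rule continuous_on_compose2[OF smooth_on_imp_continuous[OF that]])
       (use Q in \<open>auto intro!: continuous_intros contQ X\<close>)
  have "((\<lambda>s. integral (cbox 0 1) (?g s)) has_real_derivative integral (cbox 0 1) (?g' 0)) (at 0 within {-\<delta>..\<delta>})"
  proof (rule leibniz_rule_field_derivative[where f = ?g and fx = ?g'])
    show "((\<lambda>s. ?g s y) has_real_derivative ?g' s y) (at s within {-\<delta>..\<delta>})" if "s \<in> {-\<delta>..\<delta>}" for s y
      by (rule has_field_derivative_at_within[OF deriv_g[OF that]])
    show "?g s integrable_on cbox 0 1" if "s \<in> {-\<delta>..\<delta>}" for s
    proof (rule integrable_continuous)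
      have "continuous_on (cbox 0 1) (\<lambda>y. f (?Q s, X (?Q s) * y))"
        by (rule continuous_on_compose2[OF smooth_continuous_x[OF f Q[OF that], of UNIV]])
           (auto intro!: continuous_intros)
      then show "continuous_on (cbox 0 1) (?g s)"
        by (intro continuous_on_mult continuous_on_const)
    qed
    show "continuous_on ({-\<delta>..\<delta>} \<times> cbox 0 1) (\<lambda>(s, y). ?g' s y)"
      unfolding split_def
      by (intro continuous_on_add continuous_on_mult contQ contF smooth_on_dd f X continuous_on_snd continuous_on_id)
  qed (use \<delta> in auto)
  moreover have "(0::real) \<in> interior {-\<delta>..\<delta>}" using \<delta> by simp
  ultimately have D: "((\<lambda>s. integral {0..1} (?g s)) has_real_derivative integral {0..1} (?g' 0)) (at 0)"
    by (simp only: at_within_interior cbox_interval)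
  have "integral {0..1} (?g' 0) = dd h X q * f (q, X q) + integral {0..X q} (\<lambda>x. dd (h, 0) f (q, x))"
  proof -
    obtain G where G: "\<And>x. (G has_vector_derivative dd (h, 0) f (q, x)) (at x)"
      using continuous_antiderivative[OF smooth_continuous_x[OF smooth_on_dd[OF f] \<Omega>(2)]] by blast
    have G': "(G has_real_derivative dd (h, 0) f (q, x)) (at x)" for x
      using G by (simp add: has_real_derivative_iff_has_vector_derivative)
    \<comment> \<open>The terms caused by the variation of the period are the derivative of
      \<open>y f (q, X y)\<close> times \<open>dd h X q\<close>; its value at \<open>y = 1\<close>
      is the boundary term.\<close>
    have "((\<lambda>y. dd h X q * (y * f (q, X q * y)) + G (X q * y)) has_real_derivative ?g' 0 y) (at y)" for y
    proof -
      have "((\<lambda>y. f (q, X q * y)) has_real_derivative X q * dd (0, 1) f (q, X q * y)) (at y)"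
        using DERIV_chain'[OF DERIV_cmult_Id smooth_deriv_x[OF f \<Omega>(2)], of "X q"] by (simp add: mult.commute)
      moreover have "((\<lambda>y. G (X q * y)) has_real_derivative X q * dd (h, 0) f (q, X q * y)) (at y)"
        using DERIV_chain'[OF DERIV_cmult_Id G', of "X q"] by (simp add: mult.commute)
      ultimately show ?thesis
        by (rule DERIV_cong[OF DERIV_add[OF DERIV_cmult[OF DERIV_mult[OF DERIV_ident]]]]) (simp add: algebra_simps)
    qed
    from integral_DERIV[OF this, of 1] integral_DERIV[OF G', of "X q"] pos[OF \<Omega>(2)] show ?thesis
      by simp
  qed
  with D have "((\<lambda>s. integral {0..1} (?g s)) has_real_derivative
      dd h X q * f (q, X q) + integral {0..X q} (\<lambda>x. dd (h, 0) f (q, x))) (at 0)" by simp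
  then show ?thesis
    by (rule has_field_derivative_transform_within_open[OF _ open_greaterThanLessThan[of "-\<delta>" \<delta>]])
       (use \<delta> rescale[OF Q] in auto)
qed

section \<open>The profile equations and their parameter derivatives\<close>

lemma pd_eqI: "(f has_derivative f') (at x) \<Longrightarrow> pd h f x = f' h"
  using pd_eq_dd[of f x h] dd_eqI[of f f' x h] by (auto simp: differentiable_def)

lemma compose2_smooth:
  fixes F :: "real \<times> real \<Rightarrow> real"
  assumes "smooth_on UNIV F" "smooth_on S f" "smooth_on S g" "z \<in> S"
  shows "((\<lambda>z. F (f z, g z)) has_derivative
    (\<lambda>h. dd (1, 0) F (f z, g z) * dd h f z + dd (0, 1) F (f z, g z) * dd h g z)) (at z)"
  by (intro has_derivative_compose2 smooth_on_imp_differentiable[OF assms(1)]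
      smooth_on_imp_differentiable[OF assms(2,4)] smooth_on_imp_differentiable[OF assms(3,4)]) simp

lemma compose2_linear:
  fixes F :: "real \<times> real \<Rightarrow> real"
  assumes "smooth_on UNIV F" "bounded_linear f" "bounded_linear g"
  shows "((\<lambda>z. F (f z, g z)) has_derivative
    (\<lambda>h. dd (1, 0) F (f z, g z) * f h + dd (0, 1) F (f z, g z) * g h)) (at z)"
  using compose2_smooth[where S = UNIV and z = z, OF assms(1) smooth_on_linear[OF assms(2)] smooth_on_linear[OF assms(3)]]
  by (simp add: dd_linear assms)

section \<open>The Hamiltonian density in scalar coordinates\<close>

definition cv :: "(real ^ 2) \<times> (real ^ 2) \<Rightarrow> real" where "cv z = fst z $ 1"
definition cu :: "(real ^ 2) \<times> (real ^ 2) \<Rightarrow> real" where "cu z = fst z $ 2"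
definition cp :: "(real ^ 2) \<times> (real ^ 2) \<Rightarrow> real" where "cp z = snd z $ 1"

lemma linear_coords: "bounded_linear cv" "bounded_linear cu" "bounded_linear cp"
  unfolding cv_def[abs_def] cu_def[abs_def] cp_def[abs_def]
  by (intro bounded_linear_compose[OF bounded_linear_vec_nth] bounded_linear_fst bounded_linear_snd)+

lemma coords_dir: "cv (dirU 1) = 1" "cv (dirU 2) = 0" "cv (dirX i) = 0"
  "cu (dirU 1) = 0" "cu (dirU 2) = 1" "cu (dirX i) = 0"
  "cp (dirU i) = 0" "cp (dirX 1) = 1" "cp (dirX 2) = 0"
  by (simp_all add: cv_def cu_def cp_def dirU_def dirX_def axis_def)

locale smooth_hamiltonian =
  fixes B :: "real ^ 2 ^ 2" and a b :: real and I E :: "real \<times> real \<Rightarrow> real"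
  assumes B: "matrix_inv B = vector [vector [a, b], vector [b, 0]]" and b_nz: "b \<noteq> 0"
    and I: "smooth_on UNIV I" and E: "smooth_on UNIV E"
    and I_convex: "\<And>v u. pd (0, 1) (pd (0, 1) I) (v, u) > 0"
    and E_convex: "\<And>v w. pd (0, 1) (pd (0, 1) E) (v, w) > 0"
begin

abbreviation "I1 \<equiv> dd (1, 0) I"
abbreviation "I2 \<equiv> dd (0, 1) I"
abbreviation "E1 \<equiv> dd (1, 0) E"
abbreviation "E2 \<equiv> dd (0, 1) E"
abbreviation "I11 \<equiv> dd (1, 0) I1"
abbreviation "I12 \<equiv> dd (1, 0) I2"
abbreviation "I22 \<equiv> dd (0, 1) I2"
abbreviation "E11 \<equiv> dd (1, 0) E1"
abbreviation "E12 \<equiv> dd (1, 0) E2"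
abbreviation "E22 \<equiv> dd (0, 1) E2"

lemma mixed_partials: "dd (0, 1) I1 z = I12 z" "dd (0, 1) E1 z = E12 z"
  by (rule schwarz[OF open_UNIV UNIV_I I], rule schwarz[OF open_UNIV UNIV_I E])

lemmas IE_smooth = I E smooth_on_dd[OF I] smooth_on_dd[OF E] smooth_on_dd[OF smooth_on_dd[OF I]] smooth_on_dd[OF smooth_on_dd[OF E]]

lemma pd_smooth: "smooth_on UNIV F \<Longrightarrow> pd h F = dd h F" for F :: "real \<times> real \<Rightarrow> real"
  by (rule ext, rule pd_eq_dd, rule smooth_on_imp_differentiable) auto

lemma I22_pos: "I22 z > 0" and E22_pos: "E22 z > 0"
  using I_convex[of "fst z" "snd z"] E_convex[of "fst z" "snd z"] by (simp_all add: pd_smooth IE_smooth)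

definition K :: "real \<Rightarrow> density" where
  "K c z = I (cv z, cu z) + E (cv z, cp z) + c * (a / 2 * (cv z * cv z) + b * (cv z * cu z))"

lemma impulse_eq: "impulse B W = a / 2 * (W $ 1 * W $ 1) + b * (W $ 1 * W $ 2)"
  by (simp add: impulse_def B inner_vec_def sum_2 matrix_vector_mult_def field_simps)

lemma plus_impulse_eq: "plus_impulse (hamiltonian I E) c B = K c"
  by (auto simp: plus_impulse_def hamiltonian_def K_def impulse_eq cv_def cu_def cp_def)

lemma hamiltonian_eq: "hamiltonian I E = K 0"
  by (auto simp: hamiltonian_def K_def cv_def cu_def cp_def)

lemma lin_deriv: "(cv has_derivative cv) (at z)" "(cu has_derivative cu) (at z)" "(cp has_derivative cp) (at z)"
  using linear_coords bounded_linear_imp_has_derivative by auto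

lemma pd_K_gen: "pd h (K c) z = (I1 (cv z, cu z) * cv h + I2 (cv z, cu z) * cu h)
   + (E1 (cv z, cp z) * cv h + E2 (cv z, cp z) * cp h)
   + c * (a / 2 * (cv z * cv h + cv h * cv z) + b * (cv z * cu h + cv h * cu z))"
  unfolding K_def[abs_def]
  by (rule pd_eqI[where f' = "\<lambda>h. (I1 (cv z, cu z) * cv h + I2 (cv z, cu z) * cu h)
   + (E1 (cv z, cp z) * cv h + E2 (cv z, cp z) * cp h)
   + c * (a / 2 * (cv z * cv h + cv h * cv z) + b * (cv z * cu h + cv h * cu z))"])
   (intro has_derivative_add has_derivative_mult_right has_derivative_mult compose2_linear I E linear_coords lin_deriv)

lemma pd_K: "pd (dirU 1) (K c) = (\<lambda>z. I1 (cv z, cu z) + E1 (cv z, cp z) + c * (a * cv z + b * cu z))"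
  "pd (dirU 2) (K c) = (\<lambda>z. I2 (cv z, cu z) + c * (b * cv z))"
  "pd (dirX 1) (K c) = (\<lambda>z. E2 (cv z, cp z))"
  "pd (dirX 2) (K c) = (\<lambda>z. 0)"
  by (simp_all add: fun_eq_iff pd_K_gen coords_dir)

lemma pd2_K:
  "pd h (pd (dirU 1) (K c)) z = I11 (cv z, cu z) * cv h + I12 (cv z, cu z) * cu h
     + (E11 (cv z, cp z) * cv h + E12 (cv z, cp z) * cp h) + c * (a * cv h + b * cu h)"
  "pd h (pd (dirU 2) (K c)) z = I12 (cv z, cu z) * cv h + I22 (cv z, cu z) * cu h + c * (b * cv h)"
  "pd h (pd (dirX 1) (K c)) z = E12 (cv z, cp z) * cv h + E22 (cv z, cp z) * cp h"
  "pd h (pd (dirX 2) (K c)) z = 0"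
  unfolding pd_K mixed_partials[symmetric]
  by (rule pd_eqI[where f' = "\<lambda>h. I11 (cv z, cu z) * cv h + dd (0, 1) I1 (cv z, cu z) * cu h
     + (E11 (cv z, cp z) * cv h + dd (0, 1) E1 (cv z, cp z) * cp h) + c * (a * cv h + b * cu h)"],
    intro has_derivative_add has_derivative_mult_right compose2_linear IE_smooth linear_coords lin_deriv)
   (unfold mixed_partials,
    rule pd_eqI[where f' = "\<lambda>h. I12 (cv z, cu z) * cv h + I22 (cv z, cu z) * cu h + c * (b * cv h)"],
    intro has_derivative_add has_derivative_mult_right compose2_linear IE_smooth linear_coords lin_deriv,
    rule pd_eqI[where f' = "\<lambda>h. E12 (cv z, cp z) * cv h + E22 (cv z, cp z) * cp h"],
    intro compose2_linear IE_smooth linear_coords,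
    rule pd_eqI[where f' = "\<lambda>h. 0"], rule has_derivative_const)

end

locale profile_family = smooth_hamiltonian +
  fixes \<Omega> :: "(real ^ 4) set" and U :: "real ^ 4 \<Rightarrow> real \<Rightarrow> real ^ 2" and \<Xi> :: "real ^ 4 \<Rightarrow> real"
  assumes \<Omega>: "open \<Omega>" and U: "smooth_on (\<Omega> \<times> UNIV) (\<lambda>(q, x). U q x)" and \<Xi>: "smooth_on \<Omega> \<Xi>"
    and \<Xi>_pos: "\<And>q. q \<in> \<Omega> \<Longrightarrow> \<Xi> q > 0"
    and U_per: "\<And>q x. q \<in> \<Omega> \<Longrightarrow> U q (x + \<Xi> q) = U q x"
    and euler_lagrange: "\<And>q x. q \<in> \<Omega> \<Longrightarrow>
      var_deriv (plus_impulse (hamiltonian I E) (par_c q) B) (U q) x = par_lambda q"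
    and energy: "\<And>q x. q \<in> \<Omega> \<Longrightarrow> U q x \<bullet> var_deriv (hamiltonian I E) (U q) x
      + legendre (hamiltonian I E) (U q) x + par_c q * impulse B (U q x) = par_mu q"
begin

abbreviation (input) "DD \<equiv> \<Omega> \<times> (UNIV :: real set)"

lemma open_DD: "open DD" using \<Omega> by (simp add: open_Times)

definition vv :: "(real ^ 4) \<times> real \<Rightarrow> real" where "vv z = U (fst z) (snd z) $ 1"
definition uu :: "(real ^ 4) \<times> real \<Rightarrow> real" where "uu z = U (fst z) (snd z) $ 2"
definition vx :: "(real ^ 4) \<times> real \<Rightarrow> real" where "vx = dd (0, 1) vv"
text \<open>The momentum \<pi>. With it the first Euler-Lagrange equation is of first order, and
  \<open>v_xx\<close> does not appear.\<close>

definition pp :: "(real ^ 4) \<times> real \<Rightarrow> real" where "pp z = E2 (vv z, vx z)"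

lemma smooth_profile: "smooth_on DD vv" "smooth_on DD uu" "smooth_on DD vx" "smooth_on DD pp"
proof -
  show v: "smooth_on DD vv" and "smooth_on DD uu"
    using smooth_on_vec_nth[OF open_DD U] by (simp_all add: vv_def[abs_def] uu_def[abs_def] split_def)
  show vx: "smooth_on DD vx" unfolding vx_def by (rule smooth_on_dd[OF v])
  show "smooth_on DD pp" unfolding pp_def[abs_def]
    by (rule smooth_on_compose2[OF open_DD IE_smooth(4) v vx])
qed

lemmas profile_diff = smooth_profile[THEN smooth_on_imp_differentiable]

lemma U_deriv:
  assumes "q \<in> \<Omega>"
  shows "(U q has_vector_derivative vector [vx (q, x), dd (0, 1) uu (q, x)]) (at x)"
  using smooth_deriv_x[OF smooth_profile(1) assms, of x] smooth_deriv_x[OF smooth_profile(2) assms, of x]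
  by (simp add: has_vector_derivative_vec_iff forall_2 vv_def uu_def vx_def has_real_derivative_iff_has_vector_derivative)

lemma jet_eq:
  assumes "q \<in> \<Omega>"
  shows "jet (U q) x = (U q x, vector [vx (q, x), dd (0, 1) uu (q, x)])"
    "cv (jet (U q) x) = vv (q, x)" "cu (jet (U q) x) = uu (q, x)" "cp (jet (U q) x) = vx (q, x)"
  using vector_derivative_at[OF U_deriv[OF assms]]
  by (simp_all add: jet_def cv_def cu_def cp_def vv_def uu_def)

lemma var_deriv_K:
  assumes "q \<in> \<Omega>"
  shows "var_deriv (K c) (U q) x $ 1 = I1 (vv (q, x), uu (q, x)) + E1 (vv (q, x), vx (q, x))
      + c * (a * vv (q, x) + b * uu (q, x)) - dd (0, 1) pp (q, x)"
    "var_deriv (K c) (U q) x $ 2 = I2 (vv (q, x), uu (q, x)) + c * (b * vv (q, x))"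
  using DERIV_imp_deriv[OF smooth_deriv_x[OF smooth_profile(4) assms, of x]]
  by (simp_all add: var_deriv_def pd_K jet_eq(2-4)[OF assms] pp_def)

lemma profile_eq_v:
  assumes "z \<in> DD"
  shows "dd (0, 1) pp z = I1 (vv z, uu z) + E1 (vv z, vx z) + fst z $ 4 * (a * vv z + b * uu z) - fst z $ 2"
  using arg_cong[OF euler_lagrange[of "fst z" "snd z"], of "\<lambda>v. v $ 1"] assms
  by (simp add: plus_impulse_eq var_deriv_K mem_Times_iff par_lambda_def par_c_def)

lemma profile_eq_u:
  assumes "z \<in> DD"
  shows "I2 (vv z, uu z) + fst z $ 4 * (b * vv z) = fst z $ 3"
  using arg_cong[OF euler_lagrange[of "fst z" "snd z"], of "\<lambda>v. v $ 2"] assms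
  by (simp add: plus_impulse_eq var_deriv_K mem_Times_iff par_lambda_def par_c_def)

text \<open>By the Euler-Lagrange equations \<open>U . E H = \<lambda> . U - 2 c Q\<close>. This
  turns \<open>+ c Q\<close> into \<open>- c Q\<close> and leaves a first integral without
  \<open>\<pi>_x\<close>.\<close>

lemma profile_energy:
  assumes "z \<in> DD"
  shows "vx z * pp z - I (vv z, uu z) - E (vv z, vx z) + fst z $ 2 * vv z + fst z $ 3 * uu z
    - fst z $ 4 * (a / 2 * (vv z * vv z) + b * (vv z * uu z)) = fst z $ 1"
proof -
  obtain q x where z: "z = (q, x)" "q \<in> \<Omega>" using assms by auto
  have leg: "legendre (K 0) (U q) x = vx z * pp z - I (vv z, uu z) - E (vv z, vx z)"
    by (simp add: legendre_def sum_2 pd_K jet_eq(2-4)[OF z(2)] vector_derivative_at[OF U_deriv[OF z(2)]] K_def z pp_def)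
  have "U q x \<bullet> var_deriv (K 0) (U q) x = vv z * (I1 (vv z, uu z) + E1 (vv z, vx z) - dd (0, 1) pp z)
      + uu z * I2 (vv z, uu z)"
    by (simp add: inner_vec_def sum_2 var_deriv_K[OF z(2)] z(1) vv_def uu_def)
  also have "\<dots> = vv z * (fst z $ 2 - fst z $ 4 * (a * vv z + b * uu z)) + uu z * (fst z $ 3 - fst z $ 4 * (b * vv z))"
  proof -
    have "I1 (vv z, uu z) + E1 (vv z, vx z) - dd (0, 1) pp z = fst z $ 2 - fst z $ 4 * (a * vv z + b * uu z)"
      using profile_eq_v[OF assms] by simp
    moreover have "I2 (vv z, uu z) = fst z $ 3 - fst z $ 4 * (b * vv z)"
      using profile_eq_u[OF assms] by simp
    ultimately show ?thesis by (simp only:)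
  qed
  finally have "vv z * (fst z $ 2 - fst z $ 4 * (a * vv z + b * uu z)) + uu z * (fst z $ 3 - fst z $ 4 * (b * vv z))
      + (vx z * pp z - I (vv z, uu z) - E (vv z, vx z))
      + fst z $ 4 * (a / 2 * (vv z * vv z) + b * (vv z * uu z)) = fst z $ 1"
    using energy[OF z(2), of x] leg unfolding hamiltonian_eq
    by (simp add: par_c_def par_mu_def z(1) impulse_eq vv_def uu_def)
  then show ?thesis by (simp add: field_simps)
qed

end

section \<open>Linearised profile equations and the coefficients of the system\<close>

context profile_family begin

lemma coord_deriv: "((\<lambda>z :: (real ^ 4) \<times> real. fst z $ i) has_derivative (\<lambda>h. fst h $ i)) (at z)"
  by (intro bounded_linear_imp_has_derivative bounded_linear_compose[OF bounded_linear_vec_nth] bounded_linear_fst)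

lemma profile_deriv:
  assumes "z \<in> DD"
  shows "(vv has_derivative (\<lambda>h. dd h vv z)) (at z)" "(uu has_derivative (\<lambda>h. dd h uu z)) (at z)"
    "(vx has_derivative (\<lambda>h. dd h vx z)) (at z)" "(pp has_derivative (\<lambda>h. dd h pp z)) (at z)"
  by (intro dd_works profile_diff assms)+

lemma dd_vx: "z \<in> DD \<Longrightarrow> dd h vx z = dd (0, 1) (dd h vv) z"
  unfolding vx_def by (rule schwarz[OF open_DD _ smooth_profile(1)])

lemma dd_pp:
  assumes "z \<in> DD"
  shows "dd h pp z = E12 (vv z, vx z) * dd h vv z + E22 (vv z, vx z) * dd (0, 1) (dd h vv) z"
  unfolding dd_vx[OF assms, symmetric]
  by (rule dd_eqI[where f = pp, unfolded pp_def[abs_def], OF compose2_smooth, folded pp_def[abs_def]])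
     (use IE_smooth smooth_profile assms in auto)

lemma dd_profile_eq_v:
  assumes z: "z \<in> DD"
  shows "dd (0, 1) (dd h pp) z = (I11 (vv z, uu z) + E11 (vv z, vx z) + fst z $ 4 * a) * dd h vv z
    + (I12 (vv z, uu z) + fst z $ 4 * b) * dd h uu z + E12 (vv z, vx z) * dd (0, 1) (dd h vv) z
    + fst h $ 4 * (a * vv z + b * uu z) - fst h $ 2"
proof -
  have "dd (0, 1) (dd h pp) z = dd h (dd (0, 1) pp) z"
    by (rule schwarz[OF open_DD z smooth_profile(4)])
  also have "\<dots> = dd h (\<lambda>z. I1 (vv z, uu z) + E1 (vv z, vx z) + fst z $ 4 * (a * vv z + b * uu z) - fst z $ 2) z"
    by (rule dd_cong[OF smooth_on_imp_differentiable[OF smooth_on_dd[OF smooth_profile(4)] z] open_DD z profile_eq_v])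
  also have "\<dots> = (I11 (vv z, uu z) * dd h vv z + dd (0, 1) I1 (vv z, uu z) * dd h uu z)
      + (E11 (vv z, vx z) * dd h vv z + dd (0, 1) E1 (vv z, vx z) * dd h vx z)
      + (fst z $ 4 * (a * dd h vv z + b * dd h uu z) + fst h $ 4 * (a * vv z + b * uu z)) - fst h $ 2"
    by (rule dd_eqI[where f' = "\<lambda>h. (I11 (vv z, uu z) * dd h vv z + dd (0, 1) I1 (vv z, uu z) * dd h uu z)
      + (E11 (vv z, vx z) * dd h vv z + dd (0, 1) E1 (vv z, vx z) * dd h vx z)
      + (fst z $ 4 * (a * dd h vv z + b * dd h uu z) + fst h $ 4 * (a * vv z + b * uu z)) - fst h $ 2"])
       (intro has_derivative_diff has_derivative_add has_derivative_mult has_derivative_mult_right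
          compose2_smooth[OF _ _ _ z] IE_smooth smooth_profile coord_deriv profile_deriv z)
  finally show ?thesis
    unfolding mixed_partials dd_vx[OF z] by (simp add: algebra_simps)
qed

lemma dd_profile_eq_u:
  assumes z: "z \<in> DD"
  shows "(I12 (vv z, uu z) + fst z $ 4 * b) * dd h vv z + I22 (vv z, uu z) * dd h uu z
    + fst h $ 4 * (b * vv z) = fst h $ 3"
proof -
  let ?f = "\<lambda>z. I2 (vv z, uu z) + fst z $ 4 * (b * vv z)"
  have D: "(?f has_derivative (\<lambda>h. (I12 (vv z, uu z) * dd h vv z + I22 (vv z, uu z) * dd h uu z)
      + (fst z $ 4 * (b * dd h vv z) + fst h $ 4 * (b * vv z)))) (at z)"
    by (intro has_derivative_add has_derivative_mult has_derivative_mult_right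
          compose2_smooth[OF _ _ _ z] IE_smooth smooth_profile coord_deriv profile_deriv z)
  have "dd h ?f z = dd h (\<lambda>z. fst z $ 3) z"
    by (rule dd_cong[OF _ open_DD z profile_eq_u]) (use D in \<open>auto simp: differentiable_def\<close>)
  then show ?thesis
    unfolding dd_eqI[OF D] dd_eqI[OF coord_deriv] by (simp add: algebra_simps)
qed

text \<open>The variations of \<open>v_x\<close> and \<open>u\<close> drop out by the definition of
  \<pi> and the second Euler-Lagrange equation; what remains is the flux of the linearised system.
  In the direction of \<mu> it says that the Wronskian with \<open>U_x\<close> is 1.\<close>

lemma dd_profile_energy:
  assumes z: "z \<in> DD"
  shows "vx z * dd h pp z - dd (0, 1) pp z * dd h vv z + fst h $ 2 * vv z + fst h $ 3 * uu z
    - fst h $ 4 * (a / 2 * (vv z * vv z) + b * (vv z * uu z)) = fst h $ 1"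
proof -
  let ?f = "\<lambda>z. vx z * pp z - I (vv z, uu z) - E (vv z, vx z) + fst z $ 2 * vv z + fst z $ 3 * uu z
    - fst z $ 4 * (a / 2 * (vv z * vv z) + b * (vv z * uu z))"
  have D: "(?f has_derivative (\<lambda>h. (vx z * dd h pp z + dd h vx z * pp z)
      - (I1 (vv z, uu z) * dd h vv z + I2 (vv z, uu z) * dd h uu z)
      - (E1 (vv z, vx z) * dd h vv z + E2 (vv z, vx z) * dd h vx z)
      + (fst z $ 2 * dd h vv z + fst h $ 2 * vv z) + (fst z $ 3 * dd h uu z + fst h $ 3 * uu z)
      - (fst z $ 4 * (a / 2 * (vv z * dd h vv z + dd h vv z * vv z) + b * (vv z * dd h uu z + dd h vv z * uu z))
        + fst h $ 4 * (a / 2 * (vv z * vv z) + b * (vv z * uu z))))) (at z)"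
    by (intro has_derivative_diff has_derivative_add has_derivative_mult has_derivative_mult_right
          compose2_smooth[OF _ _ _ z] IE_smooth smooth_profile coord_deriv profile_deriv z)
  have "dd h ?f z = dd h (\<lambda>z. fst z $ 1) z"
    by (rule dd_cong[OF _ open_DD z profile_energy]) (use D in \<open>auto simp: differentiable_def\<close>)
  then have *: "(vx z * dd h pp z + dd h vx z * pp z)
      - (I1 (vv z, uu z) * dd h vv z + I2 (vv z, uu z) * dd h uu z)
      - (E1 (vv z, vx z) * dd h vv z + pp z * dd h vx z)
      + (fst z $ 2 * dd h vv z + fst h $ 2 * vv z) + (fst z $ 3 * dd h uu z + fst h $ 3 * uu z)
      - (fst z $ 4 * (a / 2 * (vv z * dd h vv z + dd h vv z * vv z) + b * (vv z * dd h uu z + dd h vv z * uu z))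
        + fst h $ 4 * (a / 2 * (vv z * vv z) + b * (vv z * uu z))) = fst h $ 1"
    unfolding dd_eqI[OF D] dd_eqI[OF coord_deriv] pp_def[symmetric] .
  have "dd (0, 1) pp z * dd h vv z = (I1 (vv z, uu z) + E1 (vv z, vx z) + fst z $ 4 * (a * vv z + b * uu z) - fst z $ 2) * dd h vv z"
    using profile_eq_v[OF z] by simp
  moreover have "I2 (vv z, uu z) * dd h uu z = (fst z $ 3 - fst z $ 4 * (b * vv z)) * dd h uu z"
    by (rule arg_cong[where f = "\<lambda>t. t * dd h uu z"]) (use profile_eq_u[OF z] in simp)
  ultimately show ?thesis
    using * by (simp add: algebra_simps)
qed

text \<open>Second derivatives of the Hamiltonian along the profile, and the coefficients of the system for \<open>Y\<close>
  obtained from them.\<close>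

definition ka where "ka q x = E22 (vv (q, x), vx (q, x))"
definition ee where "ee q x = E12 (vv (q, x), vx (q, x))"
definition mm where "mm q x = I11 (vv (q, x), uu (q, x)) + E11 (vv (q, x), vx (q, x)) + q $ 4 * a"
definition al where "al q x = I12 (vv (q, x), uu (q, x)) + q $ 4 * b"
definition be where "be q x = I22 (vv (q, x), uu (q, x))"

definition kk where "kk q x = 1 / ka q x"
definition ll where "ll q x = 1 / be q x"
definition d1 where "d1 q x = - ee q x / ka q x"
text \<open>The Schur complement with respect to \<open>v\<close> of the Hessian in
  \<open>(v, u, v_x)\<close>: the other two variables have been eliminated.\<close>

definition d2 where "d2 q x = mm q x - (al q x)\<^sup>2 / be q x - (ee q x)\<^sup>2 / ka q x"
definition d3 where "d3 q x = ee q x / ka q x"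
definition d4 where "d4 q x = al q x / be q x"
definition d5 where "d5 q x = a / b - al q x / be q x"

abbreviation "dw q x y \<equiv> d1 q x * y $ 1 + kk q x * y $ 2"
abbreviation "dP q x y \<equiv> d2 q x * y $ 1 + d3 q x * y $ 2 - y $ 3 + d4 q x * y $ 4"
abbreviation "du q x y \<equiv> ll q x * y $ 4 - d4 q x * y $ 1"
abbreviation "N3 q x y \<equiv> d5 q x * y $ 1 + ll q x * y $ 4"

lemma ka_pos: "ka q x > 0" and be_pos: "be q x > 0"
  by (simp_all add: ka_def be_def E22_pos I22_pos)

lemma coefficient_deriv:
  fixes F :: "real \<times> real \<Rightarrow> real" and f g :: "(real ^ 4) \<times> real \<Rightarrow> real"
  assumes "smooth_on UNIV F" "smooth_on DD f" "smooth_on DD g" "q \<in> \<Omega>"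
  shows "((\<lambda>x. F (f (q, x), g (q, x))) has_real_derivative dd (0, 1) (\<lambda>z. F (f z, g z)) (q, x)) (at x)"
  by (rule smooth_deriv_x[OF smooth_on_compose2[OF open_DD assms(1-3)] assms(4)])

lemma coefficient_continuous:
  fixes F :: "real \<times> real \<Rightarrow> real" and f g :: "(real ^ 4) \<times> real \<Rightarrow> real"
  assumes "smooth_on UNIV F" "smooth_on DD f" "smooth_on DD g" "q \<in> \<Omega>"
  shows "continuous_on S (\<lambda>x. F (f (q, x), g (q, x)))"
  by (rule smooth_continuous_x[OF smooth_on_compose2[OF open_DD assms(1-3)] assms(4)])

lemma continuous_coefficients:
  assumes "q \<in> \<Omega>"
  shows "continuous_on S (ka q)" "continuous_on S (ee q)" "continuous_on S (mm q)"
    "continuous_on S (al q)" "continuous_on S (be q)"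
  unfolding ka_def[abs_def] ee_def[abs_def] mm_def[abs_def] al_def[abs_def] be_def[abs_def]
  by (intro continuous_on_add continuous_on_const coefficient_continuous IE_smooth smooth_profile assms)+

lemma wave_system:
  assumes "q \<in> \<Omega>"
  shows "wave_system (kk q) (ll q) (d1 q) (d2 q) (d3 q) (d4 q) (d5 q) b (\<Xi> q)"
proof
  have nz: "\<forall>x\<in>UNIV. ka q x \<noteq> 0" "\<forall>x\<in>UNIV. be q x \<noteq> 0"
    using ka_pos be_pos by (auto simp: less_imp_neq[symmetric])
  note c = continuous_coefficients[OF assms]
  show "continuous_on UNIV (kk q)" "continuous_on UNIV (ll q)" "continuous_on UNIV (d1 q)"
    "continuous_on UNIV (d2 q)" "continuous_on UNIV (d3 q)" "continuous_on UNIV (d4 q)" "continuous_on UNIV (d5 q)"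
    unfolding kk_def[abs_def] ll_def[abs_def] d1_def[abs_def] d2_def[abs_def] d3_def[abs_def] d4_def[abs_def] d5_def[abs_def]
    by (intro continuous_on_diff continuous_on_divide continuous_on_minus continuous_on_power continuous_on_const c nz)+
qed (use ka_pos be_pos \<Xi>_pos[OF assms] b_nz in \<open>simp_all add: kk_def ll_def\<close>)

text \<open>The derivative of the profile in a direction \<open>h\<close> of the space of pairs (parameter, \<open>x\<close>): \<open>(0, 1)\<close> gives
  \<open>U\<^sub>x\<close>, and \<open>(axis j 1, 0)\<close> the parameter derivatives. The last two components are \<open>g = A (dU h)\<close>.\<close>

definition dirY :: "real ^ 4 \<Rightarrow> (real ^ 4) \<times> real \<Rightarrow> real \<Rightarrow> real ^ 4" where
  "dirY q h x = vector [dd h vv (q, x), dd h pp (q, x),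
     fst h $ 2 - fst h $ 4 * (a * vv (q, x) + b * uu (q, x)), fst h $ 3 - fst h $ 4 * (b * vv (q, x))]"

text \<open>The second profile equation contains no x-derivative, so its linearisation is algebraic
  and strong convexity in \<open>u\<close> lets it be solved for the
  \<open>u\<close>-component.\<close>

lemma dd_uu:
  assumes "q \<in> \<Omega>"
  shows "dd h uu (q, x) = du q x (dirY q h x)"
proof -
  have "(q, x) \<in> DD" using assms by simp
  from dd_profile_eq_u[OF this, of h]
  have "be q x * dd h uu (q, x) = dirY q h x $ 4 - al q x * dirY q h x $ 1"
    by (simp add: dirY_def al_def be_def)
  then show ?thesis
    using be_pos[of q x] by (simp add: ll_def d4_def field_simps)
qed

text \<open>The linearised Legendre transformation, solved for the derivative of \<open>v_x\<close>
  by strong convexity of \<open>E\<close>.\<close>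

lemma dd_vv_x:
  assumes "q \<in> \<Omega>"
  shows "dd (0, 1) (dd h vv) (q, x) = dw q x (dirY q h x)"
proof -
  have "(q, x) \<in> DD" using assms by simp
  from dd_pp[OF this, of h]
  have "dirY q h x $ 2 = ee q x * dirY q h x $ 1 + ka q x * dd (0, 1) (dd h vv) (q, x)"
    by (simp add: dirY_def ee_def ka_def)
  then show ?thesis
    using ka_pos[of q x] by (simp add: kk_def d1_def field_simps)
qed

lemma dd_pp_x:
  assumes "q \<in> \<Omega>"
  shows "dd (0, 1) (dd h pp) (q, x) = dP q x (dirY q h x)"
proof -
  have "(q, x) \<in> DD" using assms by simp
  from dd_profile_eq_v[OF this, of h]
  have "dd (0, 1) (dd h pp) (q, x) = mm q x * dirY q h x $ 1 + al q x * dd h uu (q, x)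
     + ee q x * dd (0, 1) (dd h vv) (q, x) - dirY q h x $ 3"
    by (simp add: dirY_def ee_def mm_def al_def)
  also have "\<dots> = dP q x (dirY q h x)"
    unfolding dd_uu[OF assms] dd_vv_x[OF assms]
    by (simp add: kk_def ll_def d1_def d2_def d3_def d4_def power2_eq_square algebra_simps diff_divide_distrib add_divide_distrib)
  finally show ?thesis .
qed

lemma N_dirY:
  assumes "q \<in> \<Omega>"
  shows "b * (d5 q x * dirY q h x $ 1 + ll q x * dirY q h x $ 4) = a * dd h vv (q, x) + b * dd h uu (q, x)"
  unfolding dd_uu[OF assms] using b_nz be_pos[of q x]
  by (simp add: d5_def ll_def d4_def dirY_def field_simps)

lemma dirY_deriv:
  assumes q: "q \<in> \<Omega>"
  shows "(dirY q h has_vector_derivative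
    wave_system.M (kk q) (ll q) (d1 q) (d2 q) (d3 q) (d4 q) (d5 q) b 0 x *v dirY q h x
    - fst h $ 4 *\<^sub>R (wave_system.N (ll q) (d5 q) b x *v dirY q (0, 1) x)) (at x)"
proof -
  interpret W: wave_system "kk q" "ll q" "d1 q" "d2 q" "d3 q" "d4 q" "d5 q" b "\<Xi> q"
    by (rule wave_system[OF q])
  note DV = smooth_deriv_x[OF smooth_profile(1) q] and DU = smooth_deriv_x[OF smooth_profile(2) q]
  have 1: "((\<lambda>x. dirY q h x $ 1) has_real_derivative dw q x (dirY q h x)) (at x)"
    using smooth_deriv_x[OF smooth_on_dd[OF smooth_profile(1)] q, of h x] unfolding dd_vv_x[OF q]
    by (simp add: dirY_def)
  have 2: "((\<lambda>x. dirY q h x $ 2) has_real_derivative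
      dP q x (dirY q h x)) (at x)"
    using smooth_deriv_x[OF smooth_on_dd[OF smooth_profile(4)] q, of h x] unfolding dd_pp_x[OF q]
    by (simp add: dirY_def)
  have NY3: "(W.N x *v dirY q (0, 1) x) $ 3 = a * dd (0, 1) vv (q, x) + b * dd (0, 1) uu (q, x)"
    unfolding W.N_mult N_dirY[OF q] by simp
  have NY4: "(W.N x *v dirY q (0, 1) x) $ 4 = b * dd (0, 1) vv (q, x)"
    unfolding W.N_mult by (simp add: dirY_def)
  have "((\<lambda>x. fst h $ 2 - fst h $ 4 * (a * vv (q, x) + b * uu (q, x))) has_real_derivative
      0 - fst h $ 4 * (a * dd (0, 1) vv (q, x) + b * dd (0, 1) uu (q, x))) (at x)"
    by (intro DERIV_diff DERIV_const DERIV_cmult DERIV_add DV DU)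
  then have 3: "((\<lambda>x. dirY q h x $ 3) has_real_derivative - (fst h $ 4 * (W.N x *v dirY q (0, 1) x) $ 3)) (at x)"
    unfolding NY3 by (simp add: dirY_def)
  have "((\<lambda>x. fst h $ 3 - fst h $ 4 * (b * vv (q, x))) has_real_derivative
      0 - fst h $ 4 * (b * dd (0, 1) vv (q, x))) (at x)"
    by (intro DERIV_diff DERIV_const DERIV_cmult DV)
  then have 4: "((\<lambda>x. dirY q h x $ 4) has_real_derivative - (fst h $ 4 * (W.N x *v dirY q (0, 1) x) $ 4)) (at x)"
    unfolding NY4 by (simp add: dirY_def)
  have N12: "(W.N x *v dirY q (0, 1) x) $ 1 = 0" "(W.N x *v dirY q (0, 1) x) $ 2 = 0"
    by (simp_all add: W.N_mult)
  show ?thesis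
    unfolding has_vector_derivative_vec_iff forall_4 has_real_derivative_iff_has_vector_derivative[symmetric]
      vector_minus_component vector_scaleR_component W.M_mult vector_4 N12
    using 1 2 3 4 by simp
qed

text \<open>Both identities differentiate \<open>f (q, x + \<Xi> q) = f (q, x)\<close>. The period
  moves with the parameters, so parameter derivatives of the profile jump by a multiple of its
  x-derivative.\<close>

lemma period_shift:
  fixes f :: "(real ^ 4) \<times> real \<Rightarrow> real"
  assumes f: "smooth_on DD f" and per: "\<And>q x. q \<in> \<Omega> \<Longrightarrow> f (q, x + \<Xi> q) = f (q, x)" and q: "q \<in> \<Omega>"
  shows "dd (0, 1) f (q, x + \<Xi> q) = dd (0, 1) f (q, x)" (is ?x)
    and "dd (h, 0) f (q, x + \<Xi> q) - dd (h, 0) f (q, x) = - dd h \<Xi> q * dd (0, 1) f (q, x)" (is ?h)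
proof -
  have fd: "f differentiable (at (q', y))" if "q' \<in> \<Omega>" for q' y
    by (rule smooth_on_imp_differentiable[OF f]) (use that in simp)
  have "((\<lambda>x. f (q, x + \<Xi> q)) has_real_derivative dd (0, 1) f (q, x + \<Xi> q)) (at x)"
    using smooth_deriv_x[OF f q, of "x + \<Xi> q"]
      DERIV_shift[of "\<lambda>x. f (q, x)" "dd (0, 1) f (q, x + \<Xi> q)" x "\<Xi> q"] by blast
  then show ?x
    unfolding per[OF q] using smooth_deriv_x[OF f q] DERIV_unique by blast
  obtain \<delta> where \<delta>: "\<delta> > 0" and line: "\<And>s. s \<in> {-\<delta>..\<delta>} \<Longrightarrow> q + s *\<^sub>R h \<in> \<Omega>"
    by (rule line_in_open[OF \<Omega> q]) (rule that)
  have D\<Xi>: "((\<lambda>s. \<Xi> (q + s *\<^sub>R h)) has_real_derivative dd h \<Xi> q) (at 0)"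
    using dd_line[of \<Xi> q 0 h] smooth_on_imp_differentiable[OF \<Xi> q] by simp
  have "((\<lambda>s. (q + s *\<^sub>R h, x + \<Xi> (q + s *\<^sub>R h))) has_vector_derivative (h, 0 + dd h \<Xi> q)) (at 0)"
    by (intro has_vector_derivative_Pair' line_deriv has_vector_derivative_add has_vector_derivative_const)
       (use D\<Xi> in \<open>simp add: has_real_derivative_iff_has_vector_derivative\<close>)
  from dd_path_real[OF _ this, of f] fd[OF q]
  have 1: "((\<lambda>s. f (q + s *\<^sub>R h, x + \<Xi> (q + s *\<^sub>R h))) has_real_derivative dd (h, dd h \<Xi> q) f (q, x + \<Xi> q)) (at 0)"
    by simp
  have "((\<lambda>s. (q + s *\<^sub>R h, x)) has_vector_derivative (h, 0)) (at 0)"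
    by (intro has_vector_derivative_Pair' line_deriv has_vector_derivative_const)
  from dd_path_real[OF _ this, of f] fd[OF q]
  have "((\<lambda>s. f (q + s *\<^sub>R h, x)) has_real_derivative dd (h, 0) f (q, x)) (at 0)"
    by simp
  then have "((\<lambda>s. f (q + s *\<^sub>R h, x + \<Xi> (q + s *\<^sub>R h))) has_real_derivative dd (h, 0) f (q, x)) (at 0)"
  proof (rule has_field_derivative_transform_within_open[OF _ open_greaterThanLessThan[of "-\<delta>" \<delta>]])
    show "f (q + s *\<^sub>R h, x) = f (q + s *\<^sub>R h, x + \<Xi> (q + s *\<^sub>R h))" if "s \<in> {-\<delta><..<\<delta>}" for s
      by (rule per[OF line, symmetric]) (use that in simp)
  qed (use \<delta> in simp)
  with 1 have "dd (h, dd h \<Xi> q) f (q, x + \<Xi> q) = dd (h, 0) f (q, x)"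
    by (rule DERIV_unique)
  then show ?h
    using dd_pair[OF fd[OF q, of "x + \<Xi> q"], of h "dd h \<Xi> q"] unfolding \<open>?x\<close> by simp
qed

lemma profile_periodic:
  assumes "q \<in> \<Omega>"
  shows "vv (q, x + \<Xi> q) = vv (q, x)" "uu (q, x + \<Xi> q) = uu (q, x)"
    "vx (q, x + \<Xi> q) = vx (q, x)" "pp (q, x + \<Xi> q) = pp (q, x)"
proof -
  show v: "vv (q, x + \<Xi> q) = vv (q, x)" and u: "uu (q, x + \<Xi> q) = uu (q, x)"
    by (simp_all add: vv_def uu_def U_per[OF assms])
  have "vv (q, x + \<Xi> q) = vv (q, x)" if "q \<in> \<Omega>" for q x
    by (simp add: vv_def U_per[OF that])
  from period_shift(1)[OF smooth_profile(1) this assms]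
  show vx: "vx (q, x + \<Xi> q) = vx (q, x)" unfolding vx_def .
  show "pp (q, x + \<Xi> q) = pp (q, x)" by (simp add: pp_def v vx)
qed

lemma wave_family:
  assumes q: "q \<in> \<Omega>"
  shows "wave_family (kk q) (ll q) (d1 q) (d2 q) (d3 q) (d4 q) (d5 q) b (\<Xi> q) a (\<lambda>x. vv (q, x)) (\<lambda>x. uu (q, x))
    (dirY q (0, 1)) (\<lambda>j. dirY q (axis j 1, 0)) (\<lambda>j. dd (axis j 1) \<Xi> q)"
proof -
  interpret W: wave_system "kk q" "ll q" "d1 q" "d2 q" "d3 q" "d4 q" "d5 q" b "\<Xi> q"
    by (rule wave_system[OF q])
  have z: "(q, x) \<in> DD" for x using q by simp
  show ?thesis
  proof
    show "d3 q x = - d1 q x" for x by (simp add: d3_def d1_def)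
    show "b * d5 q x = a - b * d4 q x" for x using b_nz by (simp add: d5_def d4_def field_simps)
    show "((\<lambda>x. vv (q, x)) has_real_derivative dirY q (0, 1) x $ 1) (at x)" for x
      using smooth_deriv_x[OF smooth_profile(1) q, of x] by (simp add: dirY_def)
    show "((\<lambda>x. uu (q, x)) has_real_derivative - d4 q x * dirY q (0, 1) x $ 1) (at x)" for x
      using smooth_deriv_x[OF smooth_profile(2) q, of x] unfolding dd_uu[OF q] by (simp add: dirY_def)
    show "W.sol 0 (dirY q (0, 1))"
      unfolding W.sol_def using dirY_deriv[OF q, of "(0, 1)"] by simp
    show "(dirY q (axis j 1, 0) has_vector_derivative W.M 0 x *v dirY q (axis j 1, 0) x
        - (if j = 4 then W.N x *v dirY q (0, 1) x else 0)) (at x)" for j x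
      using dirY_deriv[OF q, of "(axis j 1, 0)" x] by (auto simp: axis_def)
    show "vv (q, \<Xi> q) = vv (q, 0)" "uu (q, \<Xi> q) = uu (q, 0)"
      using profile_periodic[OF q, of 0] by simp_all
    show "dirY q (0, 1) (\<Xi> q) = dirY q (0, 1) 0"
      using period_shift(1)[OF smooth_profile(1) profile_periodic(1) q, of 0]
        period_shift(1)[OF smooth_profile(4) profile_periodic(4) q, of 0] by (simp add: dirY_def)
    show "dirY q (axis j 1, 0) (\<Xi> q) $ 1 - dirY q (axis j 1, 0) 0 $ 1 = - dd (axis j 1) \<Xi> q * dirY q (0, 1) 0 $ 1"
      "dirY q (axis j 1, 0) (\<Xi> q) $ 2 - dirY q (axis j 1, 0) 0 $ 2 = - dd (axis j 1) \<Xi> q * dirY q (0, 1) 0 $ 2" for j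
      using period_shift(2)[OF smooth_profile(1) profile_periodic(1) q, of "axis j 1" 0]
        period_shift(2)[OF smooth_profile(4) profile_periodic(4) q, of "axis j 1" 0] by (simp_all add: dirY_def)
    \<comment> \<open>The energy relation differentiated in \<mu>, where the right-hand side is 1
      and the remaining parameter terms vanish.\<close>
    show "dirY q (0, 1) 0 $ 1 * dirY q (axis 1 1, 0) 0 $ 2 - dirY q (0, 1) 0 $ 2 * dirY q (axis 1 1, 0) 0 $ 1 = 1"
      using dd_profile_energy[OF z, of 0 "(axis 1 1, 0)"] by (simp add: dirY_def vx_def axis_def)
  qed (auto simp: dirY_def axis_def)
qed

end

section \<open>Hessian of the action\<close>

lemma smooth_on_cmult: "open S \<Longrightarrow> smooth_on S f \<Longrightarrow> smooth_on S (\<lambda>x. c * f x :: real)"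
  by (rule smooth_on_mult[OF _ smooth_on_const])

lemma smooth_on_diff_real:
  fixes f g :: "'a::real_normed_vector \<Rightarrow> real"
  assumes "open S" "smooth_on S f" "smooth_on S g"
  shows "smooth_on S (\<lambda>x. f x - g x)"
  using smooth_on_add[OF assms(1,2) smooth_on_cmult[OF assms(1,3), of "- 1"]] by simp

context profile_family begin

abbreviation "\<Theta> \<equiv> action B (hamiltonian I E) U \<Xi>"
abbreviation "Hess\<Theta> \<equiv> hessian_matrix \<Theta>"

definition lagrangian :: "(real ^ 4) \<times> real \<Rightarrow> real" where
  "lagrangian z = I (vv z, uu z) + E (vv z, vx z) + fst z $ 4 * (a / 2 * (vv z * vv z) + b * (vv z * uu z))
     - fst z $ 2 * vv z - fst z $ 3 * uu z + fst z $ 1"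

text \<open>The explicit derivative of \<open>lagrangian\<close> in the \<open>j\<close>-th
  parameter, with the profile held fixed.\<close>

definition dens :: "4 \<Rightarrow> (real ^ 4) \<times> real \<Rightarrow> real" where
  "dens j z = (if j = 1 then 1 else if j = 2 then - vv z else if j = 3 then - uu z
     else a / 2 * (vv z * vv z) + b * (vv z * uu z))"

lemma smooth_coord: "smooth_on DD (\<lambda>z. fst z $ i)"
  by (intro smooth_on_linear bounded_linear_compose[OF bounded_linear_vec_nth] bounded_linear_fst)

lemma smooth_lagrangian: "smooth_on DD lagrangian"
  unfolding lagrangian_def[abs_def]
  by (intro smooth_on_add[OF open_DD] smooth_on_diff_real[OF open_DD] smooth_on_mult[OF open_DD] smooth_on_const smooth_coord
      smooth_on_compose2[OF open_DD I smooth_profile(1,2)] smooth_on_compose2[OF open_DD E smooth_profile(1,3)] smooth_profile)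

lemma smooth_dens: "smooth_on DD (dens j)"
proof -
  have u: "smooth_on DD (\<lambda>z. - uu z)" and v: "smooth_on DD (\<lambda>z. - vv z)"
    using smooth_on_cmult[OF open_DD smooth_profile(1), of "- 1"] smooth_on_cmult[OF open_DD smooth_profile(2), of "- 1"]
    by simp_all
  have "smooth_on DD (\<lambda>z. a / 2 * (vv z * vv z) + b * (vv z * uu z))"
    by (intro smooth_on_add[OF open_DD] smooth_on_mult[OF open_DD] smooth_on_const smooth_profile)
  with u v smooth_on_const[of DD 1] show ?thesis
    unfolding dens_def[abs_def] by (cases "j = 1"; cases "j = 2"; cases "j = 3"; simp)
qed

lemma action_eq:
  assumes "q \<in> \<Omega>"
  shows "\<Theta> q = integral {0..\<Xi> q} (\<lambda>x. lagrangian (q, x))"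
  unfolding action_def hamiltonian_eq
  by (intro integral_cong)
     (simp add: K_def jet_eq(2-4)[OF assms] impulse_eq lagrangian_def par_c_def par_mu_def par_lambda_def
       inner_vec_def sum_2 vv_def uu_def)

text \<open>The action is therefore the integral of \<open>\<pi> dv\<close> over one period, and the
  boundary term from the moving period is known.\<close>

lemma lagrangian_eq: "z \<in> DD \<Longrightarrow> lagrangian z = vx z * pp z"
  using profile_energy[of z] unfolding lagrangian_def by simp

text \<open>The profile is critical, so its variation contributes only the total derivative of
  \<open>\<pi>\<close> times the variation of \<open>v\<close>; the rest is the explicit dependence
  on the parameter.\<close>

lemma dd_lagrangian:
  assumes z: "z \<in> DD"
  shows "dd (axis j 1, 0) lagrangian z = (pp z * dd (0, 1) (dd (axis j 1, 0) vv) z + dd (0, 1) pp z * dd (axis j 1, 0) vv z) + dens j z"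
proof -
  let ?h = "(axis j 1, 0) :: (real ^ 4) \<times> real"
  have D: "(lagrangian has_derivative (\<lambda>h. (I1 (vv z, uu z) * dd h vv z + I2 (vv z, uu z) * dd h uu z)
      + (E1 (vv z, vx z) * dd h vv z + E2 (vv z, vx z) * dd h vx z)
      + (fst z $ 4 * (a / 2 * (vv z * dd h vv z + dd h vv z * vv z) + b * (vv z * dd h uu z + dd h vv z * uu z))
        + fst h $ 4 * (a / 2 * (vv z * vv z) + b * (vv z * uu z)))
      - (fst z $ 2 * dd h vv z + fst h $ 2 * vv z) - (fst z $ 3 * dd h uu z + fst h $ 3 * uu z) + fst h $ 1)) (at z)"
    unfolding lagrangian_def[abs_def]
    by (intro has_derivative_diff has_derivative_add has_derivative_mult has_derivative_mult_right
          compose2_smooth[OF _ _ _ z] I E smooth_profile coord_deriv profile_deriv z)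
  have "dens j z = fst ?h $ 4 * (a / 2 * (vv z * vv z) + b * (vv z * uu z)) - fst ?h $ 2 * vv z - fst ?h $ 3 * uu z + fst ?h $ 1"
    using exhaust_4[of j] by (auto simp: dens_def axis_def)
  moreover have "dd (0, 1) pp z * dd ?h vv z = (I1 (vv z, uu z) + E1 (vv z, vx z) + fst z $ 4 * (a * vv z + b * uu z) - fst z $ 2) * dd ?h vv z"
    using profile_eq_v[OF z] by simp
  moreover have "I2 (vv z, uu z) * dd ?h uu z = (fst z $ 3 - fst z $ 4 * (b * vv z)) * dd ?h uu z"
    by (rule arg_cong[where f = "\<lambda>t. t * dd ?h uu z"]) (use profile_eq_u[OF z] in simp)
  ultimately show ?thesis
    unfolding dd_eqI[OF D] dd_vx[OF z] pp_def[symmetric] by (simp add: algebra_simps)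
qed

lemma period_derivative:
  assumes q: "q \<in> \<Omega>" and f: "smooth_on DD f"
  shows "pd h (\<lambda>q. integral {0..\<Xi> q} (\<lambda>x. f (q, x))) q
    = dd h \<Xi> q * f (q, \<Xi> q) + integral {0..\<Xi> q} (\<lambda>x. dd (h, 0) f (q, x))"
  unfolding pd_def by (rule DERIV_imp_deriv[OF leibniz_moving[OF \<Omega> q f \<Xi> \<Xi>_pos]])

lemma pd_cong_open:
  assumes "q \<in> \<Omega>" "\<And>q. q \<in> \<Omega> \<Longrightarrow> f q = g q"
  shows "pd h f q = pd h g q"
proof -
  obtain \<delta> where \<delta>: "\<delta> > 0" and line: "\<And>s. s \<in> {-\<delta>..\<delta>} \<Longrightarrow> q + s *\<^sub>R h \<in> \<Omega>"
    by (rule line_in_open[OF \<Omega> assms(1)]) (rule that)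
  have "\<forall>\<^sub>F s in nhds 0. f (q + s *\<^sub>R h) = g (q + s *\<^sub>R h)"
    unfolding eventually_nhds_metric
    by (intro exI[of _ \<delta>]) (use \<delta> in \<open>auto intro!: assms(2) line simp: dist_real_def\<close>)
  then show ?thesis
    unfolding pd_def by (rule deriv_cong_ev) simp
qed

text \<open>The total derivative integrates to \<open>- v_x \<pi>\<close> times the derivative of
  the period, because the variation of \<open>v\<close> jumps. This cancels the contribution of the
  moving end, since \<open>lagrangian\<close> equals \<open>v_x \<pi>\<close>.\<close>

lemma gradient_action:
  assumes q: "q \<in> \<Omega>"
  shows "pd (axis j 1) \<Theta> q = integral {0..\<Xi> q} (\<lambda>x. dens j (q, x))"
proof -
  let ?h = "(axis j 1, 0) :: (real ^ 4) \<times> real"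
  have z: "(q, x) \<in> DD" for x using q by simp
  have D: "((\<lambda>x. pp (q, x) * dd ?h vv (q, x)) has_real_derivative
      pp (q, x) * dd (0, 1) (dd ?h vv) (q, x) + dd (0, 1) pp (q, x) * dd ?h vv (q, x)) (at x)" for x
    by (intro DERIV_mult' smooth_deriv_x[OF _ q] smooth_profile smooth_on_dd)
  have c: "continuous_on {0..\<Xi> q} (\<lambda>x. pp (q, x) * dd (0, 1) (dd ?h vv) (q, x) + dd (0, 1) pp (q, x) * dd ?h vv (q, x))"
    by (intro continuous_on_add continuous_on_mult smooth_continuous_x[OF _ q] smooth_profile smooth_on_dd)
  have "pd (axis j 1) \<Theta> q
      = dd (axis j 1) \<Xi> q * lagrangian (q, \<Xi> q) + integral {0..\<Xi> q} (\<lambda>x. dd ?h lagrangian (q, x))"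
    using pd_cong_open[OF q action_eq] period_derivative[OF q smooth_lagrangian] by simp
  also have "integral {0..\<Xi> q} (\<lambda>x. dd ?h lagrangian (q, x))
      = integral {0..\<Xi> q} (\<lambda>x. pp (q, x) * dd (0, 1) (dd ?h vv) (q, x) + dd (0, 1) pp (q, x) * dd ?h vv (q, x))
        + integral {0..\<Xi> q} (\<lambda>x. dens j (q, x))"
    unfolding dd_lagrangian[OF z]
    by (rule Henstock_Kurzweil_Integration.integral_add[OF integrable_continuous_real[OF c]
          integrable_continuous_real[OF smooth_continuous_x[OF smooth_dens q]]])
  also have "integral {0..\<Xi> q} (\<lambda>x. pp (q, x) * dd (0, 1) (dd ?h vv) (q, x) + dd (0, 1) pp (q, x) * dd ?h vv (q, x))
      = pp (q, \<Xi> q) * dd ?h vv (q, \<Xi> q) - pp (q, 0) * dd ?h vv (q, 0)"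
    by (rule integral_DERIV[OF D]) (use \<Xi>_pos[OF q] in simp)
  also have "\<dots> = - dd (axis j 1) \<Xi> q * (vx (q, 0) * pp (q, 0))"
  proof -
    have "dd ?h vv (q, \<Xi> q) = dd ?h vv (q, 0) - dd (axis j 1) \<Xi> q * vx (q, 0)"
      using period_shift(2)[OF smooth_profile(1) profile_periodic(1) q, of "axis j 1" 0] by (simp add: vx_def)
    moreover have "pp (q, \<Xi> q) = pp (q, 0)"
      using profile_periodic(4)[OF q, of 0] by simp
    ultimately show ?thesis
      by (simp only:) (simp add: algebra_simps)
  qed
  finally show ?thesis
    using profile_periodic(3,4)[OF q, of 0] lagrangian_eq[OF z, of "\<Xi> q"] by simp
qed

lemma hessian_action:
  assumes q: "q \<in> \<Omega>"
  shows "Hess\<Theta> q $ i $ j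
    = dd (axis i 1) \<Xi> q * dens j (q, 0) + integral {0..\<Xi> q} (\<lambda>x. dd (axis i 1, 0) (dens j) (q, x))"
proof -
  have "dens j (q, \<Xi> q) = dens j (q, 0)"
    using profile_periodic[OF q, of 0] by (simp add: dens_def)
  then show ?thesis
    unfolding hessian_matrix_def
    using pd_cong_open[OF q gradient_action] period_derivative[OF q smooth_dens[of j], of "axis i 1"] by simp
qed

definition DT :: "real ^ 4 \<Rightarrow> real \<Rightarrow> real" where
  "DT q r = wave_system.Dt (kk q) (ll q) (d1 q) (d2 q) (d3 q) (d4 q) (d5 q) b r (\<Xi> q)"

lemma DT_limit:
  assumes q: "q \<in> \<Omega>"
  shows "((\<lambda>r. DT q r / r ^ 4) \<longlongrightarrow> b\<^sup>2 * det (Hess\<Theta> q)) (at 0)"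
proof -
  interpret F: wave_family "kk q" "ll q" "d1 q" "d2 q" "d3 q" "d4 q" "d5 q" b "\<Xi> q" a "\<lambda>x. vv (q, x)" "\<lambda>x. uu (q, x)"
    "dirY q (0, 1)" "\<lambda>j. dirY q (axis j 1, 0)" "\<lambda>j. dd (axis j 1) \<Xi> q"
    by (rule wave_family[OF q])
  define s1 where "s1 j = integral {0..\<Xi> q} (\<lambda>x. dd (axis j 1, 0) vv (q, x))" for j :: 4
  define s2 where "s2 j = integral {0..\<Xi> q} (\<lambda>x. dd (axis j 1, 0) uu (q, x))" for j :: 4
  have z: "(q, x) \<in> DD" for x using q by simp
  have NY3: "(F.N x *v dirY q (axis j 1, 0) x) $ 3 = a * dd (axis j 1, 0) vv (q, x) + b * dd (axis j 1, 0) uu (q, x)" for j x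
    unfolding F.N_mult vector_4 N_dirY[OF q] ..
  have NY4: "(F.N x *v dirY q (axis j 1, 0) x) $ 4 = b * dd (axis j 1, 0) vv (q, x)" for j x
    unfolding F.N_mult by (simp add: dirY_def)
  have int: "(\<lambda>x. c * dd h vv (q, x)) integrable_on {0..\<Xi> q}" "(\<lambda>x. c * dd h uu (q, x)) integrable_on {0..\<Xi> q}" for c h
    by (intro integrable_continuous_real continuous_on_mult continuous_on_const smooth_continuous_x[OF _ q] smooth_on_dd smooth_profile)+
  have r3: "F.row3 (dirY q (axis j 1, 0)) = a * s1 j + b * s2 j" for j
    unfolding F.row3_def NY3 s1_def s2_def
    by (simp add: Henstock_Kurzweil_Integration.integral_add[OF int])
  have r4: "F.row4 (dirY q (axis j 1, 0)) = b * s1 j" for j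
    unfolding F.row4_def NY4 s1_def by simp
  have dens4: "dd (axis j 1, 0) (dens 4) (q, x) = vv (q, x) * (F.N x *v dirY q (axis j 1, 0) x) $ 3
      + uu (q, x) * (F.N x *v dirY q (axis j 1, 0) x) $ 4" for j x
  proof -
    have "dens 4 = (\<lambda>z. a / 2 * (vv z * vv z) + b * (vv z * uu z))"
      by (auto simp: dens_def)
    moreover have "((\<lambda>z. a / 2 * (vv z * vv z) + b * (vv z * uu z)) has_derivative
        (\<lambda>h. a / 2 * (vv (q, x) * dd h vv (q, x) + dd h vv (q, x) * vv (q, x))
          + b * (vv (q, x) * dd h uu (q, x) + dd h vv (q, x) * uu (q, x)))) (at (q, x))"
      by (intro has_derivative_add has_derivative_mult_right has_derivative_mult profile_deriv z)
    ultimately show ?thesis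
      unfolding NY3 NY4 by (simp add: dd_eqI algebra_simps)
  qed
  have r2: "F.row2 (dirY q (axis j 1, 0)) = integral {0..\<Xi> q} (\<lambda>x. dd (axis j 1, 0) (dens 4) (q, x))" for j
    unfolding F.row2_def dens4 ..
  have dens1: "dd h (dens 1) (q, x) = 0" for h x
    using dd_eqI[OF has_derivative_const[of "1::real" "at (q, x)"], of h] by (simp add: dens_def[abs_def])
  have dens2: "dd h (dens 2) (q, x) = - dd h vv (q, x)" for h x
    using dd_eqI[OF has_derivative_minus[OF profile_deriv(1)[OF z]], of h] by (simp add: dens_def[abs_def])
  have dens3: "dd h (dens 3) (q, x) = - dd h uu (q, x)" for h x
    using dd_eqI[OF has_derivative_minus[OF profile_deriv(2)[OF z]], of h] by (simp add: dens_def[abs_def])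
  let ?J = "(\<chi> i j. if i = 1 then dd (axis j 1) \<Xi> q
    else if i = 2 then - (s1 j + dd (axis j 1) \<Xi> q * vv (q, 0)) else if i = 3 then - (s2 j + dd (axis j 1) \<Xi> q * uu (q, 0))
    else F.row2 (dirY q (axis j 1, 0)) + dd (axis j 1) \<Xi> q * dens 4 (q, 0)) :: real ^ 4 ^ 4"
  have "Hess\<Theta> q $ j $ i = ?J $ i $ j" for i j
    unfolding hessian_action[OF q] r2 s1_def s2_def
    using exhaust_4[of i] by (auto simp: dens1 dens2 dens3) (simp_all add: dens_def)
  \<comment> \<open>The gradient components index the rows of \<open>?J\<close> but the columns of
    the Hessian as defined; the determinant does not distinguish the two.\<close>
  then have "Hess\<Theta> q = transpose ?J"
    by (simp add: vec_eq_iff transpose_def)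
  then have "det (Hess\<Theta> q) = det ?J"
    by (simp only: det_transpose)
  then show ?thesis
    using F.Dt_limit_hessian[of s1 s2 "dens 4 (q, 0)", OF r3 r4] unfolding DT_def by (simp only:)
qed

end

section \<open>The eigenvalue equation\<close>

text \<open>The derivative is an explicit argument, so that this relation can stand for
  \<open>R\<close> in \<open>lin_graph_of_solution\<close>. Periodicity of \<open>f'\<close> follows
  from that of \<open>f\<close>.\<close>

definition C1_per :: "real \<Rightarrow> (real \<Rightarrow> real) \<Rightarrow> (real \<Rightarrow> real) \<Rightarrow> bool" where
  "C1_per X f f' \<longleftrightarrow> (\<forall>x. (f has_real_derivative f' x) (at x)) \<and> continuous_on UNIV f' \<and> (\<forall>x. f (x + X) = f x)"

lemma C1_perD:
  assumes "C1_per X f f'"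
  shows "(f has_real_derivative f' x) (at x)" "continuous_on S f'" "continuous_on S f" "f (x + X) = f x" "f' (x + X) = f' x"
proof -
  show D: "(f has_real_derivative f' x) (at x)" for x
    using assms by (simp add: C1_per_def)
  show per: "f (x + X) = f x" for x
    using assms by (simp add: C1_per_def)
  show "continuous_on S f'"
    using assms continuous_on_subset unfolding C1_per_def by blast
  show "continuous_on S f"
    by (intro continuous_at_imp_continuous_on ballI DERIV_isCont[OF D])
  have "((\<lambda>x. f (x + X)) has_real_derivative f' (x + X)) (at x)"
    using D[of "x + X"] DERIV_shift[of f "f' (x + X)" x X] by blast
  then show "f' (x + X) = f' x"
    unfolding per using D DERIV_unique by blast
qed

lemma C1_per_const: "C1_per X (\<lambda>x. c) (\<lambda>x. 0)"
  by (simp add: C1_per_def)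

lemma C1_per_mult:
  assumes f: "C1_per X f f'" and g: "C1_per X g g'"
  shows "C1_per X (\<lambda>x. f x * g x) (\<lambda>x. f x * g' x + f' x * g x)"
  unfolding C1_per_def
  by (intro conjI allI DERIV_mult' continuous_on_add continuous_on_mult C1_perD(1-3)[OF f] C1_perD(1-3)[OF g])
     (simp add: C1_perD(4)[OF f] C1_perD(4)[OF g])

lemma C1_per_diff:
  assumes f: "C1_per X f f'" and g: "C1_per X g g'"
  shows "C1_per X (\<lambda>x. f x - g x) (\<lambda>x. f' x - g' x)"
  unfolding C1_per_def
  by (intro conjI allI DERIV_diff continuous_on_diff C1_perD(1-3)[OF f] C1_perD(1-3)[OF g])
     (simp add: C1_perD(4)[OF f] C1_perD(4)[OF g])

lemma C1_per_inverse:
  assumes f: "C1_per X f f'" and nz: "\<And>x. f x \<noteq> 0"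
  shows "C1_per X (\<lambda>x. 1 / f x) (\<lambda>x. - (f' x / (f x * f x)))"
  unfolding C1_per_def
proof (intro conjI allI)
  show "((\<lambda>x. 1 / f x) has_real_derivative - (f' x / (f x * f x))) (at x)" for x
    using DERIV_inverse_fun[OF C1_perD(1)[OF f, of x] nz[of x]] nz[of x]
    by (simp add: inverse_eq_divide mult_ac power2_eq_square)
  show "continuous_on UNIV (\<lambda>x. - (f' x / (f x * f x)))"
    by (intro continuous_on_minus continuous_on_divide continuous_on_mult C1_perD(2,3)[OF f]) (use nz in auto)
qed (simp add: C1_perD(4)[OF f])

definition cvec :: "(real \<Rightarrow> real) \<Rightarrow> (real \<Rightarrow> real) \<Rightarrow> real \<Rightarrow> complex ^ 2" where
  "cvec f g x = vector [complex_of_real (f x), complex_of_real (g x)]"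

lemma cvec_nth [simp]: "cvec f g x $ 1 = of_real (f x)" "cvec f g x $ 2 = of_real (g x)"
  by (simp_all add: cvec_def)

lemma cvec_deriv:
  assumes "(f has_real_derivative f' x) (at x)" "(g has_real_derivative g' x) (at x)"
  shows "(cvec f g has_vector_derivative cvec f' g' x) (at x)"
  unfolding has_vector_derivative_vec_iff forall_2 cvec_nth
  using assms has_vector_derivative_of_real by blast

lemma cvec_continuous:
  assumes "continuous_on S f" "continuous_on S g"
  shows "continuous_on S (cvec f g)"
proof -
  have "continuous_on S (\<lambda>x. cvec f g x $ i)" for i
    using exhaust_2[of i] assms by (auto intro!: continuous_on_of_real)
  from continuous_on_vec_lambda[of S "\<lambda>i x. cvec f g x $ i", OF this] show ?thesis
    by simp
qed

text \<open>Integration by parts over one period; the boundary terms cancel because the test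
  function and \<open>cvec f g\<close> are both periodic.\<close>

lemma weak_deriv_cvec:
  assumes X: "X > 0" and f: "C1_per X f f'" and g: "C1_per X g g'"
  shows "weak_deriv_per X (cvec f g) (cvec f' g')"
proof -
  have cont: "continuous_on S (cvec f g)" "continuous_on S (cvec f' g')" for S
    by (rule cvec_continuous; rule C1_perD[OF f] C1_perD[OF g])+
  have L2: "h \<in> L2_per X" if "\<And>S. continuous_on S h" "\<And>x. h (x + X) = h x" for h :: "real \<Rightarrow> complex ^ 2"
    unfolding L2_per_def mem_Collect_eq
    by (intro conjI allI that borel_measurable_continuous_onI borel_integrable_atLeastAtMost' continuous_on_power continuous_on_norm)
  have per: "cvec f g (x + X) = cvec f g x" "cvec f' g' (x + X) = cvec f' g' x" for x
    by (simp_all add: cvec_def C1_perD[OF f] C1_perD[OF g])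
  have "(LINT x:{0..X}|lborel. deriv \<phi> x *\<^sub>R cvec f g x) = - (LINT x:{0..X}|lborel. \<phi> x *\<^sub>R cvec f' g' x)"
    if \<phi>: "smooth_on UNIV \<phi>" and \<phi>per: "\<And>x. \<phi> (x + X) = \<phi> x" for \<phi> :: "real \<Rightarrow> real"
  proof -
    have D\<phi>: "(\<phi> has_real_derivative dd 1 \<phi> x) (at x)" for x
      using dd_line[of \<phi> 0 x 1] smooth_on_imp_differentiable[OF \<phi>] by simp
    have deriv: "deriv \<phi> x = dd 1 \<phi> x" for x by (rule DERIV_imp_deriv[OF D\<phi>])
    have c\<phi>: "continuous_on S (dd 1 \<phi>)" "continuous_on S \<phi>" for S
      using smooth_on_imp_continuous[OF \<phi>] smooth_on_imp_continuous[OF smooth_on_dd[OF \<phi>]] continuous_on_subset by blast+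
    have c1: "continuous_on {0..X} (\<lambda>x. deriv \<phi> x *\<^sub>R cvec f g x)"
      unfolding deriv by (rule continuous_on_scaleR[OF c\<phi>(1) cont(1)])
    have c2: "continuous_on {0..X} (\<lambda>x. \<phi> x *\<^sub>R cvec f' g' x)"
      by (rule continuous_on_scaleR[OF c\<phi>(2) cont(2)])
    have D: "((\<lambda>x. \<phi> x *\<^sub>R cvec f g x) has_vector_derivative \<phi> x *\<^sub>R cvec f' g' x + deriv \<phi> x *\<^sub>R cvec f g x) (at x within {0..X})" for x
      unfolding deriv
      by (rule has_vector_derivative_at_within[OF has_vector_derivative_scaleR[OF D\<phi> cvec_deriv[OF C1_perD(1)[OF f] C1_perD(1)[OF g]]]])
    have "(LINT x:{0..X}|lborel. \<phi> x *\<^sub>R cvec f' g' x + deriv \<phi> x *\<^sub>R cvec f g x) = \<phi> X *\<^sub>R cvec f g X - \<phi> 0 *\<^sub>R cvec f g 0"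
      unfolding set_lebesgue_integral_def
      by (rule integral_FTC_atLeastAtMost[OF less_imp_le[OF X] D continuous_on_add[OF c2 c1]])
    also have "\<dots> = 0" using \<phi>per[of 0] per(1)[of 0] by simp
    finally have "(LINT x:{0..X}|lborel. \<phi> x *\<^sub>R cvec f' g' x) + (LINT x:{0..X}|lborel. deriv \<phi> x *\<^sub>R cvec f g x) = 0"
      using set_integral_add(2)[OF borel_integrable_atLeastAtMost'[OF c2] borel_integrable_atLeastAtMost'[OF c1]] by simp
    then show ?thesis by (simp add: add_eq_0_iff)
  qed
  then show ?thesis
    unfolding weak_deriv_per_def using L2[OF cont(1) per(1)] L2[OF cont(2) per(2)] by blast
qed

lemma cmat_mult: "cmat (A ** C) = cmat A ** cmat C"
  by (simp add: cmat_def matrix_matrix_mult_def vec_eq_iff)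

lemma cmat_one: "cmat (mat 1) = mat 1"
  by (simp add: cmat_def mat_def vec_eq_iff)

lemma det_cmat: "det (cmat A) = of_real (det A)"
  by (simp add: det_def cmat_def)

lemma cmat_diff: "cmat (A - C) = cmat A - cmat C"
  by (simp add: cmat_def vec_eq_iff)

context profile_family begin

text \<open>Reverses the elimination: \<open>s\<close> and \<open>w'\<close> are the
  \<open>u\<close>-component and the derivative of the \<open>v\<close>-component recovered from
  \<open>Y\<close>, and the identities restore the momentum, the two components of the variation and
  \<open>B^-1 W\<close>.\<close>

lemma coefficient_algebra:
  defines "s q x Y \<equiv> ll q x * Y $ 4 - d4 q x * Y $ 1"
    and "w' q x Y \<equiv> d1 q x * Y $ 1 + kk q x * Y $ 2"
  shows "ee q x * Y $ 1 + ka q x * w' q x Y = (Y :: real ^ 4) $ 2" "al q x * Y $ 1 + be q x * s q x Y = Y $ 4"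
    "mm q x * Y $ 1 + al q x * s q x Y + ee q x * w' q x Y = d2 q x * Y $ 1 + d3 q x * Y $ 2 + d4 q x * Y $ 4"
    "a * Y $ 1 + b * s q x Y = b * (d5 q x * Y $ 1 + ll q x * Y $ 4)"
proof -
  have nz: "ka q x \<noteq> 0" "be q x \<noteq> 0" using ka_pos[of q x] be_pos[of q x] by auto
  show "ee q x * Y $ 1 + ka q x * w' q x Y = Y $ 2" "al q x * Y $ 1 + be q x * s q x Y = Y $ 4"
    unfolding s_def w'_def kk_def ll_def d1_def d4_def using nz by (simp_all add: field_simps)
  show "mm q x * Y $ 1 + al q x * s q x Y + ee q x * w' q x Y = d2 q x * Y $ 1 + d3 q x * Y $ 2 + d4 q x * Y $ 4"
    by (simp add: s_def w'_def kk_def ll_def d1_def d2_def d3_def d4_def power2_eq_square algebra_simps diff_divide_distrib add_divide_distrib)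
  show "a * Y $ 1 + b * s q x Y = b * (d5 q x * Y $ 1 + ll q x * Y $ 4)"
    unfolding s_def d4_def d5_def using b_nz by (simp add: field_simps)
qed

abbreviation momentum :: "real ^ 4 \<Rightarrow> (real \<Rightarrow> complex ^ 2) \<Rightarrow> (real \<Rightarrow> complex ^ 2) \<Rightarrow> real \<Rightarrow> complex ^ 2" where
  "momentum q W W' x \<equiv> vector [of_real (ee q x) * W x $ 1 + of_real (ka q x) * W' x $ 1, 0]"

abbreviation variation :: "real ^ 4 \<Rightarrow> (real \<Rightarrow> complex ^ 2) \<Rightarrow> (real \<Rightarrow> complex ^ 2) \<Rightarrow> (real \<Rightarrow> complex ^ 2) \<Rightarrow> real \<Rightarrow> complex ^ 2" where
  "variation q W W' P' x \<equiv> vector [of_real (mm q x) * W x $ 1 + of_real (al q x) * W x $ 2 + of_real (ee q x) * W' x $ 1 - P' x $ 1,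
      of_real (al q x) * W x $ 1 + of_real (be q x) * W x $ 2 - P' x $ 2]"

lemma hess_coeffs:
  assumes q: "q \<in> \<Omega>"
  shows "hess_coeff dirU dirU (K (q $ 4)) (U q) x = cmat (vector [vector [mm q x, al q x], vector [al q x, be q x]])"
    "hess_coeff dirU dirX (K (q $ 4)) (U q) x = cmat (vector [vector [ee q x, 0], 0])"
    "hess_coeff dirX dirU (K (q $ 4)) (U q) x = cmat (vector [vector [ee q x, 0], 0])"
    "hess_coeff dirX dirX (K (q $ 4)) (U q) x = cmat (vector [vector [ka q x, 0], 0])"
  unfolding hess_coeff_def
  by (rule arg_cong[where f = cmat],
      simp add: vec_eq_iff forall_2 pd2_K coords_dir jet_eq(2-4)[OF q] mm_def al_def be_def ee_def ka_def)+

lemma lin_graph_iff: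
  assumes q: "q \<in> \<Omega>"
  shows "lin_graph der B (K (q $ 4)) (U q) W F \<longleftrightarrow> (\<exists>W' P' G'. der W W' \<and>
    der (\<lambda>x. momentum q W W' x) P' \<and>
    der (\<lambda>x. variation q W W' P' x) G' \<and> F = (\<lambda>x. cmat B *v G' x))"
proof -
  have 1: "hess_coeff dirX dirU (K (q $ 4)) (U q) x *v W x + hess_coeff dirX dirX (K (q $ 4)) (U q) x *v W' x
      = momentum q W W' x" for x W'
    by (simp add: hess_coeffs[OF q] vec_eq_iff forall_2 matrix_vector_mult_def sum_2 cmat_def)
  have 2: "hess_coeff dirU dirU (K (q $ 4)) (U q) x *v W x + hess_coeff dirU dirX (K (q $ 4)) (U q) x *v W' x - P' x
      = variation q W W' P' x" for x W' P'
    by (simp add: hess_coeffs[OF q] vec_eq_iff forall_2 matrix_vector_mult_def sum_2 cmat_def)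
  show ?thesis
    unfolding lin_graph_def hess_graph_def 1 2 by blast
qed

text \<open>The notion of derivative is left open because the lemma serves twice: with the classical
  derivative for the columns of the fundamental matrix, and with the weak one for the eigenfunction
  in \<open>L^2\<close>.\<close>

lemma lin_graph_of_solution:
  fixes Y :: "real \<Rightarrow> real ^ 4"
  assumes q: "q \<in> \<Omega>" and inv: "B ** matrix_inv B = mat 1"
    and der: "\<And>f f' g g'. R f f' \<Longrightarrow> R g g' \<Longrightarrow> der (cvec f g) (cvec f' g')"
    and R: "R (\<lambda>x. Y x $ 1) (\<lambda>x. dw q x (Y x))"
      "R (\<lambda>x. du q x (Y x)) s'"
      "R (\<lambda>x. Y x $ 2) (\<lambda>x. dP q x (Y x))"
      "R (\<lambda>x. 0) (\<lambda>x. 0)"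
      "R (\<lambda>x. Y x $ 3) (\<lambda>x. r * b * N3 q x (Y x))"
      "R (\<lambda>x. Y x $ 4) (\<lambda>x. r * b * Y x $ 1)"
  shows "lin_graph der B (K (q $ 4)) (U q) (cvec (\<lambda>x. Y x $ 1) (\<lambda>x. du q x (Y x)))
    (\<lambda>x. of_real r *s cvec (\<lambda>x. Y x $ 1) (\<lambda>x. du q x (Y x)) x)"
proof -
  note alg = coefficient_algebra[where q = q and Y = "Y x" for x]
  let ?W = "cvec (\<lambda>x. Y x $ 1) (\<lambda>x. du q x (Y x))"
  let ?W' = "cvec (\<lambda>x. dw q x (Y x)) s'"
  let ?P' = "cvec (\<lambda>x. dP q x (Y x)) (\<lambda>x. 0)"
  let ?G' = "cvec (\<lambda>x. r * b * N3 q x (Y x)) (\<lambda>x. r * b * Y x $ 1)"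
  have P: "(\<lambda>x. momentum q ?W ?W' x) = cvec (\<lambda>x. Y x $ 2) (\<lambda>x. 0)"
    using alg(1) unfolding cvec_nth of_real_mult[symmetric] of_real_add[symmetric] by (auto simp: cvec_def)
  have G: "(\<lambda>x. variation q ?W ?W' ?P' x) = cvec (\<lambda>x. Y x $ 3) (\<lambda>x. Y x $ 4)"
    using alg(2,3) unfolding cvec_nth of_real_mult[symmetric] of_real_add[symmetric] of_real_diff[symmetric]
    by (auto simp: cvec_def)
  have F: "cmat B *v ?G' x = of_real r *s ?W x" for x
  proof -
    have "r * b * N3 q x (Y x) = r * (a * Y x $ 1 + b * (du q x (Y x)))"
      unfolding alg(4)[of x] by simp
    also have "\<dots> = a * (r * Y x $ 1) + b * (r * (du q x (Y x)))"
      by (simp add: algebra_simps)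
    finally have "?G' x = cmat (matrix_inv B) *v (of_real r *s ?W x)"
      unfolding B by (simp add: vec_eq_iff forall_2 matrix_vector_mult_def sum_2 cmat_def mult_ac)
    then have "cmat B *v ?G' x = cmat (B ** matrix_inv B) *v (of_real r *s ?W x)"
      by (simp add: matrix_vector_mul_assoc cmat_mult)
    then show ?thesis by (simp add: inv cmat_one)
  qed
  show ?thesis
    unfolding lin_graph_iff[OF q]
    by (rule exI[of _ ?W'], rule exI[of _ ?P'], rule exI[of _ ?G'], unfold P G F)
       (intro conjI der R refl)
qed

lemma C1_per_compose:
  fixes F :: "real \<times> real \<Rightarrow> real" and f g :: "(real ^ 4) \<times> real \<Rightarrow> real"
  assumes "smooth_on UNIV F" "smooth_on DD f" "smooth_on DD g" and q: "q \<in> \<Omega>"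
    and "\<And>x. f (q, x + \<Xi> q) = f (q, x)" "\<And>x. g (q, x + \<Xi> q) = g (q, x)"
  shows "C1_per (\<Xi> q) (\<lambda>x. F (f (q, x), g (q, x))) (\<lambda>x. dd (0, 1) (\<lambda>z. F (f z, g z)) (q, x))"
  unfolding C1_per_def
  by (intro conjI allI coefficient_deriv assms smooth_continuous_x[OF smooth_on_dd[OF smooth_on_compose2[OF open_DD]]])
     (simp add: assms)

text \<open>These four coefficients occur in the formulas for \<open>v_x\<close> and
  \<open>u\<close>, which have to be differentiated once more to obtain \<open>v_xx\<close> and
  \<open>u_x\<close>.\<close>

lemma C1_coefficients:
  assumes q: "q \<in> \<Omega>"
  obtains kk' ll' d1' d4' where "C1_per (\<Xi> q) (kk q) kk'" "C1_per (\<Xi> q) (ll q) ll'"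
    "C1_per (\<Xi> q) (d1 q) d1'" "C1_per (\<Xi> q) (d4 q) d4'"
proof -
  note per = profile_periodic[OF q]
  have "C1_per (\<Xi> q) (ka q) (\<lambda>x. dd (0, 1) (\<lambda>z. E22 (vv z, vx z)) (q, x))"
    unfolding ka_def[abs_def]
    by (rule C1_per_compose[where F = E22 and f = vv and g = vx, OF IE_smooth(6) smooth_profile(1,3) q per(1,3)])
  then obtain ka' where ka: "C1_per (\<Xi> q) (ka q) ka'" by blast
  have "C1_per (\<Xi> q) (ee q) (\<lambda>x. dd (0, 1) (\<lambda>z. E12 (vv z, vx z)) (q, x))"
    unfolding ee_def[abs_def]
    by (rule C1_per_compose[where F = E12 and f = vv and g = vx, OF IE_smooth(6) smooth_profile(1,3) q per(1,3)])
  then obtain ee' where ee: "C1_per (\<Xi> q) (ee q) ee'" by blast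
  have "C1_per (\<Xi> q) (be q) (\<lambda>x. dd (0, 1) (\<lambda>z. I22 (vv z, uu z)) (q, x))"
    unfolding be_def[abs_def]
    by (rule C1_per_compose[where F = I22 and f = vv and g = uu, OF IE_smooth(5) smooth_profile(1,2) q per(1,2)])
  then obtain be' where be: "C1_per (\<Xi> q) (be q) be'" by blast
  have "C1_per (\<Xi> q) (\<lambda>x. I12 (vv (q, x), uu (q, x)) - (- (q $ 4 * b))) (\<lambda>x. dd (0, 1) (\<lambda>z. I12 (vv z, uu z)) (q, x) - 0)"
    by (rule C1_per_diff[OF C1_per_compose[where F = I12 and f = vv and g = uu, OF IE_smooth(5) smooth_profile(1,2) q per(1,2)] C1_per_const])
  then obtain al' where al: "C1_per (\<Xi> q) (al q) al'"
    unfolding al_def[abs_def] diff_minus_eq_add by blast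
  have nz: "ka q x \<noteq> 0" "be q x \<noteq> 0" for x
    using ka_pos[of q x] be_pos[of q x] by auto
  have d1: "d1 q = (\<lambda>x. (- 1 * ee q x) * (1 / ka q x))" and d4: "d4 q = (\<lambda>x. al q x * (1 / be q x))"
    by (auto simp: d1_def d4_def)
  have kk: "kk q = (\<lambda>x. 1 / ka q x)" and ll: "ll q = (\<lambda>x. 1 / be q x)"
    by (auto simp: kk_def ll_def)
  show thesis
  proof (rule that)
    show "C1_per (\<Xi> q) (kk q) (\<lambda>x. - (ka' x / (ka q x * ka q x)))"
      unfolding kk by (rule C1_per_inverse[OF ka nz(1)])
    show "C1_per (\<Xi> q) (ll q) (\<lambda>x. - (be' x / (be q x * be q x)))"
      unfolding ll by (rule C1_per_inverse[OF be nz(2)])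
    show "C1_per (\<Xi> q) (d1 q) (\<lambda>x. (- 1 * ee q x) * - (ka' x / (ka q x * ka q x)) + (- 1 * ee' x + 0 * ee q x) * (1 / ka q x))"
      unfolding d1 by (rule C1_per_mult[OF C1_per_mult[OF C1_per_const ee] C1_per_inverse[OF ka nz(1)]])
    show "C1_per (\<Xi> q) (d4 q) (\<lambda>x. al q x * - (be' x / (be q x * be q x)) + al' x * (1 / be q x))"
      unfolding d4 by (rule C1_per_mult[OF al C1_per_inverse[OF be nz(2)]])
  qed
qed

lemma coefficients_periodic:
  assumes "q \<in> \<Omega>"
  shows "kk q (x + \<Xi> q) = kk q x" "ll q (x + \<Xi> q) = ll q x" "d1 q (x + \<Xi> q) = d1 q x" "d2 q (x + \<Xi> q) = d2 q x"
    "d3 q (x + \<Xi> q) = d3 q x" "d4 q (x + \<Xi> q) = d4 q x" "d5 q (x + \<Xi> q) = d5 q x"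
  by (simp_all add: kk_def ll_def d1_def d2_def d3_def d4_def d5_def ka_def ee_def mm_def al_def be_def profile_periodic[OF assms])

end

section \<open>The Evans function at real spectral parameter\<close>

lemma column_matrix_mult: "column j (A ** C) = A *v column j C"
  by (simp add: vec_eq_iff column_def matrix_matrix_mult_def matrix_vector_mult_def)

context profile_family begin

abbreviation "SOL q r Y \<equiv> wave_system.sol (kk q) (ll q) (d1 q) (d2 q) (d3 q) (d4 q) (d5 q) b r Y"

lemma SOL_iff:
  assumes "q \<in> \<Omega>"
  shows "SOL q r Y \<longleftrightarrow> (\<forall>x. ((\<lambda>x. Y x $ 1) has_real_derivative dw q x (Y x)) (at x) \<and>
    ((\<lambda>x. Y x $ 2) has_real_derivative dP q x (Y x)) (at x) \<and>
    ((\<lambda>x. Y x $ 3) has_real_derivative r * b * N3 q x (Y x)) (at x) \<and>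
    ((\<lambda>x. Y x $ 4) has_real_derivative r * b * Y x $ 1) (at x))"
proof -
  interpret W: wave_system "kk q" "ll q" "d1 q" "d2 q" "d3 q" "d4 q" "d5 q" b "\<Xi> q"
    by (rule wave_system[OF assms])
  show ?thesis
    unfolding W.sol_def has_vector_derivative_vec_iff forall_4 has_real_derivative_iff_has_vector_derivative[symmetric]
      W.M_mult vector_4 ..
qed

lemma coefficient_inverse:
  "d1 q x * w + kk q x * (ee q x * w + ka q x * w') = w'" "ll q x * (al q x * w + be q x * s) - d4 q x * w = s"
  unfolding d1_def kk_def ll_def d4_def using ka_pos[of q x] be_pos[of q x] by (simp_all add: field_simps)

text \<open>For real \<open>r\<close> the coefficients are real, so real and imaginary parts of a
  complex solution solve the real system; \<open>pr\<close> is \<open>Re\<close> or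
  \<open>Im\<close>. This reduces uniqueness of the complex fundamental matrix to the real
  case.\<close>

lemma real_part_solution:
  assumes q: "q \<in> \<Omega>" and inv: "matrix_inv B ** B = mat 1"
    and pr: "bounded_linear pr" "\<And>c z. pr (complex_of_real c * z) = c * pr z"
    and W: "lin_graph classical_deriv B (K (q $ 4)) (U q) W (\<lambda>x. of_real r *s W x)"
    and v1: "classical_deriv (\<lambda>x. W x $ 1) v1"
  obtains Y where "SOL q r Y" "\<And>x. pr (W x $ 1) = Y x $ 1" "\<And>x. pr (v1 x) = dw q x (Y x)"
    "\<And>x. pr (W x $ 2) = du q x (Y x)"
proof -
  obtain W' P' G' where W': "classical_deriv W W'"
    and P': "classical_deriv (\<lambda>x. momentum q W W' x) P'"
    and G': "classical_deriv (\<lambda>x. variation q W W' P' x) G'"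
    and F: "(\<lambda>x. of_real r *s W x) = (\<lambda>x. cmat B *v G' x)"
    using W unfolding lin_graph_iff[OF q] by blast
  note lin = linear_add[OF bounded_linear.linear[OF pr(1)]] linear_diff[OF bounded_linear.linear[OF pr(1)]] pr(2)
  have W'1: "W' x $ 1 = v1 x" for x
    using has_vector_derivative_vec_nth[OF W'[unfolded classical_deriv_def, rule_format, of x], of 1]
      v1[unfolded classical_deriv_def, rule_format, of x] vector_derivative_unique_at by blast
  \<comment> \<open>The Hamiltonian does not depend on \<open>u_x\<close>, so the second momentum
    vanishes identically.\<close>
  have P'2: "P' x $ 2 = 0" for x
  proof -
    have "((\<lambda>x. 0 :: complex) has_vector_derivative P' x $ 2) (at x)"
      using has_vector_derivative_vec_nth[OF P'[unfolded classical_deriv_def, rule_format, of x], of 2] by simp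
    from vector_derivative_unique_at[OF this has_vector_derivative_const] show ?thesis .
  qed
  have G'_eq: "G' x = cmat (matrix_inv B) *v (of_real r *s W x)" for x
  proof -
    have "cmat (matrix_inv B) *v (of_real r *s W x) = cmat (matrix_inv B ** B) *v G' x"
      using fun_cong[OF F, of x] by (simp add: matrix_vector_mul_assoc cmat_mult)
    then show ?thesis by (simp add: inv cmat_one)
  qed
  have G'1: "G' x $ 1 = of_real r * (of_real a * W x $ 1 + of_real b * W x $ 2)"
    and G'2: "G' x $ 2 = of_real r * (of_real b * W x $ 1)" for x
    unfolding G'_eq B by (simp_all add: matrix_vector_mult_def sum_2 cmat_def algebra_simps)
  \<comment> \<open>The momentum and the variation, written with the projected components, in the
    places of \<open>P\<close> and \<open>g\<close>.\<close>
  define Y :: "real \<Rightarrow> real ^ 4" where "Y x = vector [pr (W x $ 1), ee q x * pr (W x $ 1) + ka q x * pr (v1 x),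
    mm q x * pr (W x $ 1) + al q x * pr (W x $ 2) + ee q x * pr (v1 x) - pr (P' x $ 1), al q x * pr (W x $ 1) + be q x * pr (W x $ 2)]" for x
  have Y1: "pr (W x $ 1) = Y x $ 1" for x by (simp add: Y_def)
  have Yv: "pr (v1 x) = dw q x (Y x)" for x
    by (simp add: Y_def coefficient_inverse)
  have Y2: "pr (W x $ 2) = du q x (Y x)" for x
    by (simp add: Y_def coefficient_inverse)
  have prD: "((\<lambda>x. pr (f x)) has_real_derivative pr f') (at x)" if "(f has_vector_derivative f') (at x)" for f f' x
    unfolding has_real_derivative_iff_has_vector_derivative by (rule bounded_linear.has_vector_derivative[OF pr(1) that])
  have "SOL q r Y"
    unfolding SOL_iff[OF q]
  proof (intro allI conjI)
    fix x
    have "((\<lambda>x. pr (W x $ 1)) has_real_derivative pr (v1 x)) (at x)"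
      by (rule prD) (use v1 in \<open>simp add: classical_deriv_def\<close>)
    then show "((\<lambda>x. Y x $ 1) has_real_derivative dw q x (Y x)) (at x)"
      unfolding Y1 Yv .
    have "((\<lambda>x. pr (of_real (ee q x) * W x $ 1 + of_real (ka q x) * v1 x)) has_real_derivative pr (P' x $ 1)) (at x)"
      using prD[OF has_vector_derivative_vec_nth[OF P'[unfolded classical_deriv_def, rule_format, of x], of 1]]
      unfolding W'1 by simp
    then have D2: "((\<lambda>x. Y x $ 2) has_real_derivative pr (P' x $ 1)) (at x)"
      unfolding lin by (simp add: Y_def)
    have "pr (P' x $ 1) = mm q x * Y x $ 1 + al q x * (du q x (Y x))
        + ee q x * (dw q x (Y x)) - Y x $ 3"
      unfolding Y2[symmetric] Yv[symmetric] by (simp add: Y_def)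
    also have "\<dots> = dP q x (Y x)"
      unfolding coefficient_algebra(3) by simp
    finally show "((\<lambda>x. Y x $ 2) has_real_derivative dP q x (Y x)) (at x)"
      using D2 by simp
    have "((\<lambda>x. pr (of_real (mm q x) * W x $ 1 + of_real (al q x) * W x $ 2 + of_real (ee q x) * v1 x - P' x $ 1))
        has_real_derivative pr (G' x $ 1)) (at x)"
      using prD[OF has_vector_derivative_vec_nth[OF G'[unfolded classical_deriv_def, rule_format, of x], of 1]]
      unfolding W'1 by simp
    then have D3: "((\<lambda>x. Y x $ 3) has_real_derivative pr (G' x $ 1)) (at x)"
      unfolding lin by (simp add: Y_def)
    have "pr (G' x $ 1) = r * (a * Y x $ 1 + b * (du q x (Y x)))"
      unfolding G'1 lin Y1 Y2 ..
    then show "((\<lambda>x. Y x $ 3) has_real_derivative r * b * N3 q x (Y x)) (at x)"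
      using D3 unfolding coefficient_algebra(4) by (simp add: mult.assoc)
    have "((\<lambda>x. pr (of_real (al q x) * W x $ 1 + of_real (be q x) * W x $ 2)) has_real_derivative pr (G' x $ 2)) (at x)"
      using prD[OF has_vector_derivative_vec_nth[OF G'[unfolded classical_deriv_def, rule_format, of x], of 2]]
      unfolding P'2 by simp
    then have "((\<lambda>x. Y x $ 4) has_real_derivative pr (G' x $ 2)) (at x)"
      unfolding lin by (simp add: Y_def)
    then show "((\<lambda>x. Y x $ 4) has_real_derivative r * b * Y x $ 1) (at x)"
      unfolding G'2 lin Y1 by (simp add: mult.assoc)
  qed
  then show thesis using that Y1 Yv Y2 by blast
qed

lemma evans_eq:
  assumes q: "q \<in> \<Omega>" and inv: "B ** matrix_inv B = mat 1" "matrix_inv B ** B = mat 1"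
  shows "evans B (K (q $ 4)) (U q) (\<Xi> q) (of_real r) = of_real (DT q r)"
proof -
  interpret W: wave_system "kk q" "ll q" "d1 q" "d2 q" "d3 q" "d4 q" "d5 q" b "\<Xi> q"
    by (rule wave_system[OF q])
  obtain kk' ll' d1' d4' where C1: "C1_per (\<Xi> q) (kk q) kk'" "C1_per (\<Xi> q) (ll q) ll'"
    "C1_per (\<Xi> q) (d1 q) d1'" "C1_per (\<Xi> q) (d4 q) d4'"
    by (rule C1_coefficients[OF q])
  \<comment> \<open>Takes \<open>Y\<close> to \<open>(v, v_x, v_xx, u)\<close>; the third row arises
    by differentiating the equation for \<open>v_x\<close>. The determinant \<open>- k^2 l\<close>
    is nonzero, and the normalised fundamental matrix is \<open>T x ** Phi r x ** S\<close> with
    \<open>S\<close> the inverse of \<open>T 0\<close>.\<close>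
  define T :: "real \<Rightarrow> real ^ 4 ^ 4" where "T x = vector [vector [1, 0, 0, 0], vector [d1 q x, kk q x, 0, 0],
    vector [d1' x + d1 q x * d1 q x + kk q x * d2 q x, d1 q x * kk q x + kk' x + kk q x * d3 q x, - kk q x, kk q x * d4 q x],
    vector [- d4 q x, 0, 0, ll q x]]" for x
  define w'' where "w'' Y x = d1 q x * (dw q x (Y x)) + d1' x * Y x $ 1
    + (kk q x * (dP q x (Y x)) + kk' x * Y x $ 2)" for Y :: "real \<Rightarrow> real ^ 4" and x
  have T_mult: "T x *v Y x = vector [Y x $ 1, dw q x (Y x), w'' Y x, du q x (Y x)]" for x Y
    by (simp add: T_def w''_def vec_eq_iff forall_4 matrix_vector_mult_def sum_4 algebra_simps)
  have "det (T 0) = - (kk q 0 * kk q 0 * ll q 0)"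
    by (simp add: det_4 T_def)
  then have "det (T 0) \<noteq> 0"
    using W.k_pos[of 0] W.l_pos[of 0] by simp
  then obtain S where S: "T 0 ** S = mat 1" "S ** T 0 = mat 1"
    using invertible_det_nz[of "T 0"] unfolding invertible_def by blast
  define F0 where "F0 x = T x ** W.Phi r x ** S" for x
  have colF0: "column j (F0 x) = T x *v (W.Phi r x *v column j S)" for j x
    by (simp add: F0_def column_matrix_mult matrix_vector_mul_assoc)
  have DW'': "((\<lambda>x. dw q x (Y x)) has_real_derivative w'' Y x) (at x)" if "SOL q r Y" for Y x
    unfolding w''_def using that unfolding SOL_iff[OF q]
    by (intro DERIV_add DERIV_mult' C1_perD(1)[OF C1(1)] C1_perD(1)[OF C1(3)]) blast+
  have fund: "fundamental_solution B (K (q $ 4)) (U q) (of_real r) (\<lambda>x. cmat (F0 x))"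
    unfolding fundamental_solution_def
  proof (intro conjI allI)
    show "cmat (F0 0) = mat 1" by (simp add: F0_def W.Phi_0 S cmat_one)
    fix j
    define Y where "Y x = W.Phi r x *v column j S" for x
    have Y: "SOL q r Y" unfolding Y_def[abs_def] by (rule W.sol_Phi)
    let ?W = "cvec (\<lambda>x. Y x $ 1) (\<lambda>x. du q x (Y x))"
    have "lin_graph classical_deriv B (K (q $ 4)) (U q) ?W (\<lambda>x. of_real r *s ?W x)"
    proof (rule lin_graph_of_solution[OF q inv(1), where R = "\<lambda>f f'. \<forall>x. (f has_real_derivative f' x) (at x)"
          and s' = "\<lambda>x. (ll q x * (r * b * Y x $ 1) + ll' x * Y x $ 4) - (d4 q x * (dw q x (Y x)) + d4' x * Y x $ 1)"])
      show "\<forall>x. ((\<lambda>x. du q x (Y x)) has_real_derivative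
          (ll q x * (r * b * Y x $ 1) + ll' x * Y x $ 4) - (d4 q x * (dw q x (Y x)) + d4' x * Y x $ 1)) (at x)"
        using Y unfolding SOL_iff[OF q]
        by (intro allI DERIV_diff DERIV_mult' C1_perD(1)[OF C1(2)] C1_perD(1)[OF C1(4)]) blast+
    qed (use Y cvec_deriv in \<open>auto simp: SOL_iff[OF q] classical_deriv_def\<close>)
    moreover have "classical_deriv (\<lambda>x. ?W x $ 1) (\<lambda>x. of_real (dw q x (Y x)))"
      unfolding classical_deriv_def cvec_nth
      by (intro allI has_vector_derivative_of_real) (use Y in \<open>simp add: SOL_iff[OF q]\<close>)
    moreover have "classical_deriv (\<lambda>x. complex_of_real (dw q x (Y x))) (\<lambda>x. of_real (w'' Y x))"
      unfolding classical_deriv_def by (intro allI has_vector_derivative_of_real DW'' Y)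
    moreover have "column j (cmat (F0 x)) = vector [?W x $ 1, of_real (dw q x (Y x)), of_real (w'' Y x), ?W x $ 2]" for x
    proof -
      have "column j (cmat (F0 x)) = (\<chi> i. of_real (column j (F0 x) $ i))"
        by (simp add: vec_eq_iff column_def cmat_def)
      then show ?thesis
        unfolding colF0 Y_def[symmetric] T_mult by (simp add: vec_eq_iff forall_4)
    qed
    ultimately show "\<exists>W v1 v2. lin_graph classical_deriv B (K (q $ 4)) (U q) W (\<lambda>x. of_real r *s W x) \<and>
        classical_deriv (\<lambda>x. W x $ 1) v1 \<and> classical_deriv v1 v2 \<and>
        (\<forall>x. column j (cmat (F0 x)) = vector [W x $ 1, v1 x, v2 x, W x $ 2])"
      by blast
  qed
  \<comment> \<open>Uniqueness gives meaning to the \<open>THE\<close> in the definition of the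
    Evans function. Each column is split into real and imaginary parts, and both are compared with
    \<open>F0\<close>.\<close>
  have unique: "F = (\<lambda>x. cmat (F0 x))" if F: "fundamental_solution B (K (q $ 4)) (U q) (of_real r) F" for F
  proof
    fix x
    have part: "(\<chi> i. pr (F x $ i $ j)) = F0 x *v (\<chi> i. pr ((mat 1 :: complex ^ 4 ^ 4) $ i $ j))"
      if pr: "bounded_linear pr" "\<And>c z. pr (complex_of_real c * z) = c * pr z" for pr j x
    proof -
      obtain W v1 v2 where W: "lin_graph classical_deriv B (K (q $ 4)) (U q) W (\<lambda>x. of_real r *s W x)"
        "classical_deriv (\<lambda>x. W x $ 1) v1" "classical_deriv v1 v2"
        and col: "\<And>x. column j (F x) = vector [W x $ 1, v1 x, v2 x, W x $ 2]"
        using F unfolding fundamental_solution_def by blast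
      obtain Y where Y: "SOL q r Y" "\<And>x. pr (W x $ 1) = Y x $ 1" "\<And>x. pr (v1 x) = dw q x (Y x)"
        "\<And>x. pr (W x $ 2) = du q x (Y x)"
        by (rule real_part_solution[OF q inv(2) pr W(1,2)]) (rule that)
      have "((\<lambda>x. pr (v1 x)) has_real_derivative pr (v2 x)) (at x)" for x
        unfolding has_real_derivative_iff_has_vector_derivative
        by (rule bounded_linear.has_vector_derivative[OF pr(1)]) (use W(3) in \<open>simp add: classical_deriv_def\<close>)
      then have v2: "pr (v2 x) = w'' Y x" for x
        unfolding Y(3) using DW''[OF Y(1)] DERIV_unique by blast
      have colY: "(\<chi> i. pr (F x $ i $ j)) = T x *v Y x" for x
      proof -
        have "(\<chi> i. pr (F x $ i $ j)) = (\<chi> i. pr (column j (F x) $ i))"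
          by (simp add: column_def)
        then show ?thesis
          unfolding col T_mult by (simp add: vec_eq_iff forall_4 Y v2)
      qed
      have "Y 0 = S *v (T 0 *v Y 0)"
        by (simp add: matrix_vector_mul_assoc S)
      also have "\<dots> = S *v (\<chi> i. pr ((mat 1 :: complex ^ 4 ^ 4) $ i $ j))"
        unfolding colY[symmetric] using F by (simp add: fundamental_solution_def)
      finally have "T x *v Y x = T x *v (W.Phi r x *v (S *v (\<chi> i. pr ((mat 1 :: complex ^ 4 ^ 4) $ i $ j))))"
        using W.sol_eq_Phi[OF Y(1), of x] by simp
      then show ?thesis
        unfolding colY F0_def by (simp add: matrix_vector_mul_assoc matrix_mul_assoc)
    qed
    have "F x $ i $ j = of_real (F0 x $ i $ j)" for i j
    proof (rule complex_eqI)
      have "(\<chi> i. Re ((mat 1 :: complex ^ 4 ^ 4) $ i $ j)) = axis j 1"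
        by (simp add: vec_eq_iff mat_def axis_def)
      then have "Re (F x $ i $ j) = (F0 x *v axis j 1) $ i"
        using part[of Re x j, OF bounded_linear_Re] by (simp add: vec_eq_iff)
      then show "Re (F x $ i $ j) = Re (of_real (F0 x $ i $ j))"
        by (simp add: matrix_vector_mult_basis column_def)
      have "(\<chi> i. Im ((mat 1 :: complex ^ 4 ^ 4) $ i $ j)) = 0"
        by (simp add: vec_eq_iff mat_def)
      then have "(\<chi> i. Im (F x $ i $ j)) = F0 x *v 0"
        using part[of Im x j, OF bounded_linear_Im] by simp
      then have "Im (F x $ i $ j) = 0"
        by (simp add: vec_eq_iff)
      then show "Im (F x $ i $ j) = Im (of_real (F0 x $ i $ j))" by simp
    qed
    then show "F x = cmat (F0 x)" by (simp add: vec_eq_iff cmat_def)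
  qed
  have "(THE F. fundamental_solution B (K (q $ 4)) (U q) (of_real r) F) = (\<lambda>x. cmat (F0 x))"
    by (rule the_equality[where P = "fundamental_solution B (K (q $ 4)) (U q) (of_real r)", OF fund unique])
  then have "evans B (K (q $ 4)) (U q) (\<Xi> q) (of_real r) = of_real (det (F0 (\<Xi> q) - F0 0))"
    by (simp add: evans_def Let_def cmat_diff[symmetric] det_cmat)
  also have "F0 (\<Xi> q) - F0 0 = T 0 ** (W.Phi r (\<Xi> q) - mat 1) ** S"
  proof -
    have "T (\<Xi> q) = T 0"
      using coefficients_periodic[OF q, of 0] C1_perD(5)[OF C1(1), of 0] C1_perD(5)[OF C1(3), of 0]
      by (simp add: T_def)
    then show ?thesis
      by (simp add: F0_def W.Phi_0 bounded_bilinear.diff_left[OF bounded_bilinear_matrix_matrix]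
          bounded_bilinear.diff_right[OF bounded_bilinear_matrix_matrix])
  qed
  also have "det (T 0 ** (W.Phi r (\<Xi> q) - mat 1) ** S) = DT q r"
  proof -
    have "det (T 0) * det S = 1"
      using arg_cong[OF S(1), of det] by (simp add: det_mul)
    then show ?thesis
      by (simp add: det_mul DT_def W.Dt_def algebra_simps)
  qed
  finally show ?thesis .
qed

end

section \<open>Instability\<close>

context profile_family begin

text \<open>The periodic solution yields a nonzero \<open>W\<close> in the domain of the operator
  with \<open>A W = r W\<close>. The resolvent estimate would bound its norm by 0, so the nonzero
  real number \<open>r\<close> lies in the spectrum.\<close>

lemma unstable_of_zero:
  assumes q: "q \<in> \<Omega>" and inv: "B ** matrix_inv B = mat 1" and r: "r \<noteq> 0" and zero: "DT q r = 0"
  shows "\<not> coperiodically_stable B (K (q $ 4)) (U q) (\<Xi> q)"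
proof -
  interpret W: wave_system "kk q" "ll q" "d1 q" "d2 q" "d3 q" "d4 q" "d5 q" b "\<Xi> q"
    by (rule wave_system[OF q])
  let ?X = "\<Xi> q"
  have X: "?X > 0" by (rule \<Xi>_pos[OF q])
  obtain Y where Y: "SOL q r Y" "Y ?X = Y 0" "\<And>x. Y x \<noteq> 0"
    using W.Dt_zero_solution zero unfolding DT_def by blast
  note YD = Y(1)[unfolded SOL_iff[OF q], rule_format]
  \<comment> \<open>Periodicity of the coefficients makes the shifted solution a solution of the
    same system, with the same initial value.\<close>
  have Yper: "Y (x + ?X) = Y x" for x
  proof -
    have "SOL q r (\<lambda>x. Y (x + ?X))"
      unfolding SOL_iff[OF q]
    proof (intro allI conjI)
      fix x
      have shift: "((\<lambda>x. f (x + ?X)) has_real_derivative f') (at x)" if "(f has_real_derivative f') (at (x + ?X))" for f f'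
        using that DERIV_shift by blast
      note c = coefficients_periodic[OF q, of x]
      note D = YD[of "x + ?X", unfolded c]
      show "((\<lambda>x. Y (x + ?X) $ 1) has_real_derivative dw q x (Y (x + ?X))) (at x)"
        by (rule shift[of "\<lambda>x. Y x $ 1"]) (use D in blast)
      show "((\<lambda>x. Y (x + ?X) $ 2) has_real_derivative dP q x (Y (x + ?X))) (at x)"
        by (rule shift[of "\<lambda>x. Y x $ 2"]) (use D in blast)
      show "((\<lambda>x. Y (x + ?X) $ 3) has_real_derivative r * b * N3 q x (Y (x + ?X))) (at x)"
        by (rule shift[of "\<lambda>x. Y x $ 3"]) (use D in blast)
      show "((\<lambda>x. Y (x + ?X) $ 4) has_real_derivative r * b * Y (x + ?X) $ 1) (at x)"
        by (rule shift[of "\<lambda>x. Y x $ 4"]) (use D in blast)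
    qed
    then show ?thesis
      by (rule W.sol_unique[OF _ Y(1)]) (simp add: Y(2))
  qed
  obtain kk' ll' d1' d4' where C1: "C1_per ?X (kk q) kk'" "C1_per ?X (ll q) ll'"
    "C1_per ?X (d1 q) d1'" "C1_per ?X (d4 q) d4'"
    by (rule C1_coefficients[OF q])
  have Yc: "continuous_on UNIV (\<lambda>x. Y x $ i)" for i
    by (rule continuous_on_component[OF W.sol_continuous[OF Y(1)]])
  have C1_perI: "C1_per ?X (\<lambda>x. Y x $ i) f'"
    if "\<And>x. ((\<lambda>x. Y x $ i) has_real_derivative f' x) (at x)" "continuous_on UNIV f'" for i f'
    using that by (simp add: C1_per_def Yper)
  have R1: "C1_per ?X (\<lambda>x. Y x $ 1) (\<lambda>x. dw q x (Y x))"
    by (rule C1_perI) (use YD in blast, intro continuous_on_add continuous_on_mult Yc W.cont)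
  have R2: "C1_per ?X (\<lambda>x. Y x $ 2) (\<lambda>x. dP q x (Y x))"
    by (rule C1_perI) (use YD in blast, intro continuous_on_add continuous_on_diff continuous_on_mult Yc W.cont)
  have R3: "C1_per ?X (\<lambda>x. Y x $ 3) (\<lambda>x. r * b * N3 q x (Y x))"
    by (rule C1_perI) (use YD in blast, intro continuous_on_add continuous_on_mult continuous_on_const Yc W.cont)
  have R4: "C1_per ?X (\<lambda>x. Y x $ 4) (\<lambda>x. r * b * Y x $ 1)"
    by (rule C1_perI) (use YD in blast, intro continuous_on_mult continuous_on_const Yc)
  let ?s = "\<lambda>x. du q x (Y x)"
  let ?W = "cvec (\<lambda>x. Y x $ 1) ?s"
  note Rs = C1_per_diff[OF C1_per_mult[OF C1(2) R4] C1_per_mult[OF C1(4) R1]]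
  have W: "lin_graph (weak_deriv_per ?X) B (K (q $ 4)) (U q) ?W (\<lambda>x. of_real r *s ?W x)"
    by (rule lin_graph_of_solution[where R = "C1_per ?X" and der = "weak_deriv_per ?X" and Y = Y,
          OF q inv weak_deriv_cvec[OF X] R1 Rs R2 C1_per_const R3 R4])
  have cont: "continuous_on {0..?X} (\<lambda>x. (norm (?W x))\<^sup>2)"
    by (intro continuous_on_power continuous_on_norm cvec_continuous C1_perD(3)[OF R1] C1_perD(3)[OF Rs])
  have L2: "(LINT x:{0..?X}|lborel. (norm (?W x))\<^sup>2) = integral {0..?X} (\<lambda>x. (norm (?W x))\<^sup>2)"
    by (rule set_borel_integral_eq_integral(2)[OF borel_integrable_atLeastAtMost'[OF cont]])
  have pos: "L2_norm ?X ?W > 0"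
  \<comment> \<open>A continuous \<open>W\<close> of norm zero vanishes on the whole interval. The
    equations then force the other components of \<open>Y\<close> to vanish as well, although
    \<open>Y\<close> has no zero.\<close>
  proof (rule ccontr)
    assume "\<not> ?thesis"
    then have "integral {0..?X} (\<lambda>x. (norm (?W x))\<^sup>2) \<le> 0"
      unfolding L2_norm_def L2 by simp
    moreover have "integral {0..?X} (\<lambda>x. (norm (?W x))\<^sup>2) \<ge> 0"
      by (rule integral_nonneg[OF integrable_continuous_real[OF cont]]) simp
    ultimately have "\<forall>x\<in>{0..?X}. (norm (?W x))\<^sup>2 = 0"
      using integral_eq_0_iff[OF cont X] by simp
    then have W0: "?W x = 0" if "x \<in> {0..?X}" for x
      using that by simp
    have Y1: "Y x $ 1 = 0" and s0: "?s x = 0" if "x \<in> {0..?X}" for x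
      using arg_cong[OF W0[OF that], of "\<lambda>w. w $ 1"] arg_cong[OF W0[OF that], of "\<lambda>w. w $ 2"]
      by (simp_all only: cvec_nth zero_index of_real_eq_0_iff)
    have Y4: "Y x $ 4 = 0" if "x \<in> {0..?X}" for x
      using s0[OF that] Y1[OF that] W.l_pos[of x] by simp
    \<comment> \<open>The open interval is needed because the derivatives are two-sided; the
      midpoint of the period will serve as the interior point.\<close>
    have zero_deriv: "f' = 0" if "(f has_real_derivative f') (at x)" "\<And>y. y \<in> {0<..<?X} \<Longrightarrow> f y = 0" "x \<in> {0<..<?X}" for f f' x
    proof -
      have "(f has_real_derivative 0) (at x)"
        by (rule has_field_derivative_transform_within_open[OF DERIV_const open_greaterThanLessThan that(3)])
           (use that(2) in simp)
      with that(1) show ?thesis by (rule DERIV_unique)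
    qed
    have w'0: "dw q x (Y x) = 0" if "x \<in> {0<..<?X}" for x
      by (rule zero_deriv[OF C1_perD(1)[OF R1] _ that]) (use Y1 in simp)
    have Y2: "Y x $ 2 = 0" if "x \<in> {0<..<?X}" for x
      using w'0[OF that] Y1[of x] W.k_pos[of x] that by simp
    have "dP q x (Y x) = 0" if "x \<in> {0<..<?X}" for x
      by (rule zero_deriv[OF C1_perD(1)[OF R2] _ that]) (use Y2 in simp)
    then have Y3: "Y x $ 3 = 0" if "x \<in> {0<..<?X}" for x
      using that Y1[of x] Y2[of x] Y4[of x] by fastforce
    have "?X / 2 \<in> {0<..<?X}" using X by simp
    then have "Y (?X / 2) = 0"
      using Y1[of "?X / 2"] Y2[of "?X / 2"] Y3[of "?X / 2"] Y4[of "?X / 2"]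
      by (simp add: vec_eq_iff forall_4)
    with Y(3) show False by blast
  qed
  have "of_real r \<notin> resolvent_set B (K (q $ 4)) (U q) ?X"
  proof
    assume "of_real r \<in> resolvent_set B (K (q $ 4)) (U q) ?X"
    then obtain C where "L2_norm ?X ?W \<le> C * L2_norm ?X (\<lambda>x. of_real r *s ?W x - of_real r *s ?W x)"
      unfolding resolvent_set_def using W by blast
    then have "L2_norm ?X ?W \<le> 0" by (simp add: L2_norm_def)
    with pos show False by simp
  qed
  then have "of_real r \<in> coperiodic_spectrum B (K (q $ 4)) (U q) ?X"
    by (simp add: coperiodic_spectrum_def)
  then show ?thesis
    unfolding coperiodically_stable_def using r by fastforce
qed

lemma DT_positive_large: "q \<in> \<Omega> \<Longrightarrow> \<forall>\<^sub>F r in at_top. DT q r > 0"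
  unfolding DT_def by (rule wave_system.Dt_positive_large[OF wave_system])

lemma DT_continuous: "q \<in> \<Omega> \<Longrightarrow> isCont (DT q) r"
  unfolding DT_def[abs_def] by (rule wave_system.Dt_continuous[OF wave_system])

lemma unstable_of_negative_hessian:
  assumes q: "q \<in> \<Omega>" and inv: "B ** matrix_inv B = mat 1"
    and neg: "det (Hess\<Theta> q) < 0"
  shows "\<not> coperiodically_stable B (K (q $ 4)) (U q) (\<Xi> q)"
proof -
  have "b\<^sup>2 * det (Hess\<Theta> q) < 0"
    using neg b_nz by (simp add: mult_pos_neg)
  from order_tendstoD(2)[OF DT_limit[OF q] this]
  have "\<forall>\<^sub>F r in at_right 0. DT q r / r ^ 4 < 0 \<and> r \<in> {0<..<1}"
    by (intro eventually_conj eventually_at_right_real) (auto simp: eventually_at_split)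
  then obtain r0 where r0: "r0 > 0" "DT q r0 / r0 ^ 4 < 0"
    by (metis (no_types, lifting) eventually_happens trivial_limit_at_right_real greaterThanLessThan_iff)
  then have r0n: "DT q r0 < 0" by (simp add: divide_less_0_iff)
  obtain r1 where r1: "r1 \<ge> r0" "DT q r1 > 0"
    using eventually_conj[OF DT_positive_large[OF q] eventually_ge_at_top[of r0]]
    by (metis (no_types, lifting) eventually_happens trivial_limit_at_top_linorder)
  have "\<exists>r\<ge>r0. r \<le> r1 \<and> DT q r = 0"
    by (rule IVT) (use r0n r1 DT_continuous[OF q] in auto)
  then obtain r where "r \<ge> r0" "DT q r = 0" by blast
  then show ?thesis
    using unstable_of_zero[OF q inv, of r] r0 by simp
qed

lemma evans_expansion:
  assumes q: "q \<in> \<Omega>" and inv: "B ** matrix_inv B = mat 1" "matrix_inv B ** B = mat 1"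
  shows "(\<lambda>r::real. evans B (K (q $ 4)) (U q) (\<Xi> q) (of_real r) -
      of_real (r ^ 4 * (- det (matrix_inv B)) * det (Hess\<Theta> q)))
    \<in> o[at 0](\<lambda>r. of_real (r ^ 4))"
proof -
  let ?d = "b\<^sup>2 * det (Hess\<Theta> q)"
  have det: "- det (matrix_inv B) = b\<^sup>2"
    by (simp add: B det_2 power2_eq_square)
  have "(\<lambda>r. complex_of_real (DT q r - r ^ 4 * ?d)) \<in> o[at 0](\<lambda>r. of_real (r ^ 4))"
  proof (rule landau_o.smallI)
    fix c :: real assume c: "c > 0"
    have "\<forall>\<^sub>F r in at 0. dist (DT q r / r ^ 4) ?d < c"
      using DT_limit[OF q] c by (simp add: tendsto_iff)
    then show "\<forall>\<^sub>F r in at 0. norm (complex_of_real (DT q r - r ^ 4 * ?d)) \<le> c * norm (complex_of_real (r ^ 4))"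
      using eventually_neq_at_within[of 0 0 UNIV]
    proof eventually_elim
      case (elim r)
      have "DT q r - r ^ 4 * ?d = (DT q r / r ^ 4 - ?d) * r ^ 4"
        using elim by (simp add: field_simps)
      then have "\<bar>DT q r - r ^ 4 * ?d\<bar> = \<bar>DT q r / r ^ 4 - ?d\<bar> * \<bar>r ^ 4\<bar>"
        by (simp only: abs_mult)
      also have "\<dots> \<le> c * \<bar>r ^ 4\<bar>"
        using elim by (intro mult_right_mono) (auto simp: dist_real_def)
      finally show ?case by (simp only: norm_of_real)
    qed
  qed
  then show ?thesis
    unfolding evans_eq[OF assms] det by (simp add: mult.assoc)
qed

end

theorem theorem1:
  fixes B :: "real ^ 2 ^ 2" and a b :: real
    and I E :: "real \<times> real \<Rightarrow> real" and H :: density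
    and \<Omega> :: "(real ^ 4) set"
    and U :: "real ^ 4 \<Rightarrow> real \<Rightarrow> real ^ 2" and \<Xi> :: "real ^ 4 \<Rightarrow> real"
    and p :: "real ^ 4" and D :: "complex \<Rightarrow> complex" and \<Theta> :: "real ^ 4 \<Rightarrow> real"
  assumes "transpose B = B" and "invertible B"
    and "matrix_inv B = vector [vector [a, b], vector [b, 0]]" and "b \<noteq> 0"
    and "smooth_on UNIV I" and "smooth_on UNIV E"
    and "\<And>v u. pd (0, 1) (pd (0, 1) I) (v, u) > 0"
    and "\<And>v w. pd (0, 1) (pd (0, 1) E) (v, w) > 0"
    and "H = hamiltonian I E"
    and "open \<Omega>"
    and "smooth_on (\<Omega> \<times> UNIV) (\<lambda>(q, x). U q x)" and "smooth_on \<Omega> \<Xi>"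
    and "\<And>q. q \<in> \<Omega> \<Longrightarrow> \<Xi> q > 0"
    and "\<And>q x. q \<in> \<Omega> \<Longrightarrow> U q (x + \<Xi> q) = U q x"
    and "\<And>q. q \<in> \<Omega> \<Longrightarrow> \<not> (\<exists>k. \<forall>x. U q x = k)"
    and "\<And>q x. q \<in> \<Omega> \<Longrightarrow> var_deriv (plus_impulse H (par_c q) B) (U q) x = par_lambda q"
    and "\<And>q x. q \<in> \<Omega> \<Longrightarrow>
           U q x \<bullet> var_deriv H (U q) x + legendre H (U q) x + par_c q * impulse B (U q x) = par_mu q"
    and "p \<in> \<Omega>"
    and "D = evans B (plus_impulse H (par_c p) B) (U p) (\<Xi> p)"
    and "\<Theta> = action B H U \<Xi>"
  shows "(\<lambda>r::real. D (of_real r) -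
             of_real (r ^ 4 * (- det (matrix_inv B)) * det (hessian_matrix \<Theta> p)))
           \<in> o[at 0](\<lambda>r. of_real (r ^ 4))
       \<and> (\<forall>\<^sub>F r::real in at_top. D (of_real r) \<in> \<real> \<and> Re (D (of_real r)) > 0)
       \<and> (det (hessian_matrix \<Theta> p) < 0 \<longrightarrow>
            \<not> coperiodically_stable B (plus_impulse H (par_c p) B) (U p) (\<Xi> p))"
proof -
  interpret profile_family B a b I E \<Omega> U \<Xi>
    by unfold_locales (use assms(3-8,10-14,16-17) assms(9) in simp_all)
  \<comment> \<open>\<open>matrix_inv\<close> is defined by choice; invertibility of
    \<open>B\<close> makes the chosen matrix a two-sided inverse.\<close>
  have "\<exists>C. B ** C = mat 1 \<and> C ** B = mat 1"
    using assms(2) by (simp add: invertible_def)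
  then have inv: "B ** matrix_inv B = mat 1" "matrix_inv B ** B = mat 1"
    unfolding matrix_inv_def using someI_ex[of "\<lambda>C. B ** C = mat 1 \<and> C ** B = mat 1"] by blast+
  have K: "plus_impulse H (par_c p) B = K (p $ 4)"
    unfolding assms(9) plus_impulse_eq par_c_def ..
  have D: "D (of_real r) = of_real (DT p r)" for r
    unfolding assms(19) K by (rule evans_eq[OF assms(18) inv])
  have "\<forall>\<^sub>F r::real in at_top. D (of_real r) \<in> \<real> \<and> Re (D (of_real r)) > 0"
    using DT_positive_large[OF assms(18)] unfolding D by eventually_elim simp
  then show ?thesis
    using evans_expansion[OF assms(18) inv] unstable_of_negative_hessian[OF assms(18) inv(1)]
    unfolding assms(19,20) K unfolding assms(9) by blast
qed

end
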